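(* Suppose the following. (1) $\ell(y;a)$ is three times continuously differentiable and concave in $a$; there exist a bounded open interval $\mathcal I\supset\mathcal I_0$ and constants $C_0,C_1>0$ such that $E\{\exp(\sup_{a\in\mathcal I}|\ddot\ell_a(Y;a)|/C_0)\mid Z\}\le C_0$ and $E\{\exp(\sup_{a\in\mathcal I}|\ell'''_a(Y;a)|/C_0)\mid Z\}\le C_1$ a.s.; there is $C_2>0$ with $C_2^{-1}\le I(Z)\le C_2$ a.s.; and $E(\epsilon\mid Z)=0$, $E(\epsilon^2\mid Z)=I(Z)$ a.s. (2) There exist functions $h_\nu\in\mathcal H$, $\nu\in\mathbb N=\{0,1,2,\dots\}$, with $\sup_\nu\|h_\nu\|_{\sup}<\infty$, and a nondecreasing sequence $\gamma_\nu\asymp\nu^{2m}$, such that $V(h_\mu,h_\nu)=\delta_{\mu\nu}$ and $J(h_\mu,h_\nu)=\gamma_\mu\delta_{\mu\nu}$ for all $\mu,\nu$, and every $g\in\mathcal H$ admits the expansion $g=\sum_\nu V(g,h_\nu)h_\nu$ with convergence in $\|\cdot\|$. (3) $\|\widehat g_{n,\lambda}-g_0\|=O_P((nh)^{-1/2}+h^m)$. (4) $h=o(1)$ and $nh^2\to\infty$ as $n\to\infty$. Then $$\|\widehat g_{n,\lambda}-g_0-S_{n,\lambda}(g_0)\|=O_P(a_n\log n),$$ where $$a_n=n^{-1/2}\big((nh)^{-1/2}+h^m\big)h^{-(6m-1)/(4m)}(\log\log n)^{1/2}+C_\ell h^{-1/2}\big((nh)^{-1}+h^{2m}\big)/\log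 n$$ and $C_\ell=\sup_{z\in\mathbb I}E\{\sup_{a\in\mathcal I}|\ell'''_a(Y;a)|\mid Z=z\}$. When $h\asymp n^{-1/(2m+1)}$, the right-hand side is $o_P(n^{-m/(2m+1)})$.
   Context: Data: $T_i=(Y_i,Z_i)$, $i=1,\dots,n$, are i.i.d. copies of $T=(Y,Z)$, $Y\in\mathcal Y\subseteq\mathbb R$, $Z\in\mathbb I=[0,1]$, with $E(Y\mid Z)=F(g_0(Z))$, $F$ a known link function and $g_0\in\mathcal H$ the unknown true function, with range $\mathcal I_0$. The order $m>1/2$ is fixed and known. $\mathcal H$ is either the Sobolev space $H^m(\mathbb I)=\{g:\mathbb I\to\mathbb R: g^{(j)}$ absolutely continuous for $j=0,\dots,m-1$, $g^{(m)}\in L_2(\mathbb I)\}$ or its periodic subspace $H^m_0(\mathbb I)$ of those $g$ with $g^{(j)}(0)=g^{(j)}(1)$, $j=0,\dots,m-1$. $J(g,\widetilde g)=\int_{\mathbb I}g^{(m)}(z)\widetilde g^{(m)}(z)\,dz$. The criterion function $\ell:\mathcal Y\times\mathbb R\to\mathbb R$ is either $\ell(y;a)=\log p(y;F(a))$, where $p(y;\mu_0(z))$, $\mu_0=F(g_0)$, is the conditional density of $Y$ given $Z=z$, or the quasi-likelihood $\ell(y;a)=Q(y;F(a))$ with $Q(y;\mu)=\int_y^\mu (y-s)/\mathcal V(s)\,ds$, where $\mathrm{Var}(Y\mid Z)=\mathcal V(\mu_0(Z))$ for a known positive function $\mathcal V$. $\dot\ell_a,\ddot\ell_a,\ell'''_a$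 are the first three derivatives of $\ell(y;a)$ in $a$. $\epsilon=\dot\ell_a(Y;g_0(Z))$, $\epsilon_i=\dot\ell_a(Y_i;g_0(Z_i))$, $I(Z)=-E(\ddot\ell_a(Y;g_0(Z))\mid Z)$. The penalized estimate $\widehat g_{n,\lambda}$ (assumed to exist uniquely) maximizes $\ell_{n,\lambda}(g)=\frac1n\sum_{i=1}^n\ell(Y_i;g(Z_i))-(\lambda/2)J(g,g)$ over $g\in\mathcal H$; $\lambda=\lambda_n>0$, $\lambda\to0$ as $n\to\infty$, and $h=\lambda^{1/(2m)}$. $V(g,\widetilde g)=E\{I(Z)g(Z)\widetilde g(Z)\}$; $\langle g,\widetilde g\rangle=V(g,\widetilde g)+\lambda J(g,\widetilde g)$, $\|g\|^2=\langle g,g\rangle$; with this inner product $\mathcal H$ is a reproducing kernel Hilbert space with kernel $K$, $K_z=K(z,\cdot)\in\mathcal H$, $\langle K_z,g\rangle=g(z)$. $W_\lambda:\mathcal H\to\mathcal H$ is the self-adjoint operator with $\langle W_\lambda g,\widetilde g\rangle=\lambda J(g,\widetilde g)$. $S_{n,\lambda}(g_0)=\frac1n\sum_{i=1}^n\epsilon_iK_{Z_i}-W_\lambda g_0$. $\|g\|_{\sup}=\sup_{z\in\mathbb I}|g(z)|$. For positive sequences, $a_\mu\asymp b_\mu$ means $\lim a_\mu/b_\mu=c$ for some $c\in(0,\infty)$. $\delta_{\mu\nu}$ is Kronecker's delta. *)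

theory Defs
  imports "HOL-Probability.Probability"
begin

text \<open>Functions on the unit interval are represented by total functions of type
  \<^typ>\<open>real \<Rightarrow> real\<close>; only their values on \<^term>\<open>{0..1::real}\<close> matter, and two such
  functions are identified when they agree there.\<close>

definition abs_cont_fun :: "real \<Rightarrow> real \<Rightarrow> (real \<Rightarrow> real) \<Rightarrow> bool" where
  "abs_cont_fun a b f \<longleftrightarrow>
     (\<forall>e>0. \<exists>d>0. \<forall>D. D division_of (\<Union>D) \<longrightarrow> \<Union>D \<subseteq> {a..b} \<longrightarrow>
        (\<Sum>k\<in>D. Sup k - Inf k) < d \<longrightarrow> (\<Sum>k\<in>D. \<bar>f (Sup k) - f (Inf k)\<bar>) < e)"

text \<open>Iterated derivative on the unit interval, one-sided at the end points. For a function of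
  the Sobolev space of order \<open>m\<close> the \<open>m\<close>-th derivative exists almost everywhere only; at the
  remaining points \<^const>\<open>vector_derivative\<close> returns an unspecified constant, which does
  not affect the integrals below.\<close>

definition deriv01 :: "nat \<Rightarrow> (real \<Rightarrow> real) \<Rightarrow> real \<Rightarrow> real" where
  "deriv01 j g = ((\<lambda>f x. vector_derivative f (at x within {0..1})) ^^ j) g"

definition sobolev :: "nat \<Rightarrow> (real \<Rightarrow> real) set" where
  "sobolev m = {g.
     (\<forall>j. Suc j < m \<longrightarrow> deriv01 j g differentiable_on {0..1}) \<and>
     (\<forall>j<m. abs_cont_fun 0 1 (deriv01 j g)) \<and>
     set_borel_measurable lebesgue {0..1} (deriv01 m g) \<and>
     set_integrable lebesgue {0..1} (\<lambda>z. (deriv01 m g z)\<^sup>2)}"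

definition sobolev_periodic :: "nat \<Rightarrow> (real \<Rightarrow> real) set" where
  "sobolev_periodic m = {g \<in> sobolev m. \<forall>j<m. deriv01 j g 0 = deriv01 j g 1}"

definition roughness :: "nat \<Rightarrow> (real \<Rightarrow> real) \<Rightarrow> (real \<Rightarrow> real) \<Rightarrow> real" where
  "roughness m g g' = (LINT z:{0..1}|lebesgue. deriv01 m g z * deriv01 m g' z)"

definition sup_norm :: "(real \<Rightarrow> real) \<Rightarrow> real" where
  "sup_norm g = (SUP z\<in>{0..1}. \<bar>g z\<bar>)"

definition gen_sigma :: "'w measure \<Rightarrow> ('w \<Rightarrow> real) \<Rightarrow> 'w measure" where
  "gen_sigma M Z = vimage_algebra (space M) Z borel"

definition cond_exp :: "'w measure \<Rightarrow> ('w \<Rightarrow> real) \<Rightarrow> ('w \<Rightarrow> real) \<Rightarrow> 'w \<Rightarrow> real" where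
  "cond_exp M Z X = real_cond_exp M (gen_sigma M Z) X"

text \<open>Extended-valued version for nonnegative variables, so that a bound on it entails
  finiteness.\<close>

definition nonneg_cond_exp :: "'w measure \<Rightarrow> ('w \<Rightarrow> real) \<Rightarrow> ('w \<Rightarrow> real) \<Rightarrow> 'w \<Rightarrow> ennreal" where
  "nonneg_cond_exp M Z X = nn_cond_exp M (gen_sigma M Z) (\<lambda>\<omega>. ennreal (X \<omega>))"

text \<open>\<open>\<phi> z\<close> is a version of \<open>E(X | Z = z)\<close>.\<close>

definition cond_exp_version ::
  "'w measure \<Rightarrow> ('w \<Rightarrow> real) \<Rightarrow> ('w \<Rightarrow> real) \<Rightarrow> (real \<Rightarrow> real) \<Rightarrow> bool" where
  "cond_exp_version M Z X \<phi> \<longleftrightarrow>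
     \<phi> \<in> borel_measurable borel \<and> (AE \<omega> in M. \<phi> (Z \<omega>) = cond_exp M Z X \<omega>)"

text \<open>Stochastic order symbols. The tail event is covered by a measurable event of small
  probability (outer probability), so \<open>X n\<close> need not be known to be measurable.\<close>

definition bigOP :: "'w measure \<Rightarrow> (nat \<Rightarrow> 'w \<Rightarrow> real) \<Rightarrow> (nat \<Rightarrow> real) \<Rightarrow> bool" where
  "bigOP M X r \<longleftrightarrow> (\<forall>\<epsilon>>0. \<exists>C. \<forall>\<^sub>F n in sequentially. \<exists>A\<in>sets M.
     {\<omega> \<in> space M. \<bar>X n \<omega>\<bar> > C * r n} \<subseteq> A \<and> measure M A < \<epsilon>)"

definition smallOP :: "'w measure \<Rightarrow> (nat \<Rightarrow> 'w \<Rightarrow> real) \<Rightarrow> (nat \<Rightarrow> real) \<Rightarrow> bool" where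
  "smallOP M X r \<longleftrightarrow> (\<forall>\<epsilon>>0. \<forall>\<delta>>0. \<forall>\<^sub>F n in sequentially. \<exists>A\<in>sets M.
     {\<omega> \<in> space M. \<bar>X n \<omega>\<bar> > \<delta> * r n} \<subseteq> A \<and> measure M A < \<epsilon>)"

definition prob_tending_to_one :: "'w measure \<Rightarrow> (nat \<Rightarrow> 'w \<Rightarrow> bool) \<Rightarrow> bool" where
  "prob_tending_to_one M P \<longleftrightarrow> (\<exists>A. (\<forall>n. A n \<in> sets M) \<and>
     (\<lambda>n. measure M (A n)) \<longlonglongrightarrow> 1 \<and> (\<forall>n. \<forall>\<omega>\<in>A n. P n \<omega>))"

definition asymp_order :: "(nat \<Rightarrow> real) \<Rightarrow> (nat \<Rightarrow> real) \<Rightarrow> bool" where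
  "asymp_order a b \<longleftrightarrow> (\<exists>c>0. (\<lambda>n. a n / b n) \<longlonglongrightarrow> c)"

text \<open>\<open>dl k l y a\<close> is the \<open>k\<close>-th partial derivative of \<open>l y a\<close> in \<open>a\<close>.\<close>

definition dl :: "nat \<Rightarrow> (real \<Rightarrow> real \<Rightarrow> real) \<Rightarrow> real \<Rightarrow> real \<Rightarrow> real" where
  "dl k l y = (deriv ^^ k) (l y)"

text \<open>\<open>p y (\<mu> z)\<close>, \<open>y \<in> S\<close>, is a conditional density of \<open>Y\<close> given \<open>Z = z\<close> with respect to \<open>\<nu>\<close>.\<close>

definition conditional_density ::
  "'w measure \<Rightarrow> ('w \<Rightarrow> real) \<Rightarrow> ('w \<Rightarrow> real) \<Rightarrow> real set \<Rightarrow> real measure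
   \<Rightarrow> (real \<Rightarrow> real \<Rightarrow> real) \<Rightarrow> (real \<Rightarrow> real) \<Rightarrow> bool" where
  "conditional_density M Y Z S \<nu> p \<mu> \<longleftrightarrow>
     sigma_finite_measure \<nu> \<and> sets \<nu> = sets (restrict_space borel S) \<and>
     (\<lambda>(y, z). p y (\<mu> z)) \<in> borel_measurable (\<nu> \<Otimes>\<^sub>M restrict_space borel {0..1}) \<and>
     (\<forall>y\<in>S. \<forall>z\<in>{0..1}. 0 \<le> p y (\<mu> z)) \<and>
     (\<forall>A\<in>sets \<nu>. \<forall>B\<in>sets (restrict_space borel {0..1}).
        emeasure M {\<omega> \<in> space M. Y \<omega> \<in> A \<and> Z \<omega> \<in> B} =
        (\<integral>\<^sup>+z\<in>B. (\<integral>\<^sup>+y\<in>A. ennreal (p y (\<mu> z)) \<partial>\<nu>)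
           \<partial>(distr M (restrict_space borel {0..1}) Z)))"

definition log_lik_criterion ::
  "'w measure \<Rightarrow> ('w \<Rightarrow> real) \<Rightarrow> ('w \<Rightarrow> real) \<Rightarrow> real set \<Rightarrow> (real \<Rightarrow> real) \<Rightarrow> (real \<Rightarrow> real)
   \<Rightarrow> (real \<Rightarrow> real \<Rightarrow> real) \<Rightarrow> bool" where
  "log_lik_criterion M Y Z S F g0 l \<longleftrightarrow> (\<exists>\<nu> p.
     conditional_density M Y Z S \<nu> p (\<lambda>z. F (g0 z)) \<and>
     (\<forall>y\<in>S. \<forall>a. 0 < p y (F a) \<and> l y a = ln (p y (F a))))"

text \<open>The variance function \<open>v\<close> need only be positive at the attainable means, i.e. on the range
  of \<open>F\<close> (for binary data \<open>v s = s * (1 - s)\<close>).\<close>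

definition quasi_lik_criterion ::
  "'w measure \<Rightarrow> ('w \<Rightarrow> real) \<Rightarrow> ('w \<Rightarrow> real) \<Rightarrow> real set \<Rightarrow> (real \<Rightarrow> real) \<Rightarrow> (real \<Rightarrow> real)
   \<Rightarrow> (real \<Rightarrow> real \<Rightarrow> real) \<Rightarrow> bool" where
  "quasi_lik_criterion M Y Z S F g0 l \<longleftrightarrow> (\<exists>v :: real \<Rightarrow> real.
     (\<forall>a. 0 < v (F a)) \<and>
     (AE \<omega> in M. cond_exp M Z (\<lambda>\<omega>. (Y \<omega> - cond_exp M Z Y \<omega>)\<^sup>2) \<omega> = v (F (g0 (Z \<omega>)))) \<and>
     (\<forall>y\<in>S. \<forall>a. interval_lebesgue_integrable lborel (ereal y) (ereal (F a)) (\<lambda>s. (y - s) / v s) \<and>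
        l y a = (LBINT s=ereal y..ereal (F a). (y - s) / v s)))"

definition info ::
  "'w measure \<Rightarrow> ('w \<Rightarrow> real) \<Rightarrow> ('w \<Rightarrow> real) \<Rightarrow> (real \<Rightarrow> real \<Rightarrow> real) \<Rightarrow> (real \<Rightarrow> real)
   \<Rightarrow> 'w \<Rightarrow> real" where
  "info M Y Z l g0 \<omega> = - cond_exp M Z (\<lambda>\<omega>. dl 2 l (Y \<omega>) (g0 (Z \<omega>))) \<omega>"

definition V_form ::
  "'w measure \<Rightarrow> ('w \<Rightarrow> real) \<Rightarrow> ('w \<Rightarrow> real) \<Rightarrow> (real \<Rightarrow> real \<Rightarrow> real) \<Rightarrow> (real \<Rightarrow> real)
   \<Rightarrow> (real \<Rightarrow> real) \<Rightarrow> (real \<Rightarrow> real) \<Rightarrow> real" where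
  "V_form M Y Z l g0 g g' = (LINT \<omega>|M. info M Y Z l g0 \<omega> * g (Z \<omega>) * g' (Z \<omega>))"

definition pen_inner ::
  "'w measure \<Rightarrow> ('w \<Rightarrow> real) \<Rightarrow> ('w \<Rightarrow> real) \<Rightarrow> (real \<Rightarrow> real \<Rightarrow> real) \<Rightarrow> (real \<Rightarrow> real)
   \<Rightarrow> nat \<Rightarrow> real \<Rightarrow> (real \<Rightarrow> real) \<Rightarrow> (real \<Rightarrow> real) \<Rightarrow> real" where
  "pen_inner M Y Z l g0 m lam g g' = V_form M Y Z l g0 g g' + lam * roughness m g g'"

definition pen_norm ::
  "'w measure \<Rightarrow> ('w \<Rightarrow> real) \<Rightarrow> ('w \<Rightarrow> real) \<Rightarrow> (real \<Rightarrow> real \<Rightarrow> real) \<Rightarrow> (real \<Rightarrow> real)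
   \<Rightarrow> nat \<Rightarrow> real \<Rightarrow> (real \<Rightarrow> real) \<Rightarrow> real" where
  "pen_norm M Y Z l g0 m lam g = sqrt (pen_inner M Y Z l g0 m lam g g)"

definition pen_lik ::
  "(real \<Rightarrow> real \<Rightarrow> real) \<Rightarrow> nat \<Rightarrow> (nat \<Rightarrow> 'w \<Rightarrow> real) \<Rightarrow> (nat \<Rightarrow> 'w \<Rightarrow> real) \<Rightarrow> nat \<Rightarrow> real
   \<Rightarrow> 'w \<Rightarrow> (real \<Rightarrow> real) \<Rightarrow> real" where
  "pen_lik l m Ys Zs n lam \<omega> g =
     (1 / real n) * (\<Sum>i=1..n. l (Ys i \<omega>) (g (Zs i \<omega>))) - (lam / 2) * roughness m g g"

definition unique_maximizer ::
  "(real \<Rightarrow> real) set \<Rightarrow> ((real \<Rightarrow> real) \<Rightarrow> real) \<Rightarrow> (real \<Rightarrow> real) \<Rightarrow> bool" where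
  "unique_maximizer H L g \<longleftrightarrow> g \<in> H \<and> (\<forall>f\<in>H. L f \<le> L g) \<and>
     (\<forall>f\<in>H. L f = L g \<longrightarrow> (\<forall>z\<in>{0..1}. f z = g z))"

definition reproducing_kernel ::
  "(real \<Rightarrow> real) set \<Rightarrow> ((real \<Rightarrow> real) \<Rightarrow> (real \<Rightarrow> real) \<Rightarrow> real)
   \<Rightarrow> (real \<Rightarrow> real \<Rightarrow> real) \<Rightarrow> bool" where
  "reproducing_kernel H ip K \<longleftrightarrow> (\<forall>z\<in>{0..1}. K z \<in> H \<and> (\<forall>g\<in>H. ip (K z) g = g z))"

text \<open>The score \<open>S\<^sub>n\<^sub>,\<^sub>\<lambda>(g0)\<close>, an element of the function space; \<open>Wg0\<close> stands for the
  image of \<open>g0\<close> under the penalty operator.\<close>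

definition score ::
  "(real \<Rightarrow> real \<Rightarrow> real) \<Rightarrow> (real \<Rightarrow> real) \<Rightarrow> (nat \<Rightarrow> 'w \<Rightarrow> real) \<Rightarrow> (nat \<Rightarrow> 'w \<Rightarrow> real)
   \<Rightarrow> (real \<Rightarrow> real \<Rightarrow> real) \<Rightarrow> (real \<Rightarrow> real) \<Rightarrow> nat \<Rightarrow> 'w \<Rightarrow> real \<Rightarrow> real" where
  "score l g0 Ys Zs K Wg0 n \<omega> z =
     (1 / real n) * (\<Sum>i=1..n. dl 1 l (Ys i \<omega>) (g0 (Zs i \<omega>)) * K (Zs i \<omega>) z) - Wg0 z"

definition bahadur_rate :: "nat \<Rightarrow> real \<Rightarrow> real \<Rightarrow> nat \<Rightarrow> real" where
  "bahadur_rate m C h n =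
     real n powr (-1/2) * ((real n * h) powr (-1/2) + h ^ m)
       * h powr (- (6 * real m - 1) / (4 * real m)) * sqrt (ln (ln (real n)))
     + C * h powr (-1/2) * (inverse (real n * h) + h ^ (2 * m)) / ln (real n)"

end

theory Submission
  imports Defs "HOL-Real_Asymp.Real_Asymp"
begin

text \<open>Let \<open>g\<close> be the estimation error \<open>ghat - g0\<close> and \<open>f = g - S\<close> the error of its linear representation.
The estimate maximizes the penalized criterion, so the derivative of the criterion vanishes at
\<open>ghat\<close> in the direction \<open>f\<close>. Pair \<open>f\<close> with itself in the penalized inner product: the penalty terms
cancel against the penalty operator applied to \<open>g0\<close>, the kernel turns pairings into point
evaluations, and \<open>V\<close> is minus the expectation of the second derivative of the criterion. Writing
\<open>P\<close> for expectation and \<open>P_n\<close> for the average over the sample, what remains is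

\<open>\<langle>f, f\<rangle> = (P_n - P)[l''(g0) g f] + P_n[\<rho> f]\<close>, with \<open>\<bar>\<rho>\<bar> \<le> R g^2\<close> and \<open>R = sup \<bar>l'''\<bar>\<close>.

The first term is linear in \<open>g\<close> and in \<open>f\<close>, so a bound on the norm of a bilinear form controls it
for all \<open>g\<close> and \<open>f\<close> at once. In the orthogonal basis \<open>h_\<nu>\<close>, whose squared norms are \<open>1 + \<lambda> \<gamma>_\<nu>\<close>,
the square of its Hilbert--Schmidt norm is a weighted sum of squares of centred sample averages. The
expectation of this sum is of order \<open>(\<Sum>_\<nu> 1 / (1 + \<lambda> \<gamma>_\<nu>))^2 / n\<close>, that is \<open>1 / (n h^2)\<close>, and
Markov's inequality makes the first term \<open>O_P(n^(-1/2) h^(-1)) \<parallel>g\<parallel> \<parallel>f\<parallel>\<close>. This is within the claimed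
rate because \<open>(6m - 1) / (4m) \<ge> 1\<close>.

For the second term the same weights give \<open>sup \<bar>f\<bar> \<le> const h^(-1/2) \<parallel>f\<parallel>\<close>, which leaves
\<open>P_n[R g^2]\<close>. The bilinear-form bound with \<open>R\<close> in the place of \<open>l''(g0)\<close> exchanges \<open>P_n\<close> for \<open>P\<close> at the
cost \<open>O_P(n^(-1/2) h^(-1)) \<parallel>g\<parallel>^2\<close>, and \<open>P[R g^2] \<le> C_l C_2 \<parallel>g\<parallel>^2\<close>. Dividing by \<open>\<parallel>f\<parallel>\<close> and inserting
the rate of \<open>\<parallel>g\<parallel>\<close> yields the representation. The lemmas that carry this are
\<open>empirical_form_tail\<close>, \<open>bilinear_bound\<close>, \<open>representation_error_bound\<close> and \<open>bahadur_bigOP\<close>.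

Varying \<open>ghat\<close> inside the function space presupposes that this space is closed under linear
combinations and that the roughness is bilinear. The top derivative is only a pointwise derivative
where it exists, so both statements rest on Lebesgue's theorem that an absolutely continuous function
is differentiable almost everywhere. It is proved first, by Vitali coverings, for functions of
bounded variation.\<close>

section \<open>Almost everywhere differentiability of absolutely continuous functions\<close>

text \<open>Vitali's theorem with closed intervals as balls: whenever all finite disjoint subfamilies have total
length at most \<open>e\<close>, so does the countable disjoint family that covers \<open>S\<close> up to a null set. This
turns a bound on finite sums of increments into a bound on outer measure.\<close>

lemma vitali_interval_cover:
  fixes S :: "real set" and P :: "real \<Rightarrow> real \<Rightarrow> bool"
  assumes cover: "\<And>x d. x \<in> S \<Longrightarrow> d > 0 \<Longrightarrow> \<exists>u v. u \<le> x \<and> x \<le> v \<and> u < v \<and> v - u < d \<and> P u v"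
    and bound: "\<And>F. finite F \<Longrightarrow> (\<And>u v. (u, v) \<in> F \<Longrightarrow> u < v \<and> P u v) \<Longrightarrow>
      pairwise (\<lambda>i j. disjnt {fst i..snd i} {fst j..snd j}) F \<Longrightarrow> (\<Sum>(u, v)\<in>F. v - u) \<le> e"
  shows "\<exists>T. S \<subseteq> T \<and> T \<in> lmeasurable \<and> measure lebesgue T \<le> e"
proof -
  define I where "I = {(u, v). u < v \<and> P u v}"
  define cen where "cen = (\<lambda>i :: real \<times> real. (fst i + snd i) / 2)"
  define rad where "rad = (\<lambda>i :: real \<times> real. (snd i - fst i) / 2)"
  have cb: "cball (cen i) (rad i) = {fst i..snd i}" for i
    by (auto simp: cball_eq_atLeastAtMost cen_def rad_def field_simps)
  obtain C where C: "countable C" "C \<subseteq> I"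
    "pairwise (\<lambda>i j. disjnt (cball (cen i) (rad i)) (cball (cen j) (rad j))) C"
    "negligible (S - (\<Union>i\<in>C. cball (cen i) (rad i)))"
  proof (rule Vitali_covering_theorem_cballs[of I rad S cen])
    show "0 < rad i" if "i \<in> I" for i using that by (auto simp: I_def rad_def)
    show "\<exists>i. i \<in> I \<and> x \<in> cball (cen i) (rad i) \<and> rad i < d" if "x \<in> S" "0 < d" for x d
    proof -
      obtain u v where "u \<le> x" "x \<le> v" "u < v" "v - u < d" "P u v"
        using cover[OF \<open>x \<in> S\<close> \<open>d > 0\<close>] by blast
      then show ?thesis
        by (intro exI[of _ "(u, v)"], unfold cb) (auto simp: I_def rad_def)
    qed
  qed (rule that)
  have fin: "measure lebesgue (\<Union>i\<in>F. {fst i..snd i}) \<le> e" if "F \<subseteq> C" "finite F" for F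
  proof -
    have pw: "pairwise (\<lambda>i j. disjnt {fst i..snd i} {fst j..snd j}) F"
      using C(3) \<open>F \<subseteq> C\<close> unfolding cb by (rule pairwise_subset)
    have le: "u < v \<and> P u v" if "(u, v) \<in> F" for u v
      using that \<open>F \<subseteq> C\<close> C(2) by (auto simp: I_def)
    have "measure lebesgue (\<Union>i\<in>F. {fst i..snd i}) \<le> (\<Sum>i\<in>F. measure lebesgue {fst i..snd i})"
      by (rule measure_UNION_le) (use \<open>finite F\<close> in auto)
    also have "\<dots> = (\<Sum>(u, v)\<in>F. v - u)"
      by (rule sum.cong) (use le in \<open>auto simp: less_imp_le\<close>)
    also have "\<dots> \<le> e" using bound[OF \<open>finite F\<close> le pw] by blast
    finally show ?thesis .
  qed
  define U where "U = (\<Union>i\<in>C. {fst i..snd i})"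
  have U: "U \<in> lmeasurable" "measure lebesgue U \<le> e"
    unfolding U_def
    by (rule fmeasurable_UN_bound[OF C(1) _ fin] measure_UN_bound[OF C(1) _ fin]; simp)+
  have neg: "negligible (S - U)" using C(4) unfolding cb U_def .
  have "measure lebesgue (U \<union> (S - U)) = measure lebesgue U"
    by (rule measure_Un_null_set) (use neg U(1) in \<open>auto simp: negligible_iff_null_sets fmeasurableD\<close>)
  moreover have "U \<union> (S - U) \<in> lmeasurable"
    by (rule fmeasurable.Un[OF U(1) negligible_imp_measurable[OF neg]])
  ultimately show ?thesis using U(2) by (intro exI[of _ "U \<union> (S - U)"]) auto
qed

lemma sum_increments_division:
  fixes f :: "real \<Rightarrow> real"
  assumes "D division_of {a..b}" "a \<le> b"
  shows "(\<Sum>k\<in>D. f (Sup k) - f (Inf k)) = f b - f a"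
proof -
  note D = division_ofD[OF assms(1)]
  define p where "p = (\<lambda>k. (Inf k, k)) ` D"
  have "p tagged_division_of {a..b}"
  proof (rule tagged_division_ofI)
    show "finite p" using D(1) by (simp add: p_def)
    show "x \<in> k" if "(x, k) \<in> p" for x k
    proof -
      have "k \<in> D" "x = Inf k" using that by (auto simp: p_def)
      then obtain u v where "k = {u..v}" "k \<noteq> {}" using D(3,4) by (metis box_real(2))
      then show ?thesis using \<open>x = Inf k\<close> by auto
    qed
    show "\<Union>{K. \<exists>x. (x, K) \<in> p} = {a..b}"
    proof -
      have "{K. \<exists>x. (x, K) \<in> p} = D" by (auto simp: p_def image_iff)
      then show ?thesis using D(6) by simp
    qed
    show "interior K1 \<inter> interior K2 = {}"
      if "(x1, K1) \<in> p" "(x2, K2) \<in> p" "(x1, K1) \<noteq> (x2, K2)" for x1 x2 K1 K2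
      using that D(5)[of K1 K2] by (auto simp: p_def)
    show "k \<subseteq> {a..b}" if "(x, k) \<in> p" for x k using that D(2) by (auto simp: p_def)
    show "\<exists>a b. k = cbox a b" if "(x, k) \<in> p" for x k using that D(4) by (auto simp: p_def)
  qed
  from additive_tagged_division_1[OF assms(2) this, of f]
  have "(\<Sum>(x, K)\<in>p. f (Sup K) - f (Inf K)) = f b - f a" .
  moreover have "(\<Sum>(x, K)\<in>p. f (Sup K) - f (Inf K)) = (\<Sum>k\<in>D. f (Sup k) - f (Inf k))"
    unfolding p_def by (subst sum.reindex) (auto intro: inj_onI)
  ultimately show ?thesis by simp
qed

lemma division_of_subset_nondegenerate:
  assumes "D division_of A"
  shows "{k \<in> D. interior k \<noteq> {}} division_of \<Union>{k \<in> D. interior k \<noteq> {}}"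
  using division_of_subset[of D "{k \<in> D. interior k \<noteq> {}}"] division_ofD(6)[OF assms] assms by simp

lemma disjoint_intervals_division:
  fixes F :: "(real \<times> real) set"
  assumes F: "finite F" "\<And>u v. (u, v) \<in> F \<Longrightarrow> u < v"
    and disj: "pairwise (\<lambda>i j. disjnt {fst i..snd i} {fst j..snd j}) F"
  shows "((\<lambda>(u, v). {u..v}) ` F) division_of \<Union>((\<lambda>(u, v). {u..v}) ` F)"
    and "inj_on (\<lambda>(u, v). {u..v}) F"
proof -
  let ?p = "(\<lambda>(u, v). {u..v}) ` F"
  show "inj_on (\<lambda>(u, v). {u..v}) F"
    by (rule inj_onI) (use F(2) in \<open>fastforce simp: Icc_eq_Icc\<close>)
  show "?p division_of \<Union>?p"
  proof (rule division_ofI)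
    show "finite ?p" using F(1) by simp
    show "K \<noteq> {}" if "K \<in> ?p" for K using that F(2) by fastforce
    show "\<exists>a b. K = cbox a b" if "K \<in> ?p" for K using that by auto
    show "interior K1 \<inter> interior K2 = {}" if K: "K1 \<in> ?p" "K2 \<in> ?p" "K1 \<noteq> K2" for K1 K2
    proof -
      obtain i j where ij: "i \<in> F" "j \<in> F" "K1 = {fst i..snd i}" "K2 = {fst j..snd j}"
        using K(1,2) unfolding case_prod_unfold by blast
      then have "i \<noteq> j" using K(3) by auto
      then have "disjnt K1 K2" using pairwiseD[OF disj ij(1,2)] ij(3,4) by simp
      then show ?thesis using interior_subset by (fastforce simp: disjnt_def)
    qed
  qed auto
qed

text \<open>Inside an interval over which \<open>f\<close> increases, every subinterval over which it decreases must be
compensated, so it contributes twice its drop to the variation. The sign \<open>s\<close> covers the decreasing case as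
well. Degenerate pieces are dropped from the division so that pieces of different divisions
can never coincide.\<close>

lemma opposite_increments_add_variation:
  fixes f :: "real \<Rightarrow> real"
  assumes F: "finite F" "\<And>u v. (u, v) \<in> F \<Longrightarrow> a \<le> u \<and> u < v \<and> v \<le> b \<and> s * (f v - f u) \<le> - c * (v - u)"
    and disj: "pairwise (\<lambda>i j. disjnt {fst i..snd i} {fst j..snd j}) F"
    and s: "\<bar>s\<bar> = 1" "s * (f b - f a) \<ge> 0" and ab: "a \<le> b"
  obtains D where "D division_of \<Union>D" "\<Union>D \<subseteq> {a..b}" "\<And>k. k \<in> D \<Longrightarrow> interior k \<noteq> {}"
    "(\<Sum>k\<in>D. \<bar>f (Sup k) - f (Inf k)\<bar>) \<ge> \<bar>f b - f a\<bar> + 2 * c * (\<Sum>(u, v)\<in>F. v - u)"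
proof -
  define p where "p = (\<lambda>(u, v). {u..v}) ` F"
  have pdiv: "p division_of \<Union>p" and inj: "inj_on (\<lambda>(u, v). {u..v}) F"
    using disjoint_intervals_division[OF F(1) _ disj] F(2) unfolding p_def by blast+
  have psub: "\<Union>p \<subseteq> cbox a b" using F(2) by (fastforce simp: p_def)
  obtain q where q: "p \<subseteq> q" "q division_of cbox a b"
    using partial_division_extend_interval[OF pdiv psub] by blast
  note qD = division_ofD[OF q(2)]
  define D where "D = {k \<in> q. interior k \<noteq> {}}"
  have z: "f (Sup k) - f (Inf k) = 0" if "k \<in> q - D" for k
  proof -
    have "k \<in> q" "interior k = {}" using that by (auto simp: D_def)
    then obtain u v where "k = {u..v}" "k \<noteq> {}" using qD(3,4) by (metis box_real(2))
    then have "u = v" using \<open>interior k = {}\<close> by (auto simp: interior_atLeastAtMost_real)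
    then show ?thesis using \<open>k = {u..v}\<close> by simp
  qed
  have pD: "p \<subseteq> D"
  proof
    fix k assume "k \<in> p"
    then obtain u v where "k = {u..v}" "u < v" using F(2) by (force simp: p_def)
    then show "k \<in> D" using \<open>k \<in> p\<close> q(1) by (auto simp: D_def interior_atLeastAtMost_real)
  qed
  let ?d = "\<lambda>k. f (Sup k) - f (Inf k)"
  have finD: "finite D" using qD(1) by (simp add: D_def)
  have pneg: "\<bar>?d k\<bar> \<ge> s * ?d k + 2 * c * (Sup k - Inf k)" if "k \<in> p" for k
  proof -
    obtain u v where uv: "k = {u..v}" "(u, v) \<in> F" using \<open>k \<in> p\<close> by (auto simp: p_def)
    then have "u < v" "s * (f v - f u) \<le> - c * (v - u)" using F(2) by auto
    moreover have "\<bar>f v - f u\<bar> \<ge> - (s * (f v - f u))"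
      using s(1) by (metis abs_ge_minus_self abs_mult mult_1)
    ultimately show ?thesis using uv(1) by simp
  qed
  have gen: "\<bar>?d k\<bar> \<ge> s * ?d k" for k
    using s(1) by (metis abs_ge_self abs_mult mult_1)
  have "(\<Sum>k\<in>D. \<bar>?d k\<bar>) \<ge> (\<Sum>k\<in>D. s * ?d k + (if k \<in> p then 2 * c * (Sup k - Inf k) else 0))"
    by (rule sum_mono) (use pneg gen in auto)
  moreover have "(\<Sum>k\<in>D. s * ?d k) = s * (f b - f a)"
  proof -
    have "(\<Sum>k\<in>D. ?d k) = (\<Sum>k\<in>q. ?d k)"
      by (rule sum.mono_neutral_left) (use qD(1) z in \<open>auto simp: D_def\<close>)
    also have "\<dots> = f b - f a"
      by (rule sum_increments_division) (use q(2) ab in auto)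
    finally show ?thesis by (simp add: sum_distrib_left[symmetric])
  qed
  moreover have "(\<Sum>k\<in>D. if k \<in> p then 2 * c * (Sup k - Inf k) else 0)
      = 2 * c * (\<Sum>(u, v)\<in>F. v - u)"
  proof -
    have "(\<Sum>k\<in>D. if k \<in> p then 2 * c * (Sup k - Inf k) else 0) = (\<Sum>k\<in>p. 2 * c * (Sup k - Inf k))"
      using pD finD by (simp add: sum.If_cases Int_absorb1)
    also have "\<dots> = (\<Sum>i\<in>F. 2 * c * (snd i - fst i))"
      unfolding p_def
      by (subst sum.reindex[OF inj]) (rule sum.cong, use F(2) in \<open>auto simp: less_imp_le\<close>)
    finally show ?thesis by (simp add: sum_distrib_left case_prod_unfold)
  qed
  moreover have "s * (f b - f a) = \<bar>f b - f a\<bar>"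
    using s by (metis abs_mult abs_of_nonneg mult_1)
  ultimately have "(\<Sum>k\<in>D. \<bar>?d k\<bar>) \<ge> \<bar>f b - f a\<bar> + 2 * c * (\<Sum>(u, v)\<in>F. v - u)"
    by (simp add: sum.distrib)
  moreover have "D division_of \<Union>D" unfolding D_def
    by (rule division_of_subset_nondegenerate[OF q(2)])
  moreover have "\<Union>D \<subseteq> {a..b}" using qD(2) by (auto simp: D_def)
  moreover have "interior k \<noteq> {}" if "k \<in> D" for k using that by (simp add: D_def)
  ultimately show ?thesis by (intro that[of D])
qed

text \<open>The variation of \<open>f\<close> over \<open>[a, b]\<close> is at most \<open>V\<close>. Divisions of subsets of the interval are admitted,
which avoids completing every family of subintervals to a division.\<close>

definition bv_bound :: "real \<Rightarrow> real \<Rightarrow> (real \<Rightarrow> real) \<Rightarrow> real \<Rightarrow> bool" where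
  "bv_bound a b f V \<longleftrightarrow> (\<forall>D. D division_of \<Union>D \<longrightarrow> \<Union>D \<subseteq> {a..b} \<longrightarrow>
     (\<Sum>k\<in>D. \<bar>f (Sup k) - f (Inf k)\<bar>) \<le> V)"

text \<open>Take a division whose variation is within \<open>2 c e\<close> of the supremum. On each of its pieces, intervals
whose increment has the sign opposite to that of the piece raise the variation by twice their drop,
so their total length is at most \<open>e\<close>. Both signs occur near every point of \<open>S\<close>, hence such intervals cover \<open>S\<close>
in the sense of Vitali.\<close>

lemma bv_oscillation_negligible:
  fixes f :: "real \<Rightarrow> real"
  assumes bv: "bv_bound a b f V" and c: "c > 0" and S: "S \<subseteq> {a<..<b}"
    and up: "\<And>x d. x \<in> S \<Longrightarrow> d > 0 \<Longrightarrow>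
      \<exists>u v. u \<le> x \<and> x \<le> v \<and> u < v \<and> v - u < d \<and> c * (v - u) \<le> f v - f u"
    and down: "\<And>x d. x \<in> S \<Longrightarrow> d > 0 \<Longrightarrow>
      \<exists>u v. u \<le> x \<and> x \<le> v \<and> u < v \<and> v - u < d \<and> f v - f u \<le> - c * (v - u)"
  shows "negligible S"
proof (cases "S = {}")
  case False
  then have ab: "a < b" using S by auto
  let ?d = "\<lambda>k. f (Sup k) - f (Inf k)"
  define vs where "vs = (\<lambda>D. \<Sum>k\<in>D. \<bar>?d k\<bar>)"
  define DD where "DD = {D. D division_of \<Union>D \<and> \<Union>D \<subseteq> {a..b}}"
  define L where "L = (SUP D\<in>DD. vs D)"
  have bdd: "bdd_above (vs ` DD)"
    using bv by (intro bdd_aboveI[of _ V]) (auto simp: DD_def vs_def bv_bound_def)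
  have ne: "DD \<noteq> {}" by (auto simp: DD_def intro!: exI[of _ "{}"])
  show ?thesis unfolding negligible_outer_le
  proof (intro allI impI)
    fix e :: real assume e: "e > 0"
    have "L - 2 * c * e < L" using c e by simp
    then obtain D0 where D0: "D0 \<in> DD" "L - 2 * c * e < vs D0"
      unfolding L_def using less_cSUP_iff[OF ne bdd] by blast
    obtain D where D: "D0 \<subseteq> D" "D division_of cbox a b"
      using partial_division_extend_interval[of D0 a b] D0(1) by (auto simp: DD_def)
    note DD' = division_ofD[OF D(2)]
    have vsD: "L - 2 * c * e < vs D"
      using D0(2) sum_mono2[OF DD'(1) D(1), of "\<lambda>k. \<bar>?d k\<bar>"] by (simp add: vs_def)
    have kform: "k = {Inf k..Sup k} \<and> Inf k \<le> Sup k" if "k \<in> D" for k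
      using DD'(3,4)[OF that] by (auto simp: box_real)
    \<comment> \<open>The finitely many end points of pieces are removed, so that small intervals around the remaining points stay inside one piece.\<close>
    define B where "B = Inf ` D \<union> Sup ` D"
    have finB: "finite B" using DD'(1) by (simp add: B_def)
    define sg where "sg = (\<lambda>k. if ?d k \<ge> 0 then 1 else -1 :: real)"
    \<comment> \<open>Intervals inside one piece, with an increment of sign opposite to that of the piece.\<close>
    define P where "P = (\<lambda>u v. \<exists>k\<in>D. {u..v} \<subseteq> interior k \<and> sg k * (f v - f u) \<le> - c * (v - u))"
    have "\<exists>T. S - B \<subseteq> T \<and> T \<in> lmeasurable \<and> measure lebesgue T \<le> e"
    proof (rule vitali_interval_cover[where P = P])
      fix x d :: real assume x: "x \<in> S - B" and d: "d > 0"
      have "x \<in> cbox a b" using x S by auto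
      then obtain k where k: "k \<in> D" "x \<in> k" using DD'(6) by blast
      have "x \<noteq> Inf k" "x \<noteq> Sup k" using x k(1) by (auto simp: B_def)
      then have xi: "Inf k < x" "x < Sup k" using kform[OF k(1)] k(2) by force+
      have ik: "interior k = {Inf k<..<Sup k}"
        using kform[OF k(1)] interior_atLeastAtMost_real by metis
      define d' where "d' = min d (min (x - Inf k) (Sup k - x))"
      have d': "d' > 0" using xi d by (simp add: d'_def)
      obtain u v where uv: "u \<le> x" "x \<le> v" "u < v" "v - u < d'" "sg k * (f v - f u) \<le> - c * (v - u)"
      proof (cases "?d k \<ge> 0")
        case True
        then show ?thesis using down[of x d'] x d' that by (auto simp: sg_def)
      next
        case False
        then have "sg k = -1" by (simp add: sg_def)
        moreover obtain u v where "u \<le> x \<and> x \<le> v \<and> u < v \<and> v - u < d' \<and> c * (v - u) \<le> f v - f u"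
          using up[of x d'] x d' by blast
        ultimately show ?thesis using that[of u v] by (simp add: algebra_simps)
      qed
      moreover have "{u..v} \<subseteq> interior k" unfolding ik using uv by (auto simp: d'_def)
      ultimately show "\<exists>u v. u \<le> x \<and> x \<le> v \<and> u < v \<and> v - u < d \<and> P u v"
        using k(1) unfolding P_def d'_def by (intro exI[of _ u] exI[of _ v]) auto
    next
      fix F :: "(real \<times> real) set"
      assume F: "finite F" "\<And>u v. (u, v) \<in> F \<Longrightarrow> u < v \<and> P u v"
        and disj: "pairwise (\<lambda>i j. disjnt {fst i..snd i} {fst j..snd j}) F"
      define Fk where "Fk = (\<lambda>k. {i\<in>F. {fst i..snd i} \<subseteq> interior k \<and> sg k * (f (snd i) - f (fst i)) \<le> - c * (snd i - fst i)})"
      have "\<exists>E. E division_of \<Union>E \<and> \<Union>E \<subseteq> k \<and> (\<forall>j\<in>E. interior j \<noteq> {}) \<and>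
          vs E \<ge> \<bar>?d k\<bar> + 2 * c * (\<Sum>(u, v)\<in>Fk k. v - u)" if k: "k \<in> D" for k
      proof -
        have sub: "interior k \<subseteq> {Inf k..Sup k}" using kform[OF k] interior_subset by metis
        have dk: "Inf k \<le> u \<and> u < v \<and> v \<le> Sup k \<and> sg k * (f v - f u) \<le> - c * (v - u)"
          if "(u, v) \<in> Fk k" for u v
        proof -
          have "u < v" using F(2) that by (auto simp: Fk_def)
          moreover have "{u..v} \<subseteq> interior k" using that by (simp add: Fk_def)
          then have "{u..v} \<subseteq> {Inf k..Sup k}" using sub by (rule order_trans)
          ultimately show ?thesis using that by (auto simp: Fk_def)
        qed
        obtain E where "E division_of \<Union>E" "\<Union>E \<subseteq> {Inf k..Sup k}" "\<And>j. j \<in> E \<Longrightarrow> interior j \<noteq> {}"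
          "(\<Sum>k\<in>E. \<bar>?d k\<bar>) \<ge> \<bar>f (Sup k) - f (Inf k)\<bar> + 2 * c * (\<Sum>(u, v)\<in>Fk k. v - u)"
        proof (rule opposite_increments_add_variation[of "Fk k" "Inf k" "Sup k" "sg k" f c])
          show "pairwise (\<lambda>i j. disjnt {fst i..snd i} {fst j..snd j}) (Fk k)"
            using disj by (rule pairwise_subset) (auto simp: Fk_def)
          show "finite (Fk k)" using F(1) by (simp add: Fk_def)
          show "Inf k \<le> Sup k" using kform[OF k] by blast
        qed (use dk in \<open>auto simp: sg_def\<close>)
        moreover have "\<Union>E \<subseteq> k" using calculation(2) kform[OF k] by blast
        ultimately show ?thesis unfolding vs_def by blast
      qed
      then obtain E where E: "\<And>k. k \<in> D \<Longrightarrow> E k division_of \<Union>(E k)" "\<And>k. k \<in> D \<Longrightarrow> \<Union>(E k) \<subseteq> k"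
        "\<And>k j. k \<in> D \<Longrightarrow> j \<in> E k \<Longrightarrow> interior j \<noteq> {}"
        "\<And>k. k \<in> D \<Longrightarrow> vs (E k) \<ge> \<bar>?d k\<bar> + 2 * c * (\<Sum>(u, v)\<in>Fk k. v - u)"
        by metis
      have sep: "interior j \<inter> interior j' = {}" if "k \<in> D" "k' \<in> D" "k \<noteq> k'" "j \<in> E k" "j' \<in> E k'" for k k' j j'
      proof -
        have "interior j \<subseteq> interior k" "interior j' \<subseteq> interior k'"
          using that E(2) by (meson Sup_le_iff interior_mono)+
        then show ?thesis using DD'(5)[OF that(1-3)] by blast
      qed
      have Edisj: "E k \<inter> E k' = {}" if "k \<in> D" "k' \<in> D" "k \<noteq> k'" for k k'
        using sep[OF that] E(3)[OF that(1)] by blast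
      define G where "G = (\<Union>k\<in>D. E k)"
      have "G division_of \<Union>G"
      proof (rule division_ofI)
        show "finite G" unfolding G_def using DD'(1) division_ofD(1)[OF E(1)] by blast
        show "K \<noteq> {}" if "K \<in> G" for K using that E(3) unfolding G_def by fastforce
        show "\<exists>a b. K = cbox a b" if "K \<in> G" for K
          using that division_ofD(4)[OF E(1)] unfolding G_def by blast
        show "interior K1 \<inter> interior K2 = {}" if K: "K1 \<in> G" "K2 \<in> G" "K1 \<noteq> K2" for K1 K2
        proof -
          obtain k k' where kk: "k \<in> D" "k' \<in> D" "K1 \<in> E k" "K2 \<in> E k'" using K(1,2) by (auto simp: G_def)
          show ?thesis
          proof (cases "k = k'")
            case True
            then show ?thesis using division_ofD(5)[OF E(1)[OF kk(1)]] kk K(3) by blast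
          qed (use sep kk in blast)
        qed
      qed auto
      moreover have "\<Union>G \<subseteq> {a..b}" using E(2) DD'(2) unfolding G_def by fastforce
      ultimately have "vs G \<le> L" unfolding L_def by (intro cSUP_upper bdd) (simp add: DD_def)
      moreover have "vs G = (\<Sum>k\<in>D. vs (E k))" unfolding vs_def G_def
        by (rule sum.UNION_disjoint) (use DD'(1) division_ofD(1)[OF E(1)] Edisj in auto)
      moreover have "(\<Sum>k\<in>D. vs (E k)) \<ge> (\<Sum>k\<in>D. \<bar>?d k\<bar> + 2 * c * (\<Sum>(u, v)\<in>Fk k. v - u))"
        by (rule sum_mono) (rule E(4))
      moreover have "(\<Sum>k\<in>D. \<bar>?d k\<bar> + 2 * c * (\<Sum>(u, v)\<in>Fk k. v - u))
          = vs D + 2 * c * (\<Sum>k\<in>D. \<Sum>(u, v)\<in>Fk k. v - u)"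
        by (simp add: sum.distrib sum_distrib_left vs_def)
      moreover have "(\<Sum>k\<in>D. \<Sum>(u, v)\<in>Fk k. v - u) = (\<Sum>(u, v)\<in>(\<Union>k\<in>D. Fk k). v - u)"
      proof (rule sum.UNION_disjoint[symmetric])
        show "\<forall>k\<in>D. finite (Fk k)" using F(1) by (simp add: Fk_def)
        show "\<forall>i\<in>D. \<forall>j\<in>D. i \<noteq> j \<longrightarrow> Fk i \<inter> Fk j = {}"
        proof (intro ballI impI equals0I)
          fix k k' i assume "k \<in> D" "k' \<in> D" "k \<noteq> k'" and i: "i \<in> Fk k \<inter> Fk k'"
          then have "interior k \<inter> interior k' = {}" using DD'(5) by blast
          moreover have "fst i < snd i" using i F(2)[of "fst i" "snd i"] by (auto simp: Fk_def)
          ultimately show False using i by (fastforce simp: Fk_def)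
        qed
      qed (use DD'(1) in auto)
      moreover have "(\<Union>k\<in>D. Fk k) = F"
      proof
        show "F \<subseteq> (\<Union>k\<in>D. Fk k)"
        proof
          fix i assume i: "i \<in> F"
          then have "P (fst i) (snd i)" using F(2)[of "fst i" "snd i"] by auto
          then show "i \<in> (\<Union>k\<in>D. Fk k)" using i unfolding P_def Fk_def by auto
        qed
      qed (auto simp: Fk_def)
      ultimately have "2 * c * (\<Sum>(u, v)\<in>F. v - u) < 2 * c * e" using vsD by simp
      then show "(\<Sum>(u, v)\<in>F. v - u) \<le> e" using c by simp
    qed
    then obtain T where T: "S - B \<subseteq> T" "T \<in> lmeasurable" "measure lebesgue T \<le> e" by blast
    have nB: "negligible B" using finB by (rule negligible_finite)
    have "measure lebesgue (T \<union> B) = measure lebesgue T"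
      using nB T(2) by (simp add: measure_Un_null_set negligible_iff_null_sets fmeasurableD)
    moreover have "T \<union> B \<in> lmeasurable"
      by (rule fmeasurable.Un[OF T(2) negligible_imp_measurable[OF nB]])
    ultimately show "\<exists>T. S \<subseteq> T \<and> T \<in> lmeasurable \<and> measure lebesgue T \<le> e"
      using T by (intro exI[of _ "T \<union> B"]) auto
  qed
qed simp

text \<open>Intervals of slope at least \<open>k\<close> have total length at most \<open>V / k\<close>.\<close>

lemma bv_steep_negligible:
  fixes f :: "real \<Rightarrow> real"
  assumes bv: "bv_bound a b f V" and S: "S \<subseteq> {a<..<b}"
    and steep: "\<And>x k d. x \<in> S \<Longrightarrow> d > 0 \<Longrightarrow>
      \<exists>u v. u \<le> x \<and> x \<le> v \<and> u < v \<and> v - u < d \<and> k * (v - u) \<le> \<bar>f v - f u\<bar>"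
  shows "negligible S"
  unfolding negligible_outer_le
proof (intro allI impI)
  fix e :: real assume e: "e > 0"
  have V0: "V \<ge> 0" using bv[unfolded bv_bound_def, rule_format, of "{}"] by simp
  \<comment> \<open>Adding 1 keeps \<open>k\<close> positive when \<open>V\<close> is 0.\<close>
  define k where "k = (V + 1) / e"
  have k: "k > 0" using V0 e by (simp add: k_def)
  show "\<exists>T. S \<subseteq> T \<and> T \<in> lmeasurable \<and> measure lebesgue T \<le> e"
  proof (rule vitali_interval_cover[where P = "\<lambda>u v. a \<le> u \<and> v \<le> b \<and> k * (v - u) \<le> \<bar>f v - f u\<bar>"])
    fix x d :: real assume x: "x \<in> S" and d: "d > 0"
    then have "min d (min (x - a) (b - x)) > 0" using S by auto
    from steep[OF x this, of k]
    show "\<exists>u v. u \<le> x \<and> x \<le> v \<and> u < v \<and> v - u < d \<and> a \<le> u \<and> v \<le> b \<and> k * (v - u) \<le> \<bar>f v - f u\<bar>"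
      by (elim exE) (intro exI, auto)
  next
    fix F :: "(real \<times> real) set"
    assume F: "finite F" "\<And>u v. (u, v) \<in> F \<Longrightarrow> u < v \<and> a \<le> u \<and> v \<le> b \<and> k * (v - u) \<le> \<bar>f v - f u\<bar>"
      and disj: "pairwise (\<lambda>i j. disjnt {fst i..snd i} {fst j..snd j}) F"
    let ?p = "(\<lambda>(u, v). {u..v}) ` F"
    have "?p division_of \<Union>?p" and inj: "inj_on (\<lambda>(u, v). {u..v}) F"
      using disjoint_intervals_division[OF F(1) _ disj] F(2) by blast+
    moreover have "\<Union>?p \<subseteq> {a..b}" using F(2) by fastforce
    ultimately have "(\<Sum>k\<in>?p. \<bar>f (Sup k) - f (Inf k)\<bar>) \<le> V"
      using bv unfolding bv_bound_def by blast
    moreover have "(\<Sum>k\<in>?p. \<bar>f (Sup k) - f (Inf k)\<bar>) = (\<Sum>(u, v)\<in>F. \<bar>f v - f u\<bar>)"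
      by (subst sum.reindex[OF inj]) (rule sum.cong, use F(2) in \<open>auto simp: less_imp_le\<close>)
    moreover have "(\<Sum>(u, v)\<in>F. \<bar>f v - f u\<bar>) \<ge> (\<Sum>(u, v)\<in>F. k * (v - u))"
      by (rule sum_mono) (use F(2) in auto)
    ultimately have "k * (\<Sum>(u, v)\<in>F. v - u) \<le> V"
      by (simp add: sum_distrib_left case_prod_unfold)
    also have "V \<le> k * e" using e by (simp add: k_def)
    finally show "(\<Sum>(u, v)\<in>F. v - u) \<le> e" using k by simp
  qed
qed

lemma sum_lengths_division:
  assumes D: "D division_of \<Union>D" "\<Union>D \<subseteq> {a..b::real}" and ab: "a \<le> b"
  shows "(\<Sum>k\<in>D. Sup k - Inf k) \<le> b - a"
proof -
  obtain q where q: "D \<subseteq> q" "q division_of cbox a b"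
    using partial_division_extend_interval[of D a b] D by auto
  have "(\<Sum>k\<in>D. Sup k - Inf k) \<le> (\<Sum>k\<in>q. Sup k - Inf k)"
  proof (rule sum_mono2)
    fix k assume "k \<in> q - D"
    then obtain u v where "k = {u..v}" "k \<noteq> {}" using division_ofD(3,4)[OF q(2)] by (metis DiffD1 box_real(2))
    then show "0 \<le> Sup k - Inf k" by simp
  qed (use q division_ofD(1)[OF q(2)] in auto)
  also have "\<dots> = b - a" using sum_increments_division[of q a b "\<lambda>x. x"] q(2) ab by simp
  finally show ?thesis .
qed

text \<open>Subtracting a linear function turns slopes on both sides of \<open>r\<close> into slopes of both signs.\<close>

lemma bv_bound_add_linear:
  assumes "bv_bound a b f V" "a \<le> b"
  shows "bv_bound a b (\<lambda>x. f x - r * x) (V + \<bar>r\<bar> * (b - a))"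
  unfolding bv_bound_def
proof (intro allI impI)
  fix D assume D: "D division_of \<Union>D" "\<Union>D \<subseteq> {a..b}"
  have "(\<Sum>k\<in>D. \<bar>f (Sup k) - r * Sup k - (f (Inf k) - r * Inf k)\<bar>)
      \<le> (\<Sum>k\<in>D. \<bar>f (Sup k) - f (Inf k)\<bar> + \<bar>r\<bar> * (Sup k - Inf k))"
  proof (rule sum_mono)
    fix k assume "k \<in> D"
    then obtain u v where k: "k = {u..v}" "u \<le> v" using division_ofD(3,4)[OF D(1)]
      by (metis atLeastatMost_empty_iff2 box_real(2))
    have "\<bar>f v - r * v - (f u - r * u)\<bar> \<le> \<bar>f v - f u\<bar> + \<bar>r * (v - u)\<bar>"
      by (simp add: algebra_simps)
    also have "\<bar>r * (v - u)\<bar> = \<bar>r\<bar> * (v - u)" using k by (simp add: abs_mult)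
    finally show "\<bar>f (Sup k) - r * Sup k - (f (Inf k) - r * Inf k)\<bar>
        \<le> \<bar>f (Sup k) - f (Inf k)\<bar> + \<bar>r\<bar> * (Sup k - Inf k)" using k by simp
  qed
  also have "\<dots> = (\<Sum>k\<in>D. \<bar>f (Sup k) - f (Inf k)\<bar>) + \<bar>r\<bar> * (\<Sum>k\<in>D. Sup k - Inf k)"
    by (simp add: sum.distrib sum_distrib_left)
  also have "\<dots> \<le> V + \<bar>r\<bar> * (b - a)"
    using assms(1) D sum_lengths_division[OF D assms(2)]
    by (intro add_mono mult_left_mono) (auto simp: bv_bound_def)
  finally show "(\<Sum>k\<in>D. \<bar>f (Sup k) - r * Sup k - (f (Inf k) - r * Inf k)\<bar>) \<le> V + \<bar>r\<bar> * (b - a)" .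
qed

text \<open>Where \<open>f\<close> fails to be differentiable, its difference quotients are either unbounded or oscillate
across some pair of rationals \<open>p < q\<close>. The former happens on a null set by steepness, the latter on a
countable union of null sets.\<close>

lemma bv_differentiable_ae:
  fixes f :: "real \<Rightarrow> real"
  assumes bv: "bv_bound a b f V"
  shows "negligible {x \<in> {a<..<b}. \<not> f differentiable (at x)}"
proof (cases "a < b")
  case ab: True
  define g where "g = (\<lambda>x t. (f t - f x) / (t - x))"
  have slope: "\<exists>u v. u \<le> x \<and> x \<le> v \<and> u < v \<and> v - u < d \<and> Q (u, v) \<and> f v - f u = g x t * (v - u)"
    if "t \<noteq> x" "dist t x < d" "Q (min x t, max x t)" for x t d Q
    using that by (intro exI[of _ "min x t"] exI[of _ "max x t"])
      (auto simp: g_def dist_real_def min_def max_def field_simps)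
  define N where "N = {x \<in> {a<..<b}. \<forall>k. \<exists>\<^sub>F t in at x. k < \<bar>g x t\<bar>}"
  define E where "E = (\<lambda>(p, q). {x \<in> {a<..<b}. (\<exists>\<^sub>F t in at x. g x t < p) \<and> (\<exists>\<^sub>F t in at x. q < g x t)})"
  have "negligible N"
  proof (rule bv_steep_negligible[OF bv])
    fix x k d :: real assume "x \<in> N" "d > 0"
    then obtain t where "t \<noteq> x" "dist t x < d" "k < \<bar>g x t\<bar>"
      unfolding N_def frequently_at by blast
    with slope[of t x d "\<lambda>_. True"] obtain u v where
      uv: "u \<le> x" "x \<le> v" "u < v" "v - u < d" "f v - f u = g x t * (v - u)" by blast
    then have "k * (v - u) \<le> \<bar>f v - f u\<bar>"
      using \<open>k < \<bar>g x t\<bar>\<close> by (simp add: abs_mult mult_right_mono)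
    then show "\<exists>u v. u \<le> x \<and> x \<le> v \<and> u < v \<and> v - u < d \<and> k * (v - u) \<le> \<bar>f v - f u\<bar>"
      using uv by blast
  qed (auto simp: N_def)
  moreover have "negligible (E i)" if iI: "i \<in> {(p, q). p \<in> \<rat> \<and> q \<in> \<rat> \<and> p < q}" for i
  proof -
    obtain p q where i: "i = (p, q)" "p < q" using iI by auto
    define r where "r = (p + q) / 2"
    define c where "c = (q - p) / 2"
    show ?thesis
    proof (rule bv_oscillation_negligible[OF bv_bound_add_linear[OF bv, of r]])
      show "c > 0" using i by (simp add: c_def)
      show "E i \<subseteq> {a<..<b}" by (auto simp: E_def i)
      fix x d :: real assume x: "x \<in> E i" and d: "d > 0"
      obtain t where "t \<noteq> x" "dist t x < d" "g x t < p"
        using x d unfolding E_def i frequently_at by auto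
      with slope[of t x d "\<lambda>_. True"] obtain u v where
        uv: "u \<le> x" "x \<le> v" "u < v" "v - u < d" "f v - f u = g x t * (v - u)" by blast
      then have "f v - f u \<le> p * (v - u)"
        using \<open>g x t < p\<close> by (simp add: mult_right_mono)
      then show "\<exists>u v. u \<le> x \<and> x \<le> v \<and> u < v \<and> v - u < d \<and> f v - r * v - (f u - r * u) \<le> - c * (v - u)"
        using uv by (intro exI[of _ u] exI[of _ v]) (auto simp: r_def c_def field_simps)
      obtain t where "t \<noteq> x" "dist t x < d" "q < g x t"
        using x d unfolding E_def i frequently_at by auto
      with slope[of t x d "\<lambda>_. True"] obtain u v where
        uv: "u \<le> x" "x \<le> v" "u < v" "v - u < d" "f v - f u = g x t * (v - u)" by blast
      then have "f v - f u \<ge> q * (v - u)"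
        using \<open>q < g x t\<close> by (simp add: mult_right_mono)
      then show "\<exists>u v. u \<le> x \<and> x \<le> v \<and> u < v \<and> v - u < d \<and> c * (v - u) \<le> f v - r * v - (f u - r * u)"
        using uv by (intro exI[of _ u] exI[of _ v]) (auto simp: r_def c_def field_simps)
    qed (use ab in simp)
  qed
  moreover have "countable {(p, q). p \<in> \<rat> \<and> q \<in> \<rat> \<and> p < (q::real)}"
    by (rule countable_subset[of _ "\<rat> \<times> \<rat>"]) (auto simp: countable_rat)
  ultimately have "negligible (N \<union> (\<Union>i\<in>{(p, q). p \<in> \<rat> \<and> q \<in> \<rat> \<and> p < q}. E i))"
    by (intro negligible_Un negligible_countable_Union countable_image) auto
  moreover have "{x \<in> {a<..<b}. \<not> f differentiable (at x)} \<subseteq> N \<union> (\<Union>i\<in>{(p, q). p \<in> \<rat> \<and> q \<in> \<rat> \<and> p < q}. E i)"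
  proof
    fix x assume x: "x \<in> {x \<in> {a<..<b}. \<not> f differentiable (at x)}"
    show "x \<in> N \<union> (\<Union>i\<in>{(p, q). p \<in> \<rat> \<and> q \<in> \<rat> \<and> p < q}. E i)"
    proof (cases "x \<in> N")
      case False
      then obtain k where k: "\<forall>\<^sub>F t in at x. \<bar>g x t\<bar> \<le> k"
        using x by (auto simp: N_def not_frequently not_less)
      let ?G = "\<lambda>t. ereal (g x t)"
      have lo: "ereal (- k) \<le> Liminf (at x) ?G"
        by (rule Liminf_bounded) (use k in \<open>auto elim: eventually_mono\<close>)
      have hi: "Limsup (at x) ?G \<le> ereal k"
        by (rule Limsup_bounded) (use k in \<open>auto elim: eventually_mono\<close>)
      have le: "Liminf (at x) ?G \<le> Limsup (at x) ?G" by (rule Liminf_le_Limsup) simp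
      have "Liminf (at x) ?G \<noteq> Limsup (at x) ?G"
      proof
        assume eq: "Liminf (at x) ?G = Limsup (at x) ?G"
        obtain l where l: "Limsup (at x) ?G = ereal l"
          using lo hi le eq by (cases "Limsup (at x) ?G") auto
        have "(?G \<longlongrightarrow> ereal l) (at x)"
          using Liminf_eq_Limsup[of "at x" ?G] eq l by simp
        then have "(g x \<longlongrightarrow> l) (at x)" by simp
        then have "(f has_field_derivative l) (at x)"
          unfolding has_field_derivative_iff g_def .
        then show False using x by (auto simp: real_differentiable_def)
      qed
      with le have lt: "Liminf (at x) ?G < Limsup (at x) ?G" by simp
      then obtain w where w: "Liminf (at x) ?G < ereal w" "ereal w < Limsup (at x) ?G"
        using ereal_dense2 by blast
      obtain w' where w': "Liminf (at x) ?G < ereal w'" "ereal w' < ereal w"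
        using ereal_dense2[OF w(1)] by blast
      obtain p where p: "p \<in> \<rat>" "w' < p" "p < w" using Rats_dense_in_real[of w' w] w'(2) by auto
      obtain w'' where w'': "ereal w < ereal w''" "ereal w'' < Limsup (at x) ?G"
        using ereal_dense2[OF w(2)] by blast
      obtain q where q: "q \<in> \<rat>" "w < q" "q < w''" using Rats_dense_in_real[of w w''] w''(1) by auto
      have "\<exists>\<^sub>F t in at x. g x t < p"
      proof (rule ccontr)
        assume "\<not> (\<exists>\<^sub>F t in at x. g x t < p)"
        then have "ereal p \<le> Liminf (at x) ?G"
          by (intro Liminf_bounded) (simp add: not_frequently not_less)
        from le_less_trans[OF this w'(1)] show False using p(2) by simp
      qed
      moreover have "\<exists>\<^sub>F t in at x. q < g x t"
      proof (rule ccontr)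
        assume "\<not> (\<exists>\<^sub>F t in at x. q < g x t)"
        then have "Limsup (at x) ?G \<le> ereal q"
          by (intro Limsup_bounded) (simp add: not_frequently not_less)
        from less_le_trans[OF w''(2) this] show False using q(3) by simp
      qed
      ultimately have "x \<in> E (p, q)" using x by (auto simp: E_def)
      moreover have "p < q" using p q by simp
      ultimately show ?thesis using p q by blast
    qed simp
  qed
  ultimately show ?thesis using negligible_subset by blast
qed simp

text \<open>On intervals shorter than the modulus for \<open>e = 1\<close> every division has small total length, so the
variation there is at most 1. The local statement is enough, since differentiability is local.\<close>

lemma abs_cont_bv_bound_local:
  assumes "abs_cont_fun a b f"
  obtains d where "d > 0" "\<And>u v. a \<le> u \<Longrightarrow> u \<le> v \<Longrightarrow> v \<le> b \<Longrightarrow> v - u < d \<Longrightarrow> bv_bound u v f 1"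
proof -
  obtain d where d: "d > 0" "\<And>D. D division_of \<Union>D \<Longrightarrow> \<Union>D \<subseteq> {a..b} \<Longrightarrow>
      (\<Sum>k\<in>D. Sup k - Inf k) < d \<Longrightarrow> (\<Sum>k\<in>D. \<bar>f (Sup k) - f (Inf k)\<bar>) < 1"
    using assms unfolding abs_cont_fun_def by (meson zero_less_one)
  show ?thesis
  proof (rule that[OF d(1)])
    fix u v assume uv: "a \<le> u" "u \<le> v" "v \<le> b" "v - u < d"
    show "bv_bound u v f 1" unfolding bv_bound_def
    proof (intro allI impI)
      fix D assume D: "D division_of \<Union>D" "\<Union>D \<subseteq> {u..v}"
      have "(\<Sum>k\<in>D. Sup k - Inf k) < d" using sum_lengths_division[OF D uv(2)] uv(4) by simp
      moreover have "\<Union>D \<subseteq> {a..b}" using D(2) uv by fastforce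
      ultimately show "(\<Sum>k\<in>D. \<bar>f (Sup k) - f (Inf k)\<bar>) \<le> 1" using d(2)[OF D(1)] by force
    qed
  qed
qed

lemma abs_cont_differentiable_ae:
  assumes "abs_cont_fun a b f"
  shows "negligible {x \<in> {a<..<b}. \<not> f differentiable (at x)}"
proof -
  obtain d where d: "d > 0" "\<And>u v. a \<le> u \<Longrightarrow> u \<le> v \<Longrightarrow> v \<le> b \<Longrightarrow> v - u < d \<Longrightarrow> bv_bound u v f 1"
    using abs_cont_bv_bound_local[OF assms] by blast
  define I where "I = {(u, v). u \<in> \<rat> \<and> v \<in> \<rat> \<and> a \<le> u \<and> u \<le> v \<and> v \<le> b \<and> v - u < d}"
  have "countable I" unfolding I_def
    by (rule countable_subset[of _ "\<rat> \<times> \<rat>"]) (auto simp: countable_rat)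
  then have "negligible (\<Union>i\<in>I. {x \<in> {fst i<..<snd i}. \<not> f differentiable (at x)})"
  proof (intro negligible_countable_Union countable_image)
    fix S assume "S \<in> (\<lambda>i. {x \<in> {fst i<..<snd i}. \<not> f differentiable (at x)}) ` I"
    then obtain u v where "(u, v) \<in> I" "S = {x \<in> {u<..<v}. \<not> f differentiable (at x)}" by auto
    then show "negligible S" using bv_differentiable_ae[OF d(2)[of u v]] by (auto simp: I_def)
  qed
  moreover have "{x \<in> {a<..<b}. \<not> f differentiable (at x)}
      \<subseteq> (\<Union>i\<in>I. {x \<in> {fst i<..<snd i}. \<not> f differentiable (at x)})"
  proof
    fix x assume x: "x \<in> {x \<in> {a<..<b}. \<not> f differentiable (at x)}"
    then obtain u where u: "u \<in> \<rat>" "max a (x - d / 2) < u" "u < x"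
      using Rats_dense_in_real[of "max a (x - d / 2)" x] d(1) by auto
    obtain v where v: "v \<in> \<rat>" "x < v" "v < min b (x + d / 2)"
      using Rats_dense_in_real[of x "min b (x + d / 2)"] d(1) x by auto
    have "(u, v) \<in> I" using u v by (auto simp: I_def)
    then show "x \<in> (\<Union>i\<in>I. {x \<in> {fst i<..<snd i}. \<not> f differentiable (at x)})"
      using x u v by force
  qed
  ultimately show ?thesis using negligible_subset by blast
qed

section \<open>Sobolev spaces and the roughness form\<close>

lemma division_endpoints:
  assumes "D division_of \<Union>D" "\<Union>D \<subseteq> {a..b::real}" "k \<in> D"
  shows "Sup k \<in> {a..b}" "Inf k \<in> {a..b}"
proof -
  obtain u v where k: "k = {u..v}" "u \<le> v"
    using division_ofD(3,4)[OF assms(1,3)] by (metis atLeastatMost_empty_iff2 box_real(2))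
  then have "u \<in> {a..b}" "v \<in> {a..b}" using assms(2,3) by fastforce+
  then show "Sup k \<in> {a..b}" "Inf k \<in> {a..b}" using k by auto
qed

lemma abs_cont_fun_lincomb:
  assumes f: "abs_cont_fun a b f" and g: "abs_cont_fun a b g"
    and k: "\<And>x. x \<in> {a..b} \<Longrightarrow> k x = f x + c * g x"
  shows "abs_cont_fun a b k"
  unfolding abs_cont_fun_def
proof (intro allI impI)
  fix e :: real assume e: "e > 0"
  define e' where "e' = e / (2 * (\<bar>c\<bar> + 1))"
  have e': "e' > 0" using e by (simp add: e'_def divide_pos_pos add_nonneg_pos)
  obtain d1 where d1: "d1 > 0" "\<And>D. D division_of \<Union>D \<Longrightarrow> \<Union>D \<subseteq> {a..b} \<Longrightarrow>
      (\<Sum>k\<in>D. Sup k - Inf k) < d1 \<Longrightarrow> (\<Sum>k\<in>D. \<bar>f (Sup k) - f (Inf k)\<bar>) < e / 2"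
    using f e unfolding abs_cont_fun_def by (meson half_gt_zero)
  obtain d2 where d2: "d2 > 0" "\<And>D. D division_of \<Union>D \<Longrightarrow> \<Union>D \<subseteq> {a..b} \<Longrightarrow>
      (\<Sum>k\<in>D. Sup k - Inf k) < d2 \<Longrightarrow> (\<Sum>k\<in>D. \<bar>g (Sup k) - g (Inf k)\<bar>) < e'"
    using g e' unfolding abs_cont_fun_def by meson
  have "(\<Sum>j\<in>D. \<bar>k (Sup j) - k (Inf j)\<bar>) < e"
    if D: "D division_of \<Union>D" "\<Union>D \<subseteq> {a..b}" "(\<Sum>k\<in>D. Sup k - Inf k) < min d1 d2" for D
  proof -
    have "(\<Sum>j\<in>D. \<bar>k (Sup j) - k (Inf j)\<bar>)
        \<le> (\<Sum>j\<in>D. \<bar>f (Sup j) - f (Inf j)\<bar> + \<bar>c\<bar> * \<bar>g (Sup j) - g (Inf j)\<bar>)"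
    proof (rule sum_mono)
      fix j assume "j \<in> D"
      then have "k (Sup j) - k (Inf j) = (f (Sup j) - f (Inf j)) + c * (g (Sup j) - g (Inf j))"
        using division_endpoints[OF D(1,2)] k by (simp add: algebra_simps)
      then show "\<bar>k (Sup j) - k (Inf j)\<bar> \<le> \<bar>f (Sup j) - f (Inf j)\<bar> + \<bar>c\<bar> * \<bar>g (Sup j) - g (Inf j)\<bar>"
        by (metis abs_mult abs_triangle_ineq)
    qed
    also have "\<dots> = (\<Sum>j\<in>D. \<bar>f (Sup j) - f (Inf j)\<bar>) + \<bar>c\<bar> * (\<Sum>j\<in>D. \<bar>g (Sup j) - g (Inf j)\<bar>)"
      by (simp add: sum.distrib sum_distrib_left)
    also have "\<dots> < e / 2 + \<bar>c\<bar> * e' + e' / 2"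
    proof -
      have "\<bar>c\<bar> * (\<Sum>j\<in>D. \<bar>g (Sup j) - g (Inf j)\<bar>) \<le> \<bar>c\<bar> * e'"
        using d2(2)[OF D(1,2)] D(3) by (intro mult_left_mono) auto
      then show ?thesis using d1(2)[OF D(1,2)] D(3) e' by simp
    qed
    also have "\<dots> \<le> e / 2 + (\<bar>c\<bar> + 1) * e'" using e' by (simp add: algebra_simps)
    also have "\<dots> = e" by (simp add: e'_def field_simps)
    finally show ?thesis .
  qed
  then show "\<exists>d>0. \<forall>D. D division_of \<Union>D \<longrightarrow> \<Union>D \<subseteq> {a..b} \<longrightarrow>
      (\<Sum>k\<in>D. Sup k - Inf k) < d \<longrightarrow> (\<Sum>j\<in>D. \<bar>k (Sup j) - k (Inf j)\<bar>) < e"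
    using d1(1) d2(1) by (intro exI[of _ "min d1 d2"]) simp
qed

lemma abs_cont_fun_continuous:
  assumes "abs_cont_fun a b f"
  shows "continuous_on {a..b} f"
  unfolding continuous_on_iff
proof (intro ballI allI impI)
  fix x e :: real assume x: "x \<in> {a..b}" and e: "e > 0"
  obtain d where d: "d > 0" "\<And>D. D division_of \<Union>D \<Longrightarrow> \<Union>D \<subseteq> {a..b} \<Longrightarrow>
      (\<Sum>k\<in>D. Sup k - Inf k) < d \<Longrightarrow> (\<Sum>k\<in>D. \<bar>f (Sup k) - f (Inf k)\<bar>) < e"
    using assms e unfolding abs_cont_fun_def by meson
  have "dist (f y) (f x) < e" if y: "y \<in> {a..b}" "dist y x < d" for y
  proof -
    let ?D = "{{min x y..max x y}}"
    have "?D division_of \<Union>?D"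
      using division_of_self[of "min x y" "max x y"] by (auto simp: box_real)
    moreover have "\<Union>?D \<subseteq> {a..b}" using x y by auto
    ultimately have "\<bar>f (max x y) - f (min x y)\<bar> < e"
      using d(2)[of ?D] y by (auto simp: dist_real_def max_def min_def split: if_splits)
    then show ?thesis by (auto simp: dist_real_def max_def min_def abs_minus_commute split: if_splits)
  qed
  then show "\<exists>d>0. \<forall>y\<in>{a..b}. dist y x < d \<longrightarrow> dist (f y) (f x) < e" using d(1) by blast
qed

lemma deriv01_0 [simp]: "deriv01 0 g = g"
  by (simp add: deriv01_def)

lemma deriv01_Suc: "deriv01 (Suc j) g x = vector_derivative (deriv01 j g) (at x within {0..1})"
  by (simp add: deriv01_def)

lemma deriv01_lincomb:
  assumes "\<And>i. Suc i \<le> j \<Longrightarrow> deriv01 i f differentiable_on {0..1}"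
    "\<And>i. Suc i \<le> j \<Longrightarrow> deriv01 i g differentiable_on {0..1}" "x \<in> {0..1}"
  shows "deriv01 j (\<lambda>z. f z + a * g z) x = deriv01 j f x + a * deriv01 j g x"
  using assms
proof (induction j arbitrary: x)
  case (Suc j)
  let ?k = "\<lambda>z. f z + a * g z"
  have f: "(deriv01 j f has_vector_derivative deriv01 (Suc j) f x) (at x within {0..1})"
    and g: "(deriv01 j g has_vector_derivative deriv01 (Suc j) g x) (at x within {0..1})"
    using Suc.prems unfolding deriv01_Suc
    by (auto simp: vector_derivative_works[symmetric] differentiable_on_def)
  have "((\<lambda>x. deriv01 j f x + a *\<^sub>R deriv01 j g x) has_vector_derivative
      deriv01 (Suc j) f x + a *\<^sub>R deriv01 (Suc j) g x) (at x within {0..1})"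
    by (intro has_vector_derivative_add bounded_linear.has_vector_derivative[OF bounded_linear_scaleR_right] f g)
  then have "(deriv01 j ?k has_vector_derivative deriv01 (Suc j) f x + a *\<^sub>R deriv01 (Suc j) g x)
      (at x within {0..1})"
    by (rule has_vector_derivative_transform[rotated 2]) (use Suc in auto)
  then show ?case unfolding deriv01_Suc[of j ?k]
    by (subst vector_derivative_within_closed_interval) (use Suc.prems(3) in auto)
qed simp

text \<open>Cutting the derivative of order \<open>m\<close> off outside the unit interval turns set integrals into integrals
over the whole line.\<close>

definition top_deriv :: "nat \<Rightarrow> (real \<Rightarrow> real) \<Rightarrow> real \<Rightarrow> real" where
  "top_deriv m f x = indicat_real {0..1} x * deriv01 m f x"

lemma sobolev_iff:
  "f \<in> sobolev m \<longleftrightarrow> (\<forall>j. Suc j < m \<longrightarrow> deriv01 j f differentiable_on {0..1}) \<and>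
     (\<forall>j<m. abs_cont_fun 0 1 (deriv01 j f)) \<and>
     top_deriv m f \<in> borel_measurable lebesgue \<and> integrable lebesgue (\<lambda>x. (top_deriv m f x)\<^sup>2)"
proof -
  have "indicat_real {0..1} x *\<^sub>R (deriv01 m f x)\<^sup>2 = (top_deriv m f x)\<^sup>2" for x
    by (simp add: top_deriv_def indicator_def)
  moreover have "(\<lambda>x. indicat_real {0..1} x *\<^sub>R deriv01 m f x) = top_deriv m f"
    by (auto simp: top_deriv_def)
  ultimately show ?thesis
    by (simp add: sobolev_def set_borel_measurable_def set_integrable_def)
qed

lemma roughness_eq: "roughness m f g = (LINT x|lebesgue. top_deriv m f x * top_deriv m g x)"
  unfolding roughness_def set_lebesgue_integral_def
  by (rule Bochner_Integration.integral_cong) (auto simp: top_deriv_def indicator_def)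

lemma integrable_mult_square:
  fixes f g :: "'a \<Rightarrow> real"
  assumes "f \<in> borel_measurable M" "g \<in> borel_measurable M"
    "integrable M (\<lambda>x. (f x)\<^sup>2)" "integrable M (\<lambda>x. (g x)\<^sup>2)"
  shows "integrable M (\<lambda>x. f x * g x)"
proof (rule Bochner_Integration.integrable_bound)
  show "integrable M (\<lambda>x. (f x)\<^sup>2 + (g x)\<^sup>2)" using assms by simp
  have "\<bar>a * b\<bar> \<le> a\<^sup>2 + b\<^sup>2" for a b :: real
  proof -
    have "2 * \<bar>a\<bar> * \<bar>b\<bar> \<le> \<bar>a\<bar>\<^sup>2 + \<bar>b\<bar>\<^sup>2" by (rule sum_squares_bound)
    moreover have "0 \<le> \<bar>a\<bar> * \<bar>b\<bar>" by simp
    ultimately have "\<bar>a\<bar> * \<bar>b\<bar> \<le> \<bar>a\<bar>\<^sup>2 + \<bar>b\<bar>\<^sup>2" by linarith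
    then show ?thesis by (simp add: abs_mult)
  qed
  then show "AE x in M. norm (f x * g x) \<le> norm ((f x)\<^sup>2 + (g x)\<^sup>2)" by simp
qed (use assms in measurable)

text \<open>Below order \<open>m\<close> the derivatives exist everywhere and are linear at every point. The derivative of order \<open>m\<close> is
linear only where both derivatives of order \<open>m - 1\<close> are differentiable, that is almost everywhere by
Lebesgue's theorem; elsewhere its values are arbitrary. Membership of the combination then follows from
measurability and integrability modulo null sets.\<close>

lemma sobolev_lincomb:
  assumes f: "f \<in> sobolev m" and g: "g \<in> sobolev m" and m: "m \<ge> 1"
  shows "(\<lambda>z. f z + a * g z) \<in> sobolev m"
    and "AE x in lebesgue. top_deriv m (\<lambda>z. f z + a * g z) x = top_deriv m f x + a * top_deriv m g x"
proof -
  let ?k = "\<lambda>z. f z + a * g z"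
  note F = f[unfolded sobolev_iff] and G = g[unfolded sobolev_iff]
  obtain m' where m': "m = Suc m'" using m by (cases m) auto
  have lin: "deriv01 j ?k x = deriv01 j f x + a * deriv01 j g x" if "j < m" "x \<in> {0..1}" for j x
    using F G that by (intro deriv01_lincomb) auto
  let ?N = "\<lambda>f. {x \<in> {0<..<1}. \<not> deriv01 m' f differentiable (at x)}"
  show ae: "AE x in lebesgue. top_deriv m ?k x = top_deriv m f x + a * top_deriv m g x"
    unfolding eventually_ae_filter_negligible
  proof (intro exI conjI)
    show "negligible (?N f \<union> ?N g \<union> {0, 1})"
      using F G m' by (intro negligible_Un abs_cont_differentiable_ae) auto
    show "{x. top_deriv m ?k x \<noteq> top_deriv m f x + a * top_deriv m g x} \<subseteq> ?N f \<union> ?N g \<union> {0, 1}"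
    proof (rule subsetI, rule ccontr)
      fix x assume x: "x \<in> {x. top_deriv m ?k x \<noteq> top_deriv m f x + a * top_deriv m g x}"
        and n: "x \<notin> ?N f \<union> ?N g \<union> {0, 1}"
      have x01: "x \<in> {0..1}" by (rule ccontr) (use x in \<open>simp add: top_deriv_def\<close>)
      have d: "deriv01 m' f differentiable (at x within {0..1})" "deriv01 m' g differentiable (at x within {0..1})"
        using n x01 by (auto intro: differentiable_at_withinI)
      then have f': "(deriv01 m' f has_vector_derivative deriv01 m f x) (at x within {0..1})"
        and g': "(deriv01 m' g has_vector_derivative deriv01 m g x) (at x within {0..1})"
        unfolding m' deriv01_Suc by (auto simp: vector_derivative_works[symmetric])
      have "((\<lambda>x. deriv01 m' f x + a *\<^sub>R deriv01 m' g x) has_vector_derivative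
          deriv01 m f x + a *\<^sub>R deriv01 m g x) (at x within {0..1})"
        by (intro has_vector_derivative_add bounded_linear.has_vector_derivative[OF bounded_linear_scaleR_right] f' g')
      then have "(deriv01 m' ?k has_vector_derivative deriv01 m f x + a *\<^sub>R deriv01 m g x) (at x within {0..1})"
        by (rule has_vector_derivative_transform[rotated 2]) (use lin m' x01 in auto)
      then have "deriv01 m ?k x = deriv01 m f x + a * deriv01 m g x"
        unfolding m' deriv01_Suc[of m' ?k]
        by (subst vector_derivative_within_closed_interval) (use x01 in auto)
      then show False using x x01 by (auto simp: top_deriv_def)
    qed
  qed
  have meas: "top_deriv m ?k \<in> borel_measurable lebesgue"
    by (rule borel_measurable_AE[of "\<lambda>x. top_deriv m f x + a * top_deriv m g x"])
      (use F G ae in auto)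
  have "integrable lebesgue (\<lambda>x. top_deriv m f x * top_deriv m g x)"
    using F G by (intro integrable_mult_square) auto
  then have "integrable lebesgue (\<lambda>x. (top_deriv m f x)\<^sup>2 + a\<^sup>2 * (top_deriv m g x)\<^sup>2
      + 2 * a * (top_deriv m f x * top_deriv m g x))"
    using F G by (intro Bochner_Integration.integrable_add integrable_mult_right) auto
  then have "integrable lebesgue (\<lambda>x. (top_deriv m ?k x)\<^sup>2)"
    by (rule integrable_cong_AE_imp)
      (use meas ae in \<open>auto simp: power2_eq_square algebra_simps elim: eventually_mono\<close>)
  moreover have "deriv01 j ?k differentiable_on {0..1}" if "Suc j < m" for j
  proof -
    have "(\<lambda>x. deriv01 j f x + a * deriv01 j g x) differentiable_on {0..1}"
      using F G that by (intro derivative_intros differentiable_on_mult) auto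
    then show ?thesis
      using lin[of j] that by (auto simp: differentiable_on_def intro: differentiable_transform_within[OF _ zero_less_one])
  qed
  moreover have "abs_cont_fun 0 1 (deriv01 j ?k)" if "j < m" for j
    using F G that by (intro abs_cont_fun_lincomb[OF _ _ lin[OF that]]) auto
  ultimately show "?k \<in> sobolev m" using meas by (auto simp: sobolev_iff)
qed

lemma roughness_sym: "roughness m f g = roughness m g f"
  by (simp add: roughness_eq mult.commute)

lemma roughness_nonneg: "roughness m f f \<ge> 0"
  unfolding roughness_eq by (rule Bochner_Integration.integral_nonneg) simp

lemma roughness_lincomb:
  assumes f: "f \<in> sobolev m" and g: "g \<in> sobolev m" and k: "k \<in> sobolev m" and m: "m \<ge> 1"
  shows "roughness m (\<lambda>z. f z + a * g z) k = roughness m f k + a * roughness m g k"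
proof -
  note S = sobolev_lincomb[OF f g m, of a]
  have i: "integrable lebesgue (\<lambda>x. top_deriv m p x * top_deriv m k x)" if "p \<in> sobolev m" for p
    using that k by (intro integrable_mult_square) (auto simp: sobolev_iff)
  have "roughness m (\<lambda>z. f z + a * g z) k
      = (LINT x|lebesgue. top_deriv m f x * top_deriv m k x + a * (top_deriv m g x * top_deriv m k x))"
    unfolding roughness_eq
    by (rule integral_cong_AE)
      (use S f g k in \<open>auto simp: sobolev_iff algebra_simps elim!: eventually_mono\<close>)
  also have "\<dots> = roughness m f k + a * roughness m g k"
    using i[OF f] i[OF g] by (simp add: roughness_eq)
  finally show ?thesis .
qed

lemma sobolev_periodic_lincomb:
  assumes f: "f \<in> sobolev_periodic m" and g: "g \<in> sobolev_periodic m" and m: "m \<ge> 1"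
  shows "(\<lambda>z. f z + a * g z) \<in> sobolev_periodic m"
proof -
  have fg: "f \<in> sobolev m" "g \<in> sobolev m" using f g by (auto simp: sobolev_periodic_def)
  have "deriv01 j (\<lambda>z. f z + a * g z) x = deriv01 j f x + a * deriv01 j g x" if "j < m" "x \<in> {0..1}" for j x
    using fg that by (intro deriv01_lincomb) (auto simp: sobolev_iff)
  then show ?thesis using f g sobolev_lincomb(1)[OF fg m, of a] by (auto simp: sobolev_periodic_def)
qed

lemma sobolev_continuous:
  assumes "f \<in> sobolev m" "m \<ge> 1"
  shows "continuous_on {0..1} f"
  using assms abs_cont_fun_continuous[of 0 1 "deriv01 0 f"] by (auto simp: sobolev_iff)

section \<open>Bilinear forms on a function space with a diagonalizing basis\<close>

text \<open>A vector space of functions with a positive semidefinite symmetric form. The form may be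
degenerate: functions that agree on the unit interval are not identified.\<close>

locale function_form =
  fixes H :: "(real \<Rightarrow> real) set" and ip :: "(real \<Rightarrow> real) \<Rightarrow> (real \<Rightarrow> real) \<Rightarrow> real"
  assumes nonempty: "H \<noteq> {}"
    and lincomb: "f \<in> H \<Longrightarrow> g \<in> H \<Longrightarrow> (\<lambda>z. f z + a * g z) \<in> H"
    and ip_lincomb: "f \<in> H \<Longrightarrow> g \<in> H \<Longrightarrow> k \<in> H \<Longrightarrow> ip (\<lambda>z. f z + a * g z) k = ip f k + a * ip g k"
    and ip_sym: "ip f g = ip g f"
    and ip_nonneg: "f \<in> H \<Longrightarrow> ip f f \<ge> 0"
begin

definition nrm :: "(real \<Rightarrow> real) \<Rightarrow> real" where
  "nrm f = sqrt (ip f f)"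

lemma nrm_nonneg: "f \<in> H \<Longrightarrow> nrm f \<ge> 0"
  by (simp add: nrm_def ip_nonneg)

lemma nrm_sq: "f \<in> H \<Longrightarrow> (nrm f)\<^sup>2 = ip f f"
  by (simp add: nrm_def ip_nonneg)

lemma zero_mem: "(\<lambda>z. 0) \<in> H"
proof -
  obtain f where "f \<in> H" using nonempty by auto
  from lincomb[OF this this, of "-1"] show ?thesis by simp
qed

lemma add_mem: "f \<in> H \<Longrightarrow> g \<in> H \<Longrightarrow> (\<lambda>z. f z + g z) \<in> H"
  using lincomb[of f g 1] by simp

lemma diff_mem: "f \<in> H \<Longrightarrow> g \<in> H \<Longrightarrow> (\<lambda>z. f z - g z) \<in> H"
  using lincomb[of f g "-1"] by simp

lemma ip_diff: "f \<in> H \<Longrightarrow> g \<in> H \<Longrightarrow> k \<in> H \<Longrightarrow> ip (\<lambda>z. f z - g z) k = ip f k - ip g k"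
  using ip_lincomb[of f g k "-1"] by simp

lemma nrm_diff_commute:
  assumes f: "f \<in> H" and g: "g \<in> H"
  shows "nrm (\<lambda>z. f z - g z) = nrm (\<lambda>z. g z - f z)"
proof -
  have "ip (\<lambda>z. f z - g z) (\<lambda>z. f z - g z) = ip f f - 2 * ip f g + ip g g" if "f \<in> H" "g \<in> H" for f g
  proof -
    have "ip (\<lambda>z. f z - g z) (\<lambda>z. f z - g z) = ip f (\<lambda>z. f z - g z) - ip g (\<lambda>z. f z - g z)"
      by (intro ip_diff diff_mem that)
    also have "\<dots> = ip (\<lambda>z. f z - g z) f - ip (\<lambda>z. f z - g z) g"
      by (simp only: ip_sym[of f] ip_sym[of g])
    also have "\<dots> = (ip f f - ip g f) - (ip f g - ip g g)"
      by (simp only: ip_diff that)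
    finally show ?thesis by (simp add: ip_sym[of g f])
  qed
  from this[OF f g] this[OF g f] show ?thesis using ip_sym[of g f] by (simp add: nrm_def)
qed

lemma sum_mem:
  assumes "finite A" "\<And>i. i \<in> A \<Longrightarrow> u i \<in> H"
  shows "(\<lambda>z. \<Sum>i\<in>A. c i * u i z) \<in> H"
  using assms
proof (induction A)
  case (insert i A)
  then have "(\<lambda>z. (\<Sum>i\<in>A. c i * u i z) + c i * u i z) \<in> H" by (intro lincomb) auto
  then show ?case using insert by (simp add: add.commute)
qed (simp add: zero_mem)

text \<open>Linearity in the form \<open>L (f + a g) = L f + a L g\<close> extends to finite sums by induction; the same lemma
serves the inner product, the kernel sections and the empirical bilinear forms.\<close>

lemma linear_functional_sum:
  assumes L: "\<And>f g a. f \<in> H \<Longrightarrow> g \<in> H \<Longrightarrow> L (\<lambda>z. f z + a * g z) = L f + a * (L g :: real)"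
    and "finite A" "\<And>i. i \<in> A \<Longrightarrow> u i \<in> H"
  shows "L (\<lambda>z. \<Sum>i\<in>A. c i * u i z) = (\<Sum>i\<in>A. c i * L (u i))"
  using assms(2,3)
proof (induction A)
  case empty
  have "L (\<lambda>z. 0) = L (\<lambda>z. 0) + 1 * L (\<lambda>z. 0)" using L[OF zero_mem zero_mem, of 1] by simp
  then show ?case by simp
next
  case (insert i A)
  have "L (\<lambda>z. (\<Sum>i\<in>A. c i * u i z) + c i * u i z) = L (\<lambda>z. \<Sum>i\<in>A. c i * u i z) + c i * L (u i)"
    using insert by (intro L sum_mem) auto
  then show ?case using insert by (simp add: add.commute)
qed

text \<open>The discriminant argument; a vector of length zero is orthogonal to everything, as the linear
polynomial \<open>ip f f + 2 t ip f g\<close> could not stay nonnegative otherwise.\<close>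

lemma Cauchy_Schwarz_ip:
  assumes f: "f \<in> H" and g: "g \<in> H"
  shows "\<bar>ip f g\<bar> \<le> nrm f * nrm g"
proof -
  have Q: "0 \<le> ip f f + 2 * t * ip f g + t\<^sup>2 * ip g g" for t
  proof -
    have "0 \<le> ip (\<lambda>z. f z + t * g z) (\<lambda>z. f z + t * g z)"
      by (intro ip_nonneg lincomb f g)
    also have "\<dots> = ip f (\<lambda>z. f z + t * g z) + t * ip g (\<lambda>z. f z + t * g z)"
      by (intro ip_lincomb lincomb f g)
    also have "ip f (\<lambda>z. f z + t * g z) = ip f f + t * ip f g"
      by (subst ip_sym, subst ip_lincomb) (use f g ip_sym in auto)
    also have "ip g (\<lambda>z. f z + t * g z) = ip f g + t * ip g g"
      by (subst ip_sym, subst ip_lincomb) (use f g in auto)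
    finally show ?thesis by (simp add: algebra_simps power2_eq_square)
  qed
  have "(ip f g)\<^sup>2 \<le> ip f f * ip g g"
  proof (cases "ip g g = 0")
    case True
    have "ip f g = 0"
    proof (rule ccontr)
      assume n: "ip f g \<noteq> 0"
      \<comment> \<open>The parameter for which the linear polynomial takes the value -1.\<close>
      have "0 \<le> ip f f + 2 * (- (ip f f + 1) / (2 * ip f g)) * ip f g"
        using Q[of "- (ip f f + 1) / (2 * ip f g)"] True by simp
      also have "\<dots> = -1" using n by (simp add: field_simps)
      finally show False by simp
    qed
    then show ?thesis using True by simp
  next
    case False
    then have pos: "ip g g > 0" using ip_nonneg[OF g] by simp
    have "0 \<le> ip f f + 2 * (- ip f g / ip g g) * ip f g + (- ip f g / ip g g)\<^sup>2 * ip g g"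
      by (rule Q)
    also have "\<dots> = ip f f - (ip f g)\<^sup>2 / ip g g" using pos
      by (simp add: field_simps power2_eq_square)
    finally show ?thesis using pos by (simp add: field_simps)
  qed
  then have "sqrt ((ip f g)\<^sup>2) \<le> sqrt (ip f f * ip g g)" by (rule real_sqrt_le_mono)
  then show ?thesis by (simp add: nrm_def real_sqrt_mult)
qed

lemma nrm_triangle:
  assumes f: "f \<in> H" and g: "g \<in> H"
  shows "nrm (\<lambda>z. f z + g z) \<le> nrm f + nrm g"
proof (rule power2_le_imp_le)
  have "(nrm (\<lambda>z. f z + g z))\<^sup>2 = ip (\<lambda>z. f z + 1 * g z) (\<lambda>z. f z + 1 * g z)"
    using nrm_sq[OF add_mem[OF f g]] by simp
  also have "\<dots> = ip f (\<lambda>z. f z + 1 * g z) + 1 * ip g (\<lambda>z. f z + 1 * g z)"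
    by (intro ip_lincomb lincomb f g)
  also have "ip f (\<lambda>z. f z + 1 * g z) = ip f f + 1 * ip f g"
    by (subst ip_sym, subst ip_lincomb) (use f g ip_sym in auto)
  also have "ip g (\<lambda>z. f z + 1 * g z) = ip f g + 1 * ip g g"
    by (subst ip_sym, subst ip_lincomb) (use f g in auto)
  also have "ip f f + 1 * ip f g + 1 * (ip f g + 1 * ip g g) = (nrm f)\<^sup>2 + 2 * ip f g + (nrm g)\<^sup>2"
    using f g by (simp add: nrm_sq)
  also have "\<dots> \<le> (nrm f + nrm g)\<^sup>2"
    using Cauchy_Schwarz_ip[OF f g] by (simp add: power2_sum)
  finally show "(nrm (\<lambda>z. f z + g z))\<^sup>2 \<le> (nrm f + nrm g)\<^sup>2" .
qed (use f g nrm_nonneg in auto)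

end

text \<open>The functions \<open>e \<nu>\<close> are orthogonal with squared norms \<open>d \<nu>\<close> and uniformly bounded on the unit
interval, and every element is the norm limit of its partial sums. The kernel makes point
evaluations continuous, so that these expansions also converge pointwise.\<close>

locale basis_form = function_form +
  fixes e :: "nat \<Rightarrow> real \<Rightarrow> real" and d :: "nat \<Rightarrow> real" and B :: real
    and coef :: "(real \<Rightarrow> real) \<Rightarrow> nat \<Rightarrow> real" and K :: "real \<Rightarrow> real \<Rightarrow> real"
  assumes e_mem: "e \<nu> \<in> H"
    and ip_e: "ip (e \<mu>) (e \<nu>) = (if \<mu> = \<nu> then d \<mu> else 0)"
    and d_pos: "d \<nu> > 0"
    and e_bdd: "z \<in> {0..1} \<Longrightarrow> \<bar>e \<nu> z\<bar> \<le> B"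
    and expansion: "f \<in> H \<Longrightarrow> (\<lambda>N. nrm (\<lambda>z. f z - (\<Sum>\<nu><N. coef f \<nu> * e \<nu> z))) \<longlonglongrightarrow> 0"
    and kernel: "z \<in> {0..1} \<Longrightarrow> K z \<in> H" "z \<in> {0..1} \<Longrightarrow> f \<in> H \<Longrightarrow> ip (K z) f = f z"
begin

definition partial :: "(real \<Rightarrow> real) \<Rightarrow> nat \<Rightarrow> real \<Rightarrow> real" where
  "partial f N = (\<lambda>z. \<Sum>\<nu><N. coef f \<nu> * e \<nu> z)"

lemma partial_mem: "partial f N \<in> H"
  unfolding partial_def by (intro sum_mem e_mem) simp

lemma nrm_partial: "(nrm (partial f N))\<^sup>2 = (\<Sum>\<nu><N. (coef f \<nu>)\<^sup>2 * d \<nu>)"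
proof -
  have "ip (partial f N) k = (\<Sum>\<nu><N. coef f \<nu> * ip (e \<nu>) k)" if "k \<in> H" for k
    unfolding partial_def
    using linear_functional_sum[of "\<lambda>f. ip f k" "{..<N}" e] ip_lincomb that e_mem by simp
  then have "(nrm (partial f N))\<^sup>2 = (\<Sum>\<nu><N. coef f \<nu> * (\<Sum>\<mu><N. coef f \<mu> * ip (e \<mu>) (e \<nu>)))"
    using nrm_sq partial_mem e_mem ip_sym by simp
  also have "\<dots> = (\<Sum>\<nu><N. (coef f \<nu>)\<^sup>2 * d \<nu>)"
    by (intro sum.cong) (simp_all add: ip_e if_distrib power2_eq_square cong: if_cong)
  finally show ?thesis .
qed

lemma d_nonneg: "d \<nu> \<ge> 0"
  using d_pos[of \<nu>] by simp

lemma tail_tendsto: "f \<in> H \<Longrightarrow> (\<lambda>N. nrm (\<lambda>z. f z - partial f N z)) \<longlonglongrightarrow> 0"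
  using expansion by (simp add: partial_def)

text \<open>Bessel's inequality. The norms of the partial sums increase and approach the norm of \<open>f\<close> by the
triangle inequality.\<close>

lemma nrm_partial_le:
  assumes f: "f \<in> H"
  shows "nrm (partial f N) \<le> nrm f"
proof -
  have "nrm (partial f N) \<le> nrm f + nrm (\<lambda>z. f z - partial f M z)" if "M \<ge> N" for M
  proof -
    have "(nrm (partial f N))\<^sup>2 \<le> (nrm (partial f M))\<^sup>2"
      unfolding nrm_partial using that d_pos by (intro sum_mono2) (auto simp: less_imp_le)
    then have "nrm (partial f N) \<le> nrm (partial f M)"
      by (rule power2_le_imp_le) (rule nrm_nonneg[OF partial_mem])
    also have "\<dots> = nrm (\<lambda>z. f z + (partial f M z - f z))" by simp
    also have "\<dots> \<le> nrm f + nrm (\<lambda>z. partial f M z - f z)"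
      by (intro nrm_triangle diff_mem partial_mem f)
    also have "nrm (\<lambda>z. partial f M z - f z) = nrm (\<lambda>z. f z - partial f M z)"
      by (intro nrm_diff_commute partial_mem f)
    finally show ?thesis .
  qed
  then have "\<forall>\<^sub>F M in sequentially. nrm (partial f N) \<le> nrm f + nrm (\<lambda>z. f z - partial f M z)"
    by (auto simp: eventually_sequentially)
  moreover have "(\<lambda>M. nrm f + nrm (\<lambda>z. f z - partial f M z)) \<longlonglongrightarrow> nrm f + 0"
    by (intro tendsto_intros tail_tendsto f)
  ultimately show ?thesis using tendsto_lowerbound by fastforce
qed

lemma partial_tendsto:
  assumes f: "f \<in> H" and z: "z \<in> {0..1}"
  shows "(\<lambda>N. partial f N z) \<longlonglongrightarrow> f z"
proof -
  have "\<bar>f z - partial f N z\<bar> \<le> nrm (K z) * nrm (\<lambda>z. f z - partial f N z)" for N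
    by (rule order_trans[OF _ Cauchy_Schwarz_ip[OF kernel(1)[OF z] diff_mem[OF f partial_mem]]])
      (simp only: kernel(2)[OF z diff_mem[OF f partial_mem]])
  moreover have "(\<lambda>N. nrm (K z) * nrm (\<lambda>z. f z - partial f N z)) \<longlonglongrightarrow> nrm (K z) * 0"
    by (intro tendsto_intros tail_tendsto f)
  ultimately have "(\<lambda>N. f z - partial f N z) \<longlonglongrightarrow> 0"
    by (intro Lim_null_comparison[of "\<lambda>N. f z - partial f N z"]) auto
  then have "(\<lambda>N. f z - (f z - partial f N z)) \<longlonglongrightarrow> f z - 0" by (intro tendsto_intros)
  then show ?thesis by simp
qed

text \<open>Cauchy--Schwarz between the coefficients weighted by \<open>sqrt (d \<nu>)\<close> and the values \<open>e \<nu> z / sqrt (d \<nu>)\<close>,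
whose squares sum to at most \<open>B^2 w\<close>.\<close>

lemma sup_bound:
  assumes f: "f \<in> H" and z: "z \<in> {0..1}" and w: "\<And>N. (\<Sum>\<nu><N. 1 / d \<nu>) \<le> w"
  shows "\<bar>f z\<bar> \<le> B * sqrt w * nrm f"
proof -
  have B: "B \<ge> 0" using e_bdd[OF z, of 0] by simp
  have "\<bar>partial f N z\<bar> \<le> B * sqrt w * nrm f" for N
  proof (rule power2_le_imp_le)
    have sq: "coef f \<nu> * e \<nu> z = (coef f \<nu> * sqrt (d \<nu>)) * (e \<nu> z / sqrt (d \<nu>))" for \<nu>
      using d_pos[of \<nu>] by simp
    have "(partial f N z)\<^sup>2 = (\<Sum>\<nu><N. (coef f \<nu> * sqrt (d \<nu>)) * (e \<nu> z / sqrt (d \<nu>)))\<^sup>2"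
      unfolding partial_def sq ..
    also have "\<dots> \<le> (\<Sum>\<nu><N. (coef f \<nu> * sqrt (d \<nu>))\<^sup>2) * (\<Sum>\<nu><N. (e \<nu> z / sqrt (d \<nu>))\<^sup>2)"
      by (rule Cauchy_Schwarz_ineq_sum)
    also have "\<dots> \<le> (nrm f)\<^sup>2 * (B\<^sup>2 * w)"
    proof (rule mult_mono)
      have "(\<Sum>\<nu><N. (coef f \<nu> * sqrt (d \<nu>))\<^sup>2) = (nrm (partial f N))\<^sup>2"
        by (simp add: nrm_partial power_mult_distrib d_nonneg)
      also have "\<dots> \<le> (nrm f)\<^sup>2"
        by (intro power_mono nrm_partial_le f nrm_nonneg partial_mem)
      finally show "(\<Sum>\<nu><N. (coef f \<nu> * sqrt (d \<nu>))\<^sup>2) \<le> (nrm f)\<^sup>2" .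
      have "(\<Sum>\<nu><N. (e \<nu> z / sqrt (d \<nu>))\<^sup>2) \<le> (\<Sum>\<nu><N. B\<^sup>2 * (1 / d \<nu>))"
      proof (rule sum_mono)
        fix \<nu>
        have "(e \<nu> z)\<^sup>2 \<le> B\<^sup>2" using e_bdd[OF z, of \<nu>] B abs_le_square_iff[of "e \<nu> z" B] by simp
        then show "(e \<nu> z / sqrt (d \<nu>))\<^sup>2 \<le> B\<^sup>2 * (1 / d \<nu>)"
          using d_nonneg[of \<nu>] by (simp add: power_divide divide_right_mono)
      qed
      also have "\<dots> = B\<^sup>2 * (\<Sum>\<nu><N. 1 / d \<nu>)" by (simp add: sum_distrib_left)
      also have "\<dots> \<le> B\<^sup>2 * w" by (intro mult_left_mono w) simp
      finally show "(\<Sum>\<nu><N. (e \<nu> z / sqrt (d \<nu>))\<^sup>2) \<le> B\<^sup>2 * w" .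
    qed (auto intro: sum_nonneg)
    also have "\<dots> = (B * sqrt w * nrm f)\<^sup>2"
      using w[of 0] by (simp add: power_mult_distrib)
    finally show "\<bar>partial f N z\<bar>\<^sup>2 \<le> (B * sqrt w * nrm f)\<^sup>2" by simp
  qed (use B w[of 0] nrm_nonneg[OF f] in auto)
  moreover have "(\<lambda>N. \<bar>partial f N z\<bar>) \<longlonglongrightarrow> \<bar>f z\<bar>"
    by (intro tendsto_intros partial_tendsto f z)
  ultimately show ?thesis by (intro Lim_bounded[of _ _ 0]) auto
qed

text \<open>The operator norm of a bilinear form is at most its Hilbert--Schmidt norm in the orthonormal system
\<open>e \<nu> / sqrt (d \<nu>)\<close>. The continuity bound \<open>c\<close>, however large, justifies the passage from partial
sums to the limit.\<close>

lemma bilinear_bound: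
  fixes Q :: "(real \<Rightarrow> real) \<Rightarrow> (real \<Rightarrow> real) \<Rightarrow> real"
  assumes linl: "\<And>f g k a. f \<in> H \<Longrightarrow> g \<in> H \<Longrightarrow> k \<in> H \<Longrightarrow> Q (\<lambda>z. f z + a * g z) k = Q f k + a * Q g k"
    and linr: "\<And>f g k a. f \<in> H \<Longrightarrow> g \<in> H \<Longrightarrow> k \<in> H \<Longrightarrow> Q k (\<lambda>z. f z + a * g z) = Q k f + a * Q k g"
    and bdd: "\<And>f g. f \<in> H \<Longrightarrow> g \<in> H \<Longrightarrow> \<bar>Q f g\<bar> \<le> c * nrm f * nrm g"
    and D: "\<And>N. (\<Sum>\<mu><N. \<Sum>\<nu><N. (Q (e \<mu>) (e \<nu>))\<^sup>2 / (d \<mu> * d \<nu>)) \<le> D"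
    and f: "f \<in> H" and g: "g \<in> H"
  shows "\<bar>Q f g\<bar> \<le> sqrt D * nrm f * nrm g"
proof -
  have D0: "D \<ge> 0" using D[of 0] by simp
  have fin: "\<bar>Q (partial f N) (partial g N)\<bar> \<le> sqrt D * nrm f * nrm g" for N
  proof (rule power2_le_imp_le)
    define u where "u = (\<lambda>p. coef f (fst p) * coef g (snd p) * sqrt (d (fst p) * d (snd p)))"
    define v where "v = (\<lambda>p. Q (e (fst p)) (e (snd p)) / sqrt (d (fst p) * d (snd p)))"
    have sq: "(sqrt (d \<mu> * d \<nu>))\<^sup>2 = d \<mu> * d \<nu>" for \<mu> \<nu>
      by (intro real_sqrt_pow2 mult_nonneg_nonneg d_nonneg)
    have "Q (partial f N) (partial g N) = (\<Sum>\<mu><N. coef f \<mu> * Q (e \<mu>) (partial g N))"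
      unfolding partial_def[of f]
      by (intro linear_functional_sum[of "\<lambda>f. Q f (partial g N)"] linl) (auto intro: partial_mem e_mem)
    also have "\<dots> = (\<Sum>\<mu><N. coef f \<mu> * (\<Sum>\<nu><N. coef g \<nu> * Q (e \<mu>) (e \<nu>)))"
      unfolding partial_def
      by (intro sum.cong refl arg_cong2[where f = "(*)"] linear_functional_sum[of "\<lambda>f. Q (e _) f"] linr)
        (auto intro: partial_mem e_mem)
    also have "\<dots> = (\<Sum>(\<mu>, \<nu>)\<in>{..<N} \<times> {..<N}. coef f \<mu> * coef g \<nu> * Q (e \<mu>) (e \<nu>))"
      by (simp add: sum_distrib_left sum.cartesian_product mult.assoc)
    also have "\<dots> = (\<Sum>p\<in>{..<N} \<times> {..<N}. u p * v p)"
      using d_pos by (intro sum.cong refl) (auto simp: u_def v_def less_imp_neq[symmetric])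
    finally have "(Q (partial f N) (partial g N))\<^sup>2 = (\<Sum>p\<in>{..<N} \<times> {..<N}. u p * v p)\<^sup>2" by simp
    also have "\<dots> \<le> (\<Sum>p\<in>{..<N} \<times> {..<N}. (u p)\<^sup>2) * (\<Sum>p\<in>{..<N} \<times> {..<N}. (v p)\<^sup>2)"
      by (rule Cauchy_Schwarz_ineq_sum)
    also have "\<dots> \<le> ((nrm f)\<^sup>2 * (nrm g)\<^sup>2) * D"
    proof (rule mult_mono)
      have "(\<Sum>p\<in>{..<N} \<times> {..<N}. (u p)\<^sup>2)
          = (\<Sum>\<mu><N. \<Sum>\<nu><N. ((coef f \<mu>)\<^sup>2 * d \<mu>) * ((coef g \<nu>)\<^sup>2 * d \<nu>))"
        unfolding sum.cartesian_product
        by (intro sum.cong refl) (auto simp: u_def power_mult_distrib sq)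
      also have "\<dots> = (nrm (partial f N))\<^sup>2 * (nrm (partial g N))\<^sup>2"
        by (simp add: nrm_partial sum_product)
      also have "\<dots> \<le> (nrm f)\<^sup>2 * (nrm g)\<^sup>2"
        by (intro mult_mono power_mono nrm_partial_le f g nrm_nonneg partial_mem) auto
      finally show "(\<Sum>p\<in>{..<N} \<times> {..<N}. (u p)\<^sup>2) \<le> (nrm f)\<^sup>2 * (nrm g)\<^sup>2" .
      have "(\<Sum>p\<in>{..<N} \<times> {..<N}. (v p)\<^sup>2)
          = (\<Sum>\<mu><N. \<Sum>\<nu><N. (Q (e \<mu>) (e \<nu>))\<^sup>2 / (d \<mu> * d \<nu>))"
        unfolding sum.cartesian_product
        by (intro sum.cong refl) (auto simp: v_def power_divide sq)
      then show "(\<Sum>p\<in>{..<N} \<times> {..<N}. (v p)\<^sup>2) \<le> D" using D by simp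
    qed (auto intro: sum_nonneg)
    also have "\<dots> = (sqrt D * nrm f * nrm g)\<^sup>2" using D0 by (simp add: power_mult_distrib)
    finally show "\<bar>Q (partial f N) (partial g N)\<bar>\<^sup>2 \<le> (sqrt D * nrm f * nrm g)\<^sup>2" by simp
  qed (use D0 nrm_nonneg f g in auto)
  have "\<bar>Q f g - Q (partial f N) (partial g N)\<bar>
      \<le> \<bar>c\<bar> * nrm g * nrm (\<lambda>z. f z - partial f N z) + \<bar>c\<bar> * nrm f * nrm (\<lambda>z. g z - partial g N z)" for N
  proof -
    have "Q f g - Q (partial f N) (partial g N)
        = Q (\<lambda>z. f z - partial f N z) g + Q (partial f N) (\<lambda>z. g z - partial g N z)"
      using linl[OF f partial_mem g, where a = "-1"] linr[OF g partial_mem partial_mem, where a = "-1"] by simp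
    moreover have "\<bar>Q (\<lambda>z. f z - partial f N z) g\<bar> \<le> \<bar>c\<bar> * nrm (\<lambda>z. f z - partial f N z) * nrm g"
      by (rule order_trans[OF bdd[OF diff_mem[OF f partial_mem] g]])
        (use nrm_nonneg[OF g] nrm_nonneg[OF diff_mem[OF f partial_mem]] in \<open>auto intro!: mult_right_mono\<close>)
    moreover have "\<bar>Q (partial f N) (\<lambda>z. g z - partial g N z)\<bar> \<le> \<bar>c\<bar> * nrm (partial f N) * nrm (\<lambda>z. g z - partial g N z)"
      by (rule order_trans[OF bdd[OF partial_mem diff_mem[OF g partial_mem]]])
        (use nrm_nonneg[OF partial_mem] nrm_nonneg[OF diff_mem[OF g partial_mem]] in \<open>auto intro!: mult_right_mono\<close>)
    moreover have "\<bar>c\<bar> * nrm (partial f N) * nrm (\<lambda>z. g z - partial g N z) \<le> \<bar>c\<bar> * nrm f * nrm (\<lambda>z. g z - partial g N z)"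
      using nrm_nonneg[OF diff_mem[OF g partial_mem]] nrm_partial_le[OF f]
      by (intro mult_right_mono mult_left_mono) auto
    ultimately show ?thesis by (simp add: mult_ac)
  qed
  moreover have "(\<lambda>N. \<bar>c\<bar> * nrm g * nrm (\<lambda>z. f z - partial f N z) + \<bar>c\<bar> * nrm f * nrm (\<lambda>z. g z - partial g N z))
      \<longlonglongrightarrow> \<bar>c\<bar> * nrm g * 0 + \<bar>c\<bar> * nrm f * 0"
    by (intro tendsto_intros tail_tendsto f g)
  ultimately have "(\<lambda>N. Q f g - Q (partial f N) (partial g N)) \<longlonglongrightarrow> 0"
    by (intro Lim_null_comparison[of "\<lambda>N. Q f g - Q (partial f N) (partial g N)"]) auto
  then have "(\<lambda>N. Q f g - (Q f g - Q (partial f N) (partial g N))) \<longlonglongrightarrow> Q f g - 0"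
    by (intro tendsto_intros)
  then have "(\<lambda>N. \<bar>Q (partial f N) (partial g N)\<bar>) \<longlonglongrightarrow> \<bar>Q f g\<bar>"
    by (intro tendsto_rabs) simp
  then show ?thesis using fin by (intro Lim_bounded[of _ _ 0]) auto
qed

end

section \<open>Measurability and second moments\<close>

text \<open>Bienayme's identity: the centred summands are uncorrelated, so only the \<open>n\<close> diagonal terms survive,
each at most \<open>c\<close> because centring decreases the second moment.\<close>

lemma (in prob_space) mean_square_deviation_indep:
  fixes X :: "nat \<Rightarrow> 'a \<Rightarrow> real"
  assumes ind: "indep_vars (\<lambda>_. borel) X {1..}"
    and sq: "\<And>i. i \<ge> 1 \<Longrightarrow> integrable M (\<lambda>\<omega>. (X i \<omega>)\<^sup>2)"
    and mean: "\<And>i. i \<ge> 1 \<Longrightarrow> expectation (X i) = \<mu>"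
    and bound: "\<And>i. i \<ge> 1 \<Longrightarrow> expectation (\<lambda>\<omega>. (X i \<omega>)\<^sup>2) \<le> c"
    and n: "n \<ge> 1"
  shows "integrable M (\<lambda>\<omega>. ((1 / real n) * (\<Sum>i=1..n. X i \<omega>) - \<mu>)\<^sup>2)"
    and "expectation (\<lambda>\<omega>. ((1 / real n) * (\<Sum>i=1..n. X i \<omega>) - \<mu>)\<^sup>2) \<le> c / real n"
proof -
  have meas: "random_variable borel (X i)" if "i \<ge> 1" for i
    using ind that by (auto simp: indep_vars_def)
  have int: "integrable M (X i)" if "i \<ge> 1" for i
    using square_integrable_imp_integrable[OF meas sq] that by simp
  define D where "D = (\<lambda>i \<omega>. X i \<omega> - \<mu>)"
  have intD: "integrable M (D i)" if "i \<ge> 1" for i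
    using int[OF that] by (auto simp: D_def)
  have indD: "indep_vars (\<lambda>_. borel) D {1..}"
    unfolding D_def by (rule indep_vars_compose2[OF ind]) simp
  have D0: "expectation (D i) = 0" if "i \<ge> 1" for i
    using int[OF that] mean[OF that] by (simp add: D_def prob_space)
  have cross: "integrable M (\<lambda>\<omega>. D i \<omega> * D j \<omega>)" "expectation (\<lambda>\<omega>. D i \<omega> * D j \<omega>) = 0"
    if ij: "i \<ge> 1" "j \<ge> 1" "i \<noteq> j" for i j
  proof -
    have ind2: "indep_vars (\<lambda>_. borel) D {i, j}"
      using ij by (intro indep_vars_subset[OF indD]) auto
    have fin: "finite {i, j}" by simp
    have i2: "integrable M (D k)" if "k \<in> {i, j}" for k using that ij by (intro intD) auto
    show "integrable M (\<lambda>\<omega>. D i \<omega> * D j \<omega>)"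
      using indep_vars_integrable[OF fin ind2 i2] ij(3) by simp
    show "expectation (\<lambda>\<omega>. D i \<omega> * D j \<omega>) = 0"
      using indep_vars_lebesgue_integral[OF fin ind2 i2] ij by (simp add: D0)
  qed
  have diag: "integrable M (\<lambda>\<omega>. D i \<omega> * D i \<omega>)" "expectation (\<lambda>\<omega>. D i \<omega> * D i \<omega>) \<le> c"
    if i: "i \<ge> 1" for i
  proof -
    have eq: "D i \<omega> * D i \<omega> = (X i \<omega>)\<^sup>2 - 2 * \<mu> * X i \<omega> + \<mu>\<^sup>2" for \<omega>
      by (simp add: D_def power2_eq_square algebra_simps)
    show "integrable M (\<lambda>\<omega>. D i \<omega> * D i \<omega>)"
      unfolding eq using int[OF i] sq[OF i] by auto
    have "expectation (\<lambda>\<omega>. D i \<omega> * D i \<omega>) = expectation (\<lambda>\<omega>. (X i \<omega>)\<^sup>2) - 2 * \<mu> * expectation (X i) + \<mu>\<^sup>2"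
      unfolding eq using int[OF i] sq[OF i] by (simp add: prob_space)
    also have "\<dots> = expectation (\<lambda>\<omega>. (X i \<omega>)\<^sup>2) - \<mu>\<^sup>2"
      using mean[OF i] by (simp add: power2_eq_square)
    also have "\<dots> \<le> c" using bound[OF i] zero_le_power2[of \<mu>] by linarith
    finally show "expectation (\<lambda>\<omega>. D i \<omega> * D i \<omega>) \<le> c" .
  qed
  have eq: "((1 / real n) * (\<Sum>i=1..n. X i \<omega>) - \<mu>)\<^sup>2 = (1 / real n)\<^sup>2 * (\<Sum>i=1..n. \<Sum>j=1..n. D i \<omega> * D j \<omega>)" for \<omega>
  proof -
    have "(1 / real n) * (\<Sum>i=1..n. X i \<omega>) - \<mu> = (1 / real n) * (\<Sum>i=1..n. D i \<omega>)"
      using n by (simp add: D_def sum_subtractf field_simps)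
    then show ?thesis by (simp add: power_mult_distrib power2_eq_square sum_product)
  qed
  have int2: "integrable M (\<lambda>\<omega>. D i \<omega> * D j \<omega>)" if "i \<ge> 1" "j \<ge> 1" for i j
    using cross(1)[OF that] diag(1)[OF that(1)] by (cases "i = j") auto
  show "integrable M (\<lambda>\<omega>. ((1 / real n) * (\<Sum>i=1..n. X i \<omega>) - \<mu>)\<^sup>2)"
    unfolding eq by (intro integrable_mult_right Bochner_Integration.integrable_sum int2) auto
  have "expectation (\<lambda>\<omega>. ((1 / real n) * (\<Sum>i=1..n. X i \<omega>) - \<mu>)\<^sup>2)
      = (1 / real n)\<^sup>2 * (\<Sum>i=1..n. \<Sum>j=1..n. expectation (\<lambda>\<omega>. D i \<omega> * D j \<omega>))"
    unfolding eq using int2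
    by (subst integral_mult_right_zero, subst Bochner_Integration.integral_sum)
      (auto intro!: sum.cong Bochner_Integration.integral_sum Bochner_Integration.integrable_sum)
  also have "\<dots> \<le> (1 / real n)\<^sup>2 * (\<Sum>i=1..n. \<Sum>j=1..n. if i = j then c else 0)"
    using cross(2) diag(2) by (intro mult_left_mono sum_mono) auto
  also have "\<dots> = c / real n" using n by (simp add: power2_eq_square)
  finally show "expectation (\<lambda>\<omega>. ((1 / real n) * (\<Sum>i=1..n. X i \<omega>) - \<mu>)\<^sup>2) \<le> c / real n" .
qed

text \<open>Markov's inequality for the finite sums, uniformly in \<open>N\<close>: the sums increase with \<open>N\<close>, so the events
\<open>S N > t\<close> increase to the exceptional event and their probabilities converge.\<close>

lemma (in prob_space) weighted_square_sum_tail: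
  fixes X :: "nat \<Rightarrow> nat \<Rightarrow> 'a \<Rightarrow> real" and w :: "nat \<Rightarrow> real"
  assumes int: "\<And>\<mu> \<nu>. integrable M (\<lambda>\<omega>. (X \<mu> \<nu> \<omega>)\<^sup>2)"
    and bound: "\<And>\<mu> \<nu>. expectation (\<lambda>\<omega>. (X \<mu> \<nu> \<omega>)\<^sup>2) \<le> c" and c: "c \<ge> 0"
    and w: "\<And>\<nu>. w \<nu> \<ge> 0" "\<And>N. (\<Sum>\<nu><N. w \<nu>) \<le> W" and t: "t > 0"
  shows "\<exists>A\<in>events. prob A \<le> c * W\<^sup>2 / t \<and>
    (\<forall>\<omega>\<in>space M - A. \<forall>N. (\<Sum>\<mu><N. \<Sum>\<nu><N. w \<mu> * w \<nu> * (X \<mu> \<nu> \<omega>)\<^sup>2) \<le> t)"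
proof -
  define S where "S = (\<lambda>N \<omega>. \<Sum>\<mu><N. \<Sum>\<nu><N. w \<mu> * w \<nu> * (X \<mu> \<nu> \<omega>)\<^sup>2)"
  have intS: "integrable M (S N)" for N
    unfolding S_def by (intro Bochner_Integration.integrable_sum integrable_mult_right int)
  have [measurable]: "S N \<in> borel_measurable M" for N using intS by (rule borel_measurable_integrable)
  have S0: "S N \<omega> \<ge> 0" for N \<omega> unfolding S_def by (intro sum_nonneg mult_nonneg_nonneg w) auto
  have mono: "S N \<omega> \<le> S N' \<omega>" if "N \<le> N'" for N N' \<omega>
  proof -
    have "S N \<omega> \<le> (\<Sum>\<mu><N. \<Sum>\<nu><N'. w \<mu> * w \<nu> * (X \<mu> \<nu> \<omega>)\<^sup>2)"
      unfolding S_def using that w by (intro sum_mono sum_mono2) auto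
    also have "\<dots> \<le> S N' \<omega>"
      unfolding S_def using that w by (intro sum_mono2 sum_nonneg) auto
    finally show ?thesis .
  qed
  have ES: "expectation (S N) \<le> c * W\<^sup>2" for N
  proof -
    have "expectation (S N) = (\<Sum>\<mu><N. \<Sum>\<nu><N. w \<mu> * w \<nu> * expectation (\<lambda>\<omega>. (X \<mu> \<nu> \<omega>)\<^sup>2))"
      unfolding S_def using int
      by (subst Bochner_Integration.integral_sum)
        (auto intro!: sum.cong Bochner_Integration.integrable_sum simp: Bochner_Integration.integral_sum)
    also have "\<dots> \<le> (\<Sum>\<mu><N. \<Sum>\<nu><N. w \<mu> * w \<nu> * c)"
      by (intro sum_mono mult_left_mono bound mult_nonneg_nonneg w)
    also have "\<dots> = c * (\<Sum>\<nu><N. w \<nu>)\<^sup>2"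
      by (simp add: power2_eq_square sum_product sum_distrib_left mult_ac)
    also have "\<dots> \<le> c * W\<^sup>2"
      by (intro mult_left_mono power_mono w c sum_nonneg)
    finally show ?thesis .
  qed
  define E where "E = (\<lambda>N. {\<omega> \<in> space M. S N \<omega> > t})"
  have E: "E N \<in> events" for N unfolding E_def by measurable
  have inc: "incseq E" unfolding incseq_def E_def using mono by (auto intro: less_le_trans)
  have pE: "prob (E N) \<le> c * W\<^sup>2 / t" for N
  proof -
    have "prob (E N) \<le> prob {\<omega> \<in> space M. S N \<omega> \<ge> t}"
      unfolding E_def by (intro finite_measure_mono) auto
    also have "\<dots> \<le> expectation (S N) / t"
      by (rule integral_Markov_inequality_measure[of M _ "{}"]) (use intS S0 t in auto)
    also have "\<dots> \<le> c * W\<^sup>2 / t" using ES t by (intro divide_right_mono) auto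
    finally show ?thesis .
  qed
  have "(\<lambda>N. prob (E N)) \<longlonglongrightarrow> prob (\<Union>N. E N)"
    by (rule finite_Lim_measure_incseq) (use E inc in auto)
  then have "prob (\<Union>N. E N) \<le> c * W\<^sup>2 / t" by (rule LIMSEQ_le_const2) (use pE in auto)
  moreover have "(\<Union>N. E N) \<in> events" using E by auto
  moreover have "\<forall>\<omega>\<in>space M - (\<Union>N. E N). \<forall>N. S N \<omega> \<le> t" by (auto simp: E_def not_less)
  ultimately show ?thesis unfolding S_def by blast
qed

lemma measurable_to_restrict_borel:
  assumes "f \<in> borel_measurable M" "\<And>\<omega>. \<omega> \<in> space M \<Longrightarrow> f \<omega> \<in> S"
  shows "f \<in> measurable M (restrict_space borel S)"
  using assms by (intro measurable_restrict_space2) auto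

lemma restrict_borel_sets_vimage:
  assumes "\<And>\<omega>. \<omega> \<in> \<Omega> \<Longrightarrow> T \<omega> \<in> S"
  shows "{T -` A \<inter> \<Omega> | A. A \<in> sets (restrict_space borel S)} = {T -` A \<inter> \<Omega> | A. A \<in> sets borel}"
proof -
  have eq: "T -` (S \<inter> A) \<inter> \<Omega> = T -` A \<inter> \<Omega>" for A using assms by auto
  show ?thesis unfolding Setcompr_eq_image sets_restrict_space image_image
    by (rule image_cong[OF refl]) (rule eq)
qed

text \<open>Random variables that take values in \<open>S\<close> generate the same sigma-algebras whether their target is
the whole space or \<open>S\<close>, whether or not \<open>S\<close> is Borel. The observations live on such a set, as the
criterion function is measurable on the range of the response.\<close>

lemma (in prob_space) indep_vars_restrict_borel:
  fixes T :: "'i \<Rightarrow> 'a \<Rightarrow> 'b::topological_space"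
  assumes ind: "indep_vars (\<lambda>_. borel) T I" and range: "\<And>i \<omega>. i \<in> I \<Longrightarrow> \<omega> \<in> space M \<Longrightarrow> T i \<omega> \<in> S"
  shows "indep_vars (\<lambda>_. restrict_space borel S) T I"
proof -
  have "indep_sets (\<lambda>i. {T i -` A \<inter> space M | A. A \<in> sets borel}) I"
    using ind by (simp add: indep_vars_def2)
  moreover have "{T i -` A \<inter> space M | A. A \<in> sets (restrict_space borel S)}
      = {T i -` A \<inter> space M | A. A \<in> sets borel}" if "i \<in> I" for i
    using range[OF that] by (rule restrict_borel_sets_vimage)
  ultimately have "indep_sets (\<lambda>i. {T i -` A \<inter> space M | A. A \<in> sets (restrict_space borel S)}) I"
    by (simp cong: indep_sets_cong)
  moreover have "random_variable (restrict_space borel S) (T i)" if "i \<in> I" for i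
    using ind that range by (intro measurable_to_restrict_borel) (auto simp: indep_vars_def2)
  ultimately show ?thesis by (simp add: indep_vars_def2)
qed

lemma distr_restrict_borel_cong:
  assumes T: "T \<in> borel_measurable M" "T' \<in> borel_measurable M"
    and range: "\<And>\<omega>. \<omega> \<in> space M \<Longrightarrow> T \<omega> \<in> S" "\<And>\<omega>. \<omega> \<in> space M \<Longrightarrow> T' \<omega> \<in> S"
    and eq: "distr M borel T = distr M borel T'"
  shows "distr M (restrict_space borel S) T = distr M (restrict_space borel S) T'"
proof (rule measure_eqI)
  fix A assume A: "A \<in> sets (distr M (restrict_space borel S) T)"
  then obtain A' where A': "A' \<in> sets borel" "A = S \<inter> A'"
    by (auto simp: sets_restrict_space)
  have "T -` A \<inter> space M = T -` A' \<inter> space M" "T' -` A \<inter> space M = T' -` A' \<inter> space M"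
    using range A'(2) by auto
  moreover have "emeasure M (T -` A' \<inter> space M) = emeasure M (T' -` A' \<inter> space M)"
    using arg_cong[OF eq, of "\<lambda>N. emeasure N A'"] T A'(1) by (simp add: emeasure_distr)
  ultimately show "emeasure (distr M (restrict_space borel S) T) A
      = emeasure (distr M (restrict_space borel S) T') A"
    using A T range by (simp add: emeasure_distr measurable_to_restrict_borel)
qed simp

text \<open>A Caratheodory function is the pointwise limit of the functions obtained by rounding the continuous argument
down to a grid, and each of those takes countably many measurable branches.\<close>

lemma caratheodory_measurable:
  fixes G :: "'b \<Rightarrow> real \<Rightarrow> real"
  assumes G: "\<And>a. (\<lambda>y. G y a) \<in> borel_measurable N"
    and cont: "\<And>y. y \<in> space N \<Longrightarrow> continuous_on UNIV (G y)"
    and u: "u \<in> measurable P N" and b: "b \<in> borel_measurable P"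
  shows "(\<lambda>\<omega>. G (u \<omega>) (b \<omega>)) \<in> borel_measurable P"
proof (rule borel_measurable_LIMSEQ_real)
  let ?r = "\<lambda>n x. real_of_int \<lfloor>real (Suc n) * x\<rfloor> / real (Suc n)"
  show "(\<lambda>\<omega>. G (u \<omega>) (?r n (b \<omega>))) \<in> borel_measurable P" for n
  proof (rule measurable_compose_countable[where g = "\<lambda>\<omega>. \<lfloor>real (Suc n) * b \<omega>\<rfloor>"])
    show "(\<lambda>\<omega>. G (u \<omega>) (real_of_int i / real (Suc n))) \<in> borel_measurable P" for i
      by (rule measurable_compose[OF u G])
    show "(\<lambda>\<omega>. \<lfloor>real (Suc n) * b \<omega>\<rfloor>) \<in> measurable P (count_space UNIV)"
      using b by measurable
  qed
  fix \<omega> assume \<omega>: "\<omega> \<in> space P"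
  have lim: "(\<lambda>n. ?r n x) \<longlonglongrightarrow> x" for x
  proof (rule real_tendsto_sandwich[of "\<lambda>n. x - 1 / real (Suc n)" _ _ "\<lambda>n. x"])
    have "x - 1 / real (Suc n) \<le> ?r n x" "?r n x \<le> x" for n
    proof -
      have "real (Suc n) * x - 1 \<le> real_of_int \<lfloor>real (Suc n) * x\<rfloor>"
        "real_of_int \<lfloor>real (Suc n) * x\<rfloor> \<le> real (Suc n) * x" by linarith+
      then have "(real (Suc n) * x - 1) / real (Suc n) \<le> ?r n x" "?r n x \<le> (real (Suc n) * x) / real (Suc n)"
        by (intro divide_right_mono; simp)+
      then show "x - 1 / real (Suc n) \<le> ?r n x" "?r n x \<le> x"
        by (simp_all add: diff_divide_distrib del: of_nat_Suc)
    qed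
    then show "\<forall>\<^sub>F n in sequentially. x - 1 / real (Suc n) \<le> ?r n x" "\<forall>\<^sub>F n in sequentially. ?r n x \<le> x"
      by auto
    show "(\<lambda>n. x - 1 / real (Suc n)) \<longlonglongrightarrow> x"
      using tendsto_diff[OF tendsto_const LIMSEQ_inverse_real_of_nat, of x] by (simp add: inverse_eq_divide)
  qed simp
  have "u \<omega> \<in> space N" using u \<omega> by (rule measurable_space)
  then have "isCont (G (u \<omega>)) (b \<omega>)" using cont continuous_on_eq_continuous_at by blast
  then show "(\<lambda>n. G (u \<omega>) (?r n (b \<omega>))) \<longlonglongrightarrow> G (u \<omega>) (b \<omega>)"
    using lim by (rule isCont_tendsto_compose)
qed

lemma open_subset_closure_rationals:
  fixes I :: "real set"
  assumes "open I"
  shows "I \<subseteq> closure (I \<inter> \<rat>)"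
proof -
  have "x \<in> closure \<rat>" for x :: real
    unfolding closure_approachable
  proof (intro allI impI)
    fix e :: real assume "e > 0"
    then obtain r where "r \<in> \<rat>" "x < r" "r < x + e" using Rats_dense_in_real[of x "x + e"] by auto
    then show "\<exists>y\<in>\<rat>. dist y x < e" by (intro bexI[of _ r]) (auto simp: dist_real_def)
  qed
  then show ?thesis using open_Int_closure_subset[OF assms, of \<rat>] by auto
qed

lemma continuous_le_on_rationals:
  fixes f :: "real \<Rightarrow> real"
  assumes "open I" "continuous_on UNIV f" "\<And>a. a \<in> I \<inter> \<rat> \<Longrightarrow> f a \<le> s" "a \<in> I"
  shows "f a \<le> s"
proof (rule continuous_le_on_closure[of "I \<inter> \<rat>" f a s])
  show "continuous_on (closure (I \<inter> \<rat>)) f" using assms(2) continuous_on_subset by blast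
qed (use assms open_subset_closure_rationals in blast)+

text \<open>By continuity the supremum over the open set \<open>I\<close> may be taken over its rational points. Where the
family is unbounded, the supremum of reals is one fixed unspecified value, which is measurable as well.\<close>

lemma sup_abs_measurable:
  fixes G :: "'b \<Rightarrow> real \<Rightarrow> real"
  assumes G: "\<And>a. (\<lambda>y. G y a) \<in> borel_measurable N"
    and cont: "\<And>y. y \<in> space N \<Longrightarrow> continuous_on UNIV (G y)"
    and I: "open I" "I \<noteq> {}"
  shows "{y \<in> space N. bdd_above ((\<lambda>a. \<bar>G y a\<bar>) ` I)} \<in> sets N"
    and "(\<lambda>y. SUP a\<in>I. \<bar>G y a\<bar>) \<in> borel_measurable N"
proof -
  have I': "countable (I \<inter> \<rat>)" "I \<inter> \<rat> \<noteq> {}"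
    using open_subset_closure_rationals[OF I(1)] I(2) by (auto intro: countable_subset[OF _ countable_rat])
  have cabs: "continuous_on UNIV (\<lambda>a. \<bar>G y a\<bar>)" if "y \<in> space N" for y
    using cont[OF that] by (intro continuous_intros)
  have ext: "\<bar>G y a\<bar> \<le> s" if "y \<in> space N" "\<And>a. a \<in> I \<inter> \<rat> \<Longrightarrow> \<bar>G y a\<bar> \<le> s" "a \<in> I" for y s a
    by (rule continuous_le_on_rationals[OF I(1) cabs]) (use that in auto)
  have bdd_iff: "bdd_above ((\<lambda>a. \<bar>G y a\<bar>) ` I) \<longleftrightarrow> (\<exists>k::nat. \<forall>a\<in>I \<inter> \<rat>. \<bar>G y a\<bar> \<le> real k)"
    if y: "y \<in> space N" for y
  proof
    assume "bdd_above ((\<lambda>a. \<bar>G y a\<bar>) ` I)"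
    then obtain s where s: "\<And>a. a \<in> I \<Longrightarrow> \<bar>G y a\<bar> \<le> s" by (auto simp: bdd_above_def)
    obtain k :: nat where "s \<le> real k" using real_arch_simple by blast
    then show "\<exists>k::nat. \<forall>a\<in>I \<inter> \<rat>. \<bar>G y a\<bar> \<le> real k" using s by (meson IntD1 order_trans)
  next
    assume "\<exists>k::nat. \<forall>a\<in>I \<inter> \<rat>. \<bar>G y a\<bar> \<le> real k"
    then obtain k :: nat where k: "\<And>a. a \<in> I \<inter> \<rat> \<Longrightarrow> \<bar>G y a\<bar> \<le> real k" by blast
    show "bdd_above ((\<lambda>a. \<bar>G y a\<bar>) ` I)"
      by (rule bdd_aboveI[of _ "real k"]) (use ext[OF y k] in auto)
  qed
  have "{y \<in> space N. bdd_above ((\<lambda>a. \<bar>G y a\<bar>) ` I)}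
      = {y \<in> space N. \<exists>k::nat. \<forall>a\<in>I \<inter> \<rat>. \<bar>G y a\<bar> \<le> real k}"
    by (intro Collect_cong conj_cong refl bdd_iff)
  also have "\<dots> = (\<Union>k::nat. space N \<inter> (\<Inter>a\<in>I \<inter> \<rat>. {y \<in> space N. \<bar>G y a\<bar> \<le> real k}))" by auto
  also have "\<dots> \<in> sets N"
  proof (rule sets.countable_UN'')
    fix k :: nat
    have "{y \<in> space N. \<bar>G y a\<bar> \<le> real k} \<in> sets N" for a using G[of a] by measurable
    then have "(\<Inter>a\<in>I \<inter> \<rat>. {y \<in> space N. \<bar>G y a\<bar> \<le> real k}) \<in> sets N"
      using I' by (intro sets.countable_INT') auto
    then show "space N \<inter> (\<Inter>a\<in>I \<inter> \<rat>. {y \<in> space N. \<bar>G y a\<bar> \<le> real k}) \<in> sets N" by auto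
  qed simp
  finally show bdd: "{y \<in> space N. bdd_above ((\<lambda>a. \<bar>G y a\<bar>) ` I)} \<in> sets N" .
  define G' where "G' = (\<lambda>a y. if bdd_above ((\<lambda>a. \<bar>G y a\<bar>) ` I) then \<bar>G y a\<bar> else (LEAST s. False))"
  have "(\<lambda>y. SUP a\<in>I \<inter> \<rat>. G' a y) \<in> borel_measurable N"
  proof (rule borel_measurable_cSUP[OF I'(1)])
    show "G' a \<in> borel_measurable N" for a
      unfolding G'_def using G[of a] bdd by (intro measurable_If) (auto simp: pred_def)
    show "bdd_above ((\<lambda>a. G' a y) ` (I \<inter> \<rat>))" if "y \<in> space N" for y
      by (cases "bdd_above ((\<lambda>a. \<bar>G y a\<bar>) ` I)")
        (auto simp: G'_def intro: bdd_above_mono image_mono)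
  qed
  moreover have "(SUP a\<in>I. \<bar>G y a\<bar>) = (SUP a\<in>I \<inter> \<rat>. G' a y)" if y: "y \<in> space N" for y
  proof (cases "bdd_above ((\<lambda>a. \<bar>G y a\<bar>) ` I)")
    case True
    have b: "bdd_above ((\<lambda>a. \<bar>G y a\<bar>) ` (I \<inter> \<rat>))"
      using True by (rule bdd_above_mono) auto
    have "(SUP a\<in>I. \<bar>G y a\<bar>) = (SUP a\<in>I \<inter> \<rat>. \<bar>G y a\<bar>)"
    proof (rule antisym)
      show "(SUP a\<in>I. \<bar>G y a\<bar>) \<le> (SUP a\<in>I \<inter> \<rat>. \<bar>G y a\<bar>)"
        by (rule cSUP_least[OF I(2)], rule ext[OF y]) (auto intro: cSUP_upper[OF _ b])
      show "(SUP a\<in>I \<inter> \<rat>. \<bar>G y a\<bar>) \<le> (SUP a\<in>I. \<bar>G y a\<bar>)"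
        by (rule cSUP_subset_mono[OF I'(2) True]) auto
    qed
    then show ?thesis using True by (simp add: G'_def)
  next
    case False
    \<comment> \<open>Without an upper bound, the supremum of a set of reals is the least element of the empty set.\<close>
    then have unb: "(\<forall>x\<in>(\<lambda>a. \<bar>G y a\<bar>) ` I. x \<le> z) = False" for z by (auto simp: bdd_above_def)
    have "(SUP a\<in>I. \<bar>G y a\<bar>) = (LEAST s. False)" unfolding Sup_real_def by (simp only: unb)
    then show ?thesis using False I'(2) by (simp add: G'_def)
  qed
  ultimately show "(\<lambda>y. SUP a\<in>I. \<bar>G y a\<bar>) \<in> borel_measurable N"
    by (simp cong: measurable_cong)
qed

lemma derivative_measurable:
  fixes G G' :: "'b \<Rightarrow> real \<Rightarrow> real"
  assumes G: "\<And>a. (\<lambda>y. G y a) \<in> borel_measurable N"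
    and der: "\<And>y. y \<in> space N \<Longrightarrow> (G y has_field_derivative G' y a) (at a)"
  shows "(\<lambda>y. G' y a) \<in> borel_measurable N"
proof (rule borel_measurable_LIMSEQ_real)
  show "(\<lambda>y. (G y (a + inverse (real (Suc n))) - G y a) / inverse (real (Suc n))) \<in> borel_measurable N" for n
    using G by measurable
  fix y assume "y \<in> space N"
  then have "(\<lambda>h. (G y (a + h) - G y a) / h) \<midarrow>0\<rightarrow> G' y a"
    using der by (simp add: DERIV_def)
  then show "(\<lambda>n. (G y (a + inverse (real (Suc n))) - G y a) / inverse (real (Suc n))) \<longlonglongrightarrow> G' y a"
    unfolding tendsto_at_iff_sequentially o_def
    using LIMSEQ_inverse_real_of_nat by (auto elim!: allE[of _ "\<lambda>n. inverse (real (Suc n))"])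
qed

text \<open>The mean value inequality applied twice, first to \<open>f'\<close> and then to \<open>f x - f' a * x\<close>.\<close>

lemma second_order_remainder:
  fixes f f' f'' :: "real \<Rightarrow> real"
  assumes 1: "\<And>x. (f has_field_derivative f' x) (at x)" and 2: "\<And>x. (f' has_field_derivative f'' x) (at x)"
    and bound: "\<And>x. x \<in> closed_segment a b \<Longrightarrow> \<bar>f'' x\<bar> \<le> R"
  shows "\<bar>f b - f a - f' a * (b - a)\<bar> \<le> R * (b - a)\<^sup>2"
proof -
  have R: "R \<ge> 0" using bound[of a] by auto
  have lip: "\<bar>f' x - f' a\<bar> \<le> R * \<bar>b - a\<bar>" if x: "x \<in> closed_segment a b" for x
  proof -
    have "norm (f' x - f' a) \<le> R * norm (x - a)"
      by (rule field_differentiable_bound[OF convex_closed_segment[of a b]])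
        (use 2 bound x in \<open>auto intro: has_field_derivative_at_within\<close>)
    also have "\<dots> \<le> R * \<bar>b - a\<bar>"
      using x R by (intro mult_left_mono) (auto simp: closed_segment_eq_real_ivl split: if_splits)
    finally show ?thesis by simp
  qed
  have "norm ((f b - f' a * b) - (f a - f' a * a)) \<le> R * \<bar>b - a\<bar> * norm (b - a)"
  proof (rule field_differentiable_bound[OF convex_closed_segment[of a b], where f' = "\<lambda>x. f' x - f' a * 1"])
    show "((\<lambda>x. f x - f' a * x) has_field_derivative f' x - f' a * 1) (at x within closed_segment a b)" for x
      by (intro DERIV_diff DERIV_cmult DERIV_ident has_field_derivative_at_within[OF 1])
    show "norm (f' x - f' a * 1) \<le> R * \<bar>b - a\<bar>" if "x \<in> closed_segment a b" for x
      using lip[OF that] by simp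
  qed auto
  then show ?thesis by (simp add: power2_eq_square algebra_simps abs_mult_self_eq flip: abs_mult)
qed

lemma (in prob_space) finite_measure_subalgebra_gen_sigma:
  assumes "Z \<in> borel_measurable M"
  shows "finite_measure_subalgebra M (gen_sigma M Z)"
proof -
  have "subalgebra M (gen_sigma M Z)"
    using assms unfolding subalgebra_def gen_sigma_def
    by (auto simp: sets_vimage_algebra2 measurable_sets)
  then show ?thesis
    by (simp add: finite_measure_subalgebra_def finite_measure_axioms finite_measure_subalgebra_axioms_def)
qed

lemma measurable_gen_sigma:
  assumes "b \<in> borel_measurable borel"
  shows "(\<lambda>\<omega>. b (Z \<omega>)) \<in> borel_measurable (gen_sigma M Z)"
  unfolding gen_sigma_def
  by (rule measurable_compose[OF measurable_vimage_algebra1 assms]) simp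

lemma (in prob_space) expectation_cond_exp:
  assumes Z: "Z \<in> borel_measurable M" and b: "b \<in> borel_measurable borel" and X: "X \<in> borel_measurable M"
    and int: "integrable M (\<lambda>\<omega>. b (Z \<omega>) * X \<omega>)"
  shows "integrable M (\<lambda>\<omega>. b (Z \<omega>) * cond_exp M Z X \<omega>)"
    and "expectation (\<lambda>\<omega>. b (Z \<omega>) * cond_exp M Z X \<omega>) = expectation (\<lambda>\<omega>. b (Z \<omega>) * X \<omega>)"
proof -
  interpret F: finite_measure_subalgebra M "gen_sigma M Z"
    by (rule finite_measure_subalgebra_gen_sigma[OF Z])
  show "integrable M (\<lambda>\<omega>. b (Z \<omega>) * cond_exp M Z X \<omega>)"
    "expectation (\<lambda>\<omega>. b (Z \<omega>) * cond_exp M Z X \<omega>) = expectation (\<lambda>\<omega>. b (Z \<omega>) * X \<omega>)"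
    unfolding cond_exp_def
    by (rule F.real_cond_exp_intg[OF int measurable_gen_sigma[OF b] X])+
qed

text \<open>Since \<open>x^2 / 2 \<le> exp x\<close> for \<open>x \<ge> 0\<close>, a bound on the conditional exponential moment gives a finite
second moment.\<close>

lemma (in prob_space) square_integrable_of_exp_moment:
  assumes Z: "Z \<in> borel_measurable M" and X: "X \<in> borel_measurable M" and c: "c > 0"
    and nonneg: "AE \<omega> in M. X \<omega> \<ge> 0"
    and bound: "AE \<omega> in M. nonneg_cond_exp M Z (\<lambda>\<omega>. exp (X \<omega> / c)) \<omega> \<le> ennreal C"
  shows "integrable M (\<lambda>\<omega>. (X \<omega>)\<^sup>2)"
proof -
  interpret F: finite_measure_subalgebra M "gen_sigma M Z"
    by (rule finite_measure_subalgebra_gen_sigma[OF Z])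
  have m: "(\<lambda>\<omega>. ennreal (exp (X \<omega> / c))) \<in> borel_measurable M" using X by measurable
  have "(\<integral>\<^sup>+\<omega>. ennreal (exp (X \<omega> / c)) \<partial>M) = (\<integral>\<^sup>+\<omega>. nonneg_cond_exp M Z (\<lambda>\<omega>. exp (X \<omega> / c)) \<omega> \<partial>M)"
    using F.nn_cond_exp_intg[OF _ m, of "\<lambda>_. 1"] by (simp add: nonneg_cond_exp_def)
  also have "\<dots> \<le> (\<integral>\<^sup>+\<omega>. ennreal C \<partial>M)" by (rule nn_integral_mono_AE[OF bound])
  also have "\<dots> < \<infinity>" by (simp add: emeasure_space_1)
  finally have fin: "(\<integral>\<^sup>+\<omega>. ennreal (exp (X \<omega> / c)) \<partial>M) < \<infinity>" .
  have "integrable M (\<lambda>\<omega>. exp (X \<omega> / c))"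
    using fin X by (intro integrableI_nonneg) auto
  then have "integrable M (\<lambda>\<omega>. 2 * c\<^sup>2 * exp (X \<omega> / c))" by simp
  then show ?thesis
  proof (rule Bochner_Integration.integrable_bound)
    show "AE \<omega> in M. norm ((X \<omega>)\<^sup>2) \<le> norm (2 * c\<^sup>2 * exp (X \<omega> / c))"
      using nonneg
    proof eventually_elim
      case (elim \<omega>)
      have "0 \<le> X \<omega> / c" using elim c by simp
      then have "(X \<omega> / c)\<^sup>2 / 2 \<le> exp (X \<omega> / c)"
        using exp_lower_Taylor_quadratic[of "X \<omega> / c"] by linarith
      then have "(X \<omega>)\<^sup>2 \<le> 2 * c\<^sup>2 * exp (X \<omega> / c)" using c by (simp add: field_simps power_divide)
      then show ?case by simp
    qed
  qed (use X in measurable)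
qed

section \<open>The regression model\<close>

lemma integrable_bounded_mult:
  fixes X b :: "'a \<Rightarrow> real"
  assumes X: "integrable M X" and b: "b \<in> borel_measurable M" and bd: "\<And>\<omega>. \<omega> \<in> space M \<Longrightarrow> \<bar>b \<omega>\<bar> \<le> c"
  shows "integrable M (\<lambda>\<omega>. b \<omega> * X \<omega>)"
proof (rule Bochner_Integration.integrable_bound)
  show "integrable M (\<lambda>\<omega>. c * X \<omega>)" using X by simp
  show "AE \<omega> in M. norm (b \<omega> * X \<omega>) \<le> norm (c * X \<omega>)"
  proof (rule AE_I2)
    fix \<omega> assume "\<omega> \<in> space M"
    then have "\<bar>b \<omega>\<bar> \<le> \<bar>c\<bar>" using bd by fastforce
    then show "norm (b \<omega> * X \<omega>) \<le> norm (c * X \<omega>)" by (simp add: abs_mult mult_right_mono)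
  qed
qed (use X b in measurable)

text \<open>The hypotheses on the data, the criterion function and the basis that do not involve the sequence of
smoothing parameters.\<close>

locale spline_model = prob_space M for M :: "'w measure" +
  fixes Y Z :: "'w \<Rightarrow> real" and Ys Zs :: "nat \<Rightarrow> 'w \<Rightarrow> real" and \<Y> :: "real set"
    and g0 \<phi> :: "real \<Rightarrow> real" and l :: "real \<Rightarrow> real \<Rightarrow> real" and m :: nat
    and H :: "(real \<Rightarrow> real) set" and h_fun :: "nat \<Rightarrow> real \<Rightarrow> real" and \<gamma> :: "nat \<Rightarrow> real"
    and C\<^sub>0 C\<^sub>1 C\<^sub>2 lo hi :: real
  assumes Y_meas: "Y \<in> borel_measurable M" and Z_meas: "Z \<in> borel_measurable M"
    and T_range: "\<And>\<omega>. \<omega> \<in> space M \<Longrightarrow> Y \<omega> \<in> \<Y> \<and> Z \<omega> \<in> {0..1}"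
    and Ti_range: "\<And>i \<omega>. i \<ge> 1 \<Longrightarrow> \<omega> \<in> space M \<Longrightarrow> Ys i \<omega> \<in> \<Y> \<and> Zs i \<omega> \<in> {0..1}"
    and indep: "indep_vars (\<lambda>_. borel) (\<lambda>i \<omega>. (Ys i \<omega>, Zs i \<omega>)) {1..}"
    and ident: "\<And>i. i \<ge> 1 \<Longrightarrow>
      distr M borel (\<lambda>\<omega>. (Ys i \<omega>, Zs i \<omega>)) = distr M borel (\<lambda>\<omega>. (Y \<omega>, Z \<omega>))"
    and m: "m \<ge> 1"
    and H: "H = sobolev m \<or> H = sobolev_periodic m"
    and g0: "g0 \<in> H"
    and l_meas: "\<And>a. (\<lambda>y. l y a) \<in> borel_measurable (restrict_space borel \<Y>)"
    and smooth: "\<And>y k. y \<in> \<Y> \<Longrightarrow> k < 3 \<Longrightarrow> dl k l y differentiable_on UNIV"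
    and smooth3: "\<And>y. y \<in> \<Y> \<Longrightarrow> continuous_on UNIV (dl 3 l y)"
    and g0_range: "g0 ` {0..1} \<subseteq> {lo<..<hi}"
    and C_pos: "C\<^sub>0 > 0" "C\<^sub>1 > 0" "C\<^sub>2 > 0"
    and bdd2: "AE \<omega> in M. bdd_above ((\<lambda>a. \<bar>dl 2 l (Y \<omega>) a\<bar>) ` {lo<..<hi})"
    and exp2: "AE \<omega> in M. nonneg_cond_exp M Z
      (\<lambda>\<omega>. exp ((SUP a\<in>{lo<..<hi}. \<bar>dl 2 l (Y \<omega>) a\<bar>) / C\<^sub>0)) \<omega> \<le> ennreal C\<^sub>0"
    and bdd3: "AE \<omega> in M. bdd_above ((\<lambda>a. \<bar>dl 3 l (Y \<omega>) a\<bar>) ` {lo<..<hi})"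
    and exp3: "AE \<omega> in M. nonneg_cond_exp M Z
      (\<lambda>\<omega>. exp ((SUP a\<in>{lo<..<hi}. \<bar>dl 3 l (Y \<omega>) a\<bar>) / C\<^sub>0)) \<omega> \<le> ennreal C\<^sub>1"
    and info_bounds: "AE \<omega> in M. inverse C\<^sub>2 \<le> info M Y Z l g0 \<omega> \<and> info M Y Z l g0 \<omega> \<le> C\<^sub>2"
    and h_fun_mem: "\<And>\<nu>. h_fun \<nu> \<in> H"
    and h_fun_bdd: "bdd_above (range (\<lambda>\<nu>. sup_norm (h_fun \<nu>)))"
    and diag_V: "\<And>\<mu> \<nu>. V_form M Y Z l g0 (h_fun \<mu>) (h_fun \<nu>) = (if \<mu> = \<nu> then 1 else 0)"
    and diag_J: "\<And>\<mu> \<nu>. roughness m (h_fun \<mu>) (h_fun \<nu>) = (if \<mu> = \<nu> then \<gamma> \<mu> else 0)"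
    and phi: "cond_exp_version M Z (\<lambda>\<omega>. SUP a\<in>{lo<..<hi}. \<bar>dl 3 l (Y \<omega>) a\<bar>) \<phi>"
      "bdd_above (\<phi> ` {0..1})"
begin

abbreviation pip :: "real \<Rightarrow> (real \<Rightarrow> real) \<Rightarrow> (real \<Rightarrow> real) \<Rightarrow> real" where
  "pip \<equiv> pen_inner M Y Z l g0 m"

abbreviation pnorm :: "real \<Rightarrow> (real \<Rightarrow> real) \<Rightarrow> real" where
  "pnorm \<equiv> pen_norm M Y Z l g0 m"

lemma H_sobolev: "f \<in> H \<Longrightarrow> f \<in> sobolev m"
  using H by (auto simp: sobolev_periodic_def)

lemma H_lincomb: "f \<in> H \<Longrightarrow> g \<in> H \<Longrightarrow> (\<lambda>z. f z + a * g z) \<in> H"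
  using H sobolev_lincomb(1) sobolev_periodic_lincomb m by auto

lemma H_continuous: "f \<in> H \<Longrightarrow> continuous_on {0..1} f"
  using H_sobolev sobolev_continuous m by blast

lemma H_bounded:
  assumes "f \<in> H"
  obtains b where "b \<ge> 0" "\<And>z. z \<in> {0..1} \<Longrightarrow> \<bar>f z\<bar> \<le> b"
proof -
  have "bounded (f ` {0..1})"
    by (intro compact_imp_bounded compact_continuous_image H_continuous assms) simp
  then obtain b where "b > 0" "\<And>z. z \<in> {0..1} \<Longrightarrow> \<bar>f z\<bar> \<le> b" by (auto simp: bounded_pos)
  then show ?thesis using that[of b] by simp
qed

definition B :: real where
  "B = (SUP \<nu>. sup_norm (h_fun \<nu>))"

lemma h_fun_le: "z \<in> {0..1} \<Longrightarrow> \<bar>h_fun \<nu> z\<bar> \<le> B"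
proof -
  assume z: "z \<in> {0..1}"
  obtain b where "\<And>z. z \<in> {0..1} \<Longrightarrow> \<bar>h_fun \<nu> z\<bar> \<le> b" using H_bounded[OF h_fun_mem] by blast
  then have "bdd_above ((\<lambda>z. \<bar>h_fun \<nu> z\<bar>) ` {0..1})" by (rule bdd_aboveI2)
  then have "\<bar>h_fun \<nu> z\<bar> \<le> sup_norm (h_fun \<nu>)" unfolding sup_norm_def using z by (rule cSUP_upper[rotated])
  also have "\<dots> \<le> B" unfolding B_def by (rule cSUP_upper[OF _ h_fun_bdd]) simp
  finally show ?thesis .
qed

lemma B_nonneg: "B \<ge> 0"
  using h_fun_le[of 0 0] by simp

text \<open>Cutting a function off outside the unit interval makes it Borel on the whole line if it is
continuous on the interval.\<close>

definition cutoff01 :: "(real \<Rightarrow> real) \<Rightarrow> real \<Rightarrow> real" where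
  "cutoff01 f z = indicat_real {0..1} z * f z"

lemma cutoff01_measurable: "f \<in> H \<Longrightarrow> cutoff01 f \<in> borel_measurable borel"
  unfolding cutoff01_def
  using borel_measurable_continuous_on_indicator[of "{0..1}" f] H_continuous by simp

lemma cutoff01_eq: "z \<in> {0..1} \<Longrightarrow> cutoff01 f z = f z"
  by (simp add: cutoff01_def)

lemma fZ_measurable:
  assumes f: "f \<in> H"
  shows "(\<lambda>\<omega>. f (Z \<omega>)) \<in> borel_measurable M"
proof -
  have "(\<lambda>\<omega>. cutoff01 f (Z \<omega>)) \<in> borel_measurable M"
    using cutoff01_measurable[OF f] Z_meas by measurable
  then show ?thesis by (rule measurable_cong[THEN iffD1, rotated]) (use T_range cutoff01_eq in auto)
qed

text \<open>The observations are viewed as elements of this subspace of the plane, on which the second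
and third derivatives of the criterion are measurable functions.\<close>

definition sample_space :: "(real \<times> real) measure" where
  "sample_space = restrict_space borel (\<Y> \<times> {0..1})"

definition T :: "'w \<Rightarrow> real \<times> real" where "T \<omega> = (Y \<omega>, Z \<omega>)"

definition Ts :: "nat \<Rightarrow> 'w \<Rightarrow> real \<times> real" where "Ts i \<omega> = (Ys i \<omega>, Zs i \<omega>)"

lemma space_sample_space: "space sample_space = \<Y> \<times> {0..1}"
  by (simp add: sample_space_def space_restrict_space)

lemma T_in: "\<omega> \<in> space M \<Longrightarrow> T \<omega> \<in> \<Y> \<times> {0..1}" "i \<ge> 1 \<Longrightarrow> \<omega> \<in> space M \<Longrightarrow> Ts i \<omega> \<in> \<Y> \<times> {0..1}"
  using T_range Ti_range by (auto simp: T_def Ts_def)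

lemma T_borel: "T \<in> borel_measurable M"
  unfolding T_def using Y_meas Z_meas by measurable

lemma Ts_borel: "i \<ge> 1 \<Longrightarrow> Ts i \<in> borel_measurable M"
  using indep by (auto simp: indep_vars_def Ts_def[abs_def])

lemma T_measurable: "T \<in> measurable M sample_space"
  unfolding sample_space_def by (intro measurable_to_restrict_borel T_borel T_in)

lemma Ts_measurable: "i \<ge> 1 \<Longrightarrow> Ts i \<in> measurable M sample_space"
  unfolding sample_space_def by (intro measurable_to_restrict_borel Ts_borel T_in)

lemma Ts_indep: "indep_vars (\<lambda>_. sample_space) Ts {1..}"
  unfolding sample_space_def
proof (rule indep_vars_restrict_borel)
  show "indep_vars (\<lambda>_. borel) Ts {1..}" using indep by (simp add: Ts_def[abs_def])
qed (use T_in in auto)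

lemma Ts_distr: "i \<ge> 1 \<Longrightarrow> distr M sample_space (Ts i) = distr M sample_space T"
  unfolding sample_space_def using ident
  by (intro distr_restrict_borel_cong Ts_borel T_borel T_in) (auto simp: Ts_def[abs_def] T_def[abs_def])

lemma transfer:
  fixes q :: "real \<times> real \<Rightarrow> real"
  assumes q: "q \<in> borel_measurable sample_space" and i: "i \<ge> 1"
  shows "integrable M (\<lambda>\<omega>. q (Ts i \<omega>)) \<longleftrightarrow> integrable M (\<lambda>\<omega>. q (T \<omega>))"
    and "expectation (\<lambda>\<omega>. q (Ts i \<omega>)) = expectation (\<lambda>\<omega>. q (T \<omega>))"
  using integrable_distr_eq[OF Ts_measurable[OF i] q] integrable_distr_eq[OF T_measurable q]
    integral_distr[OF Ts_measurable[OF i] q] integral_distr[OF T_measurable q]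
  by (simp_all add: Ts_distr[OF i])

lemma fst_measurable_sample: "fst \<in> measurable sample_space (restrict_space borel \<Y>)"
  unfolding sample_space_def
  by (intro measurable_restrict_space2 measurable_restrict_space1)
    (auto simp: space_restrict_space borel_prod[symmetric])

lemma snd_measurable_sample: "f \<in> H \<Longrightarrow> (\<lambda>p. f (snd p)) \<in> borel_measurable sample_space"
proof -
  assume f: "f \<in> H"
  have "snd \<in> borel_measurable sample_space"
    unfolding sample_space_def by (intro measurable_restrict_space1) (simp add: borel_prod[symmetric])
  then have "(\<lambda>p. cutoff01 f (snd p)) \<in> borel_measurable sample_space"
    using cutoff01_measurable[OF f] by measurable
  then show ?thesis
    by (rule measurable_cong[THEN iffD1, rotated]) (auto simp: space_sample_space cutoff01_eq)
qed

lemma dl_derivative: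
  assumes "y \<in> \<Y>" "k < 3"
  shows "(dl k l y has_field_derivative dl (Suc k) l y a) (at a)"
proof -
  have "dl k l y differentiable (at a)" using smooth[OF assms] by (simp add: differentiable_on_def)
  then show ?thesis by (simp add: dl_def DERIV_deriv_iff_real_differentiable)
qed

lemma dl_continuous:
  assumes "y \<in> \<Y>" "k \<le> 3"
  shows "continuous_on UNIV (dl k l y)"
proof (cases "k = 3")
  case True
  then show ?thesis using smooth3[OF assms(1)] by simp
next
  case False
  then show ?thesis using assms by (intro differentiable_imp_continuous_on smooth) auto
qed

lemma dl_measurable: "k \<le> 3 \<Longrightarrow> (\<lambda>y. dl k l y a) \<in> borel_measurable (restrict_space borel \<Y>)"
proof (induction k arbitrary: a)
  case 0
  then show ?case using l_meas by (simp add: dl_def)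
next
  case (Suc k)
  show ?case
  proof (rule derivative_measurable[where G = "dl k l" and G' = "dl (Suc k) l"])
    show "(\<lambda>y. dl k l y a) \<in> borel_measurable (restrict_space borel \<Y>)" for a using Suc by simp
    show "(dl k l y has_field_derivative dl (Suc k) l y a) (at a)"
      if "y \<in> space (restrict_space borel \<Y>)" for y
      using that Suc.prems by (intro dl_derivative) (auto simp: space_restrict_space)
  qed
qed

definition curvature :: "real \<times> real \<Rightarrow> real" where
  "curvature p = dl 2 l (fst p) (g0 (snd p))"

definition third_envelope :: "real \<times> real \<Rightarrow> real" where
  "third_envelope p = (SUP a\<in>{lo<..<hi}. \<bar>dl 3 l (fst p) a\<bar>)"

lemma interval_open: "open {lo<..<hi}" "{lo<..<hi} \<noteq> {}"
  using g0_range by auto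

lemma sup_dl_measurable:
  assumes "k \<le> 3"
  shows "(\<lambda>y. SUP a\<in>{lo<..<hi}. \<bar>dl k l y a\<bar>) \<in> borel_measurable (restrict_space borel \<Y>)"
    and "{y \<in> \<Y>. bdd_above ((\<lambda>a. \<bar>dl k l y a\<bar>) ` {lo<..<hi})} \<in> sets (restrict_space borel \<Y>)"
  using sup_abs_measurable[OF dl_measurable[OF assms] dl_continuous[OF _ assms] interval_open]
  by (auto simp: space_restrict_space)

lemma curv_measurable: "curvature \<in> borel_measurable sample_space"
  unfolding curvature_def
  by (rule caratheodory_measurable[where G = "dl 2 l" and N = "restrict_space borel \<Y>"])
    (auto simp: space_restrict_space intro: dl_measurable dl_continuous fst_measurable_sample snd_measurable_sample g0)

lemma third_measurable: "third_envelope \<in> borel_measurable sample_space"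
  unfolding third_envelope_def by (rule measurable_compose[OF fst_measurable_sample sup_dl_measurable(1)]) simp

lemma supY_measurable: "k \<le> 3 \<Longrightarrow> (\<lambda>\<omega>. SUP a\<in>{lo<..<hi}. \<bar>dl k l (Y \<omega>) a\<bar>) \<in> borel_measurable M"
  using measurable_compose[OF measurable_compose[OF T_measurable fst_measurable_sample] sup_dl_measurable(1)]
  by (simp add: T_def)

lemma sup_nonneg:
  assumes "bdd_above ((\<lambda>a. \<bar>f a\<bar>) ` {lo<..<hi})"
  shows "0 \<le> (SUP a\<in>{lo<..<hi}. \<bar>f a :: real\<bar>)"
proof -
  obtain a where "a \<in> {lo<..<hi}" using interval_open(2) by blast
  then show ?thesis using cSUP_upper[OF _ assms, of a] by fastforce
qed

lemma third_square_integrable: "integrable M (\<lambda>\<omega>. (third_envelope (T \<omega>))\<^sup>2)"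
  unfolding third_envelope_def T_def fst_conv
  by (rule square_integrable_of_exp_moment[OF Z_meas supY_measurable C_pos(1) _ exp3])
    (use bdd3 sup_nonneg in \<open>auto elim: eventually_mono\<close>)

lemma curv_square_integrable: "integrable M (\<lambda>\<omega>. (curvature (T \<omega>))\<^sup>2)"
proof (rule Bochner_Integration.integrable_bound)
  show "integrable M (\<lambda>\<omega>. (SUP a\<in>{lo<..<hi}. \<bar>dl 2 l (Y \<omega>) a\<bar>)\<^sup>2)"
    by (rule square_integrable_of_exp_moment[OF Z_meas supY_measurable C_pos(1) _ exp2])
      (use bdd2 sup_nonneg in \<open>auto elim: eventually_mono\<close>)
  show "(\<lambda>\<omega>. (curvature (T \<omega>))\<^sup>2) \<in> borel_measurable M"
    using measurable_compose[OF T_measurable curv_measurable] by measurable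
  show "AE \<omega> in M. norm ((curvature (T \<omega>))\<^sup>2) \<le> norm ((SUP a\<in>{lo<..<hi}. \<bar>dl 2 l (Y \<omega>) a\<bar>)\<^sup>2)"
    using bdd2 AE_space
  proof eventually_elim
    case (elim \<omega>)
    have "g0 (Z \<omega>) \<in> {lo<..<hi}" using g0_range T_range[OF elim(2)] by (simp only: image_subset_iff)
    then have "\<bar>curvature (T \<omega>)\<bar> \<le> (SUP a\<in>{lo<..<hi}. \<bar>dl 2 l (Y \<omega>) a\<bar>)"
      unfolding curvature_def T_def using cSUP_upper[OF _ elim(1)] by simp
    then have "\<bar>curvature (T \<omega>)\<bar>\<^sup>2 \<le> (SUP a\<in>{lo<..<hi}. \<bar>dl 2 l (Y \<omega>) a\<bar>)\<^sup>2" by (intro power_mono) auto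
    then show ?case by simp
  qed
qed

lemma curv_integrable: "integrable M (\<lambda>\<omega>. curvature (T \<omega>))"
  using square_integrable_imp_integrable[OF measurable_compose[OF T_measurable curv_measurable] curv_square_integrable]
  by simp

lemma third_integrable: "integrable M (\<lambda>\<omega>. third_envelope (T \<omega>))"
  using square_integrable_imp_integrable[OF measurable_compose[OF T_measurable third_measurable] third_square_integrable]
  by simp

lemma fkZ:
  assumes "f \<in> H" "k \<in> H"
  obtains c where "(\<lambda>\<omega>. f (Z \<omega>) * k (Z \<omega>)) \<in> borel_measurable M"
    "\<And>\<omega>. \<omega> \<in> space M \<Longrightarrow> \<bar>f (Z \<omega>) * k (Z \<omega>)\<bar> \<le> c"
proof -
  obtain b where b: "b \<ge> 0" "\<And>z. z \<in> {0..1} \<Longrightarrow> \<bar>f z\<bar> \<le> b" using H_bounded[OF assms(1)] by blast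
  obtain b' where b': "b' \<ge> 0" "\<And>z. z \<in> {0..1} \<Longrightarrow> \<bar>k z\<bar> \<le> b'" using H_bounded[OF assms(2)] by blast
  show ?thesis
  proof (rule that[of "b * b'"])
    show "(\<lambda>\<omega>. f (Z \<omega>) * k (Z \<omega>)) \<in> borel_measurable M"
      using fZ_measurable assms by measurable
    show "\<bar>f (Z \<omega>) * k (Z \<omega>)\<bar> \<le> b * b'" if "\<omega> \<in> space M" for \<omega>
      unfolding abs_mult using b b' T_range[OF that] by (intro mult_mono) auto
  qed
qed

lemma integrable_weighted:
  assumes X: "integrable M X" and f: "f \<in> H" and k: "k \<in> H"
  shows "integrable M (\<lambda>\<omega>. X \<omega> * f (Z \<omega>) * k (Z \<omega>))"
proof -
  obtain c where c: "(\<lambda>\<omega>. f (Z \<omega>) * k (Z \<omega>)) \<in> borel_measurable M"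
    "\<And>\<omega>. \<omega> \<in> space M \<Longrightarrow> \<bar>f (Z \<omega>) * k (Z \<omega>)\<bar> \<le> c" using fkZ[OF f k] by blast
  show ?thesis using integrable_bounded_mult[OF X c] by (simp add: mult_ac)
qed

lemma info_measurable: "info M Y Z l g0 \<in> borel_measurable M"
  unfolding info_def[abs_def] cond_exp_def by measurable

lemma info_integrable: "integrable M (info M Y Z l g0)"
proof (rule integrable_const_bound[of _ "C\<^sub>2"])
  show "AE \<omega> in M. norm (info M Y Z l g0 \<omega>) \<le> C\<^sub>2"
    using info_bounds
  proof eventually_elim
    case (elim \<omega>)
    moreover have "inverse C\<^sub>2 > 0" using C_pos by simp
    ultimately have "0 \<le> info M Y Z l g0 \<omega>" by linarith
    then show ?case using elim by simp
  qed
qed (rule info_measurable)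

abbreviation V :: "(real \<Rightarrow> real) \<Rightarrow> (real \<Rightarrow> real) \<Rightarrow> real" where
  "V \<equiv> V_form M Y Z l g0"

lemma V_sym: "V f k = V k f"
  unfolding V_form_def by (intro Bochner_Integration.integral_cong) auto

lemma V_lincomb:
  assumes "f \<in> H" "g \<in> H" "k \<in> H"
  shows "V (\<lambda>z. f z + a * g z) k = V f k + a * V g k"
proof -
  have "V (\<lambda>z. f z + a * g z) k = expectation (\<lambda>\<omega>. info M Y Z l g0 \<omega> * f (Z \<omega>) * k (Z \<omega>)
      + a * (info M Y Z l g0 \<omega> * g (Z \<omega>) * k (Z \<omega>)))"
    unfolding V_form_def by (intro Bochner_Integration.integral_cong) (auto simp: algebra_simps)
  also have "\<dots> = V f k + a * V g k"
    unfolding V_form_def using integrable_weighted[OF info_integrable] assms by simp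
  finally show ?thesis .
qed

text \<open>The information is bounded below by \<open>1 / C\<^sub>2\<close>, so \<open>V\<close> dominates the squared norm in \<open>L\<^sub>2\<close> of the law of
\<open>Z\<close>.\<close>

lemma V_ge:
  assumes f: "f \<in> H"
  shows "expectation (\<lambda>\<omega>. (f (Z \<omega>))\<^sup>2) \<le> C\<^sub>2 * V f f" "V f f \<ge> 0"
proof -
  have int: "integrable M (\<lambda>\<omega>. (f (Z \<omega>))\<^sup>2)"
    using integrable_weighted[of "\<lambda>_. 1", OF _ f f] by (simp add: power2_eq_square)
  have int': "integrable M (\<lambda>\<omega>. C\<^sub>2 * (info M Y Z l g0 \<omega> * f (Z \<omega>) * f (Z \<omega>)))"
    using integrable_weighted[OF info_integrable f f] by simp
  have "expectation (\<lambda>\<omega>. (f (Z \<omega>))\<^sup>2) \<le> expectation (\<lambda>\<omega>. C\<^sub>2 * (info M Y Z l g0 \<omega> * f (Z \<omega>) * f (Z \<omega>)))"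
  proof (rule integral_mono_AE[OF int int'])
    show "AE \<omega> in M. (f (Z \<omega>))\<^sup>2 \<le> C\<^sub>2 * (info M Y Z l g0 \<omega> * f (Z \<omega>) * f (Z \<omega>))"
      using info_bounds
    proof eventually_elim
      case (elim \<omega>)
      have "1 = C\<^sub>2 * inverse C\<^sub>2" using C_pos by simp
      also have "\<dots> \<le> C\<^sub>2 * info M Y Z l g0 \<omega>" using elim C_pos by (intro mult_left_mono) auto
      finally have "1 * (f (Z \<omega>))\<^sup>2 \<le> (C\<^sub>2 * info M Y Z l g0 \<omega>) * (f (Z \<omega>))\<^sup>2"
        by (rule mult_right_mono) simp
      then show ?case by (simp add: power2_eq_square mult_ac)
    qed
  qed
  then show 1: "expectation (\<lambda>\<omega>. (f (Z \<omega>))\<^sup>2) \<le> C\<^sub>2 * V f f" by (simp add: V_form_def)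
  have "0 \<le> expectation (\<lambda>\<omega>. (f (Z \<omega>))\<^sup>2)" by (rule Bochner_Integration.integral_nonneg) simp
  then have "0 \<le> C\<^sub>2 * V f f" using 1 by linarith
  then show "V f f \<ge> 0" using C_pos(3) by (simp add: zero_le_mult_iff)
qed

text \<open>The information is minus the conditional expectation of \<open>l''\<close> given \<open>Z\<close>, and the factors \<open>f (Z \<omega>)\<close> and
\<open>k (Z \<omega>)\<close> are functions of \<open>Z\<close>.\<close>

lemma V_eq_curv:
  assumes f: "f \<in> H" and k: "k \<in> H"
  shows "expectation (\<lambda>\<omega>. curvature (T \<omega>) * f (Z \<omega>) * k (Z \<omega>)) = - V f k"
proof -
  let ?b = "\<lambda>z. cutoff01 f z * cutoff01 k z"
  have b: "?b \<in> borel_measurable borel" using cutoff01_measurable f k by measurable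
  have bZ: "?b (Z \<omega>) = f (Z \<omega>) * k (Z \<omega>)" if "\<omega> \<in> space M" for \<omega>
    using T_range[OF that] by (simp add: cutoff01_eq)
  have int: "integrable M (\<lambda>\<omega>. ?b (Z \<omega>) * curvature (T \<omega>))"
    by (rule Bochner_Integration.integrable_cong[THEN iffD1, OF refl _ integrable_weighted[OF curv_integrable f k]])
      (simp add: bZ mult_ac)
  have "expectation (\<lambda>\<omega>. curvature (T \<omega>) * f (Z \<omega>) * k (Z \<omega>)) = expectation (\<lambda>\<omega>. ?b (Z \<omega>) * curvature (T \<omega>))"
    by (intro Bochner_Integration.integral_cong) (simp_all add: bZ mult_ac)
  also have "\<dots> = expectation (\<lambda>\<omega>. ?b (Z \<omega>) * cond_exp M Z (\<lambda>\<omega>. curvature (T \<omega>)) \<omega>)"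
    by (rule expectation_cond_exp(2)[OF Z_meas b measurable_compose[OF T_measurable curv_measurable] int, symmetric])
  also have "\<dots> = expectation (\<lambda>\<omega>. - (info M Y Z l g0 \<omega> * f (Z \<omega>) * k (Z \<omega>)))"
    by (intro Bochner_Integration.integral_cong refl, subst bZ)
      (simp_all add: info_def curvature_def T_def mult_ac)
  also have "\<dots> = - V f k" by (simp add: V_form_def)
  finally show ?thesis .
qed

abbreviation Cl :: real where "Cl \<equiv> (SUP z\<in>{0..1}. \<phi> z)"

text \<open>Conditioning on \<open>Z\<close> replaces the envelope by \<open>\<phi> (Z \<omega>)\<close>, which is at most the supremum of \<open>\<phi>\<close>.\<close>

lemma third_le:
  assumes f: "f \<in> H"
  shows "expectation (\<lambda>\<omega>. third_envelope (T \<omega>) * f (Z \<omega>) * f (Z \<omega>)) \<le> Cl * expectation (\<lambda>\<omega>. (f (Z \<omega>))\<^sup>2)"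
proof -
  let ?b = "\<lambda>z. cutoff01 f z * cutoff01 f z"
  have b: "?b \<in> borel_measurable borel" using cutoff01_measurable f by measurable
  have bZ: "?b (Z \<omega>) = f (Z \<omega>) * f (Z \<omega>)" if "\<omega> \<in> space M" for \<omega>
    using T_range[OF that] by (simp add: cutoff01_eq)
  have int: "integrable M (\<lambda>\<omega>. ?b (Z \<omega>) * third_envelope (T \<omega>))"
    by (rule Bochner_Integration.integrable_cong[THEN iffD1, OF refl _ integrable_weighted[OF third_integrable f f]])
      (simp add: bZ mult_ac)
  note E = expectation_cond_exp[OF Z_meas b measurable_compose[OF T_measurable third_measurable] int]
  have "expectation (\<lambda>\<omega>. third_envelope (T \<omega>) * f (Z \<omega>) * f (Z \<omega>)) = expectation (\<lambda>\<omega>. ?b (Z \<omega>) * third_envelope (T \<omega>))"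
    by (intro Bochner_Integration.integral_cong) (simp_all add: bZ mult_ac)
  also have "\<dots> = expectation (\<lambda>\<omega>. ?b (Z \<omega>) * cond_exp M Z (\<lambda>\<omega>. third_envelope (T \<omega>)) \<omega>)"
    by (rule E(2)[symmetric])
  also have "\<dots> \<le> expectation (\<lambda>\<omega>. Cl * (f (Z \<omega>))\<^sup>2)"
  proof (rule integral_mono_AE[OF E(1)])
    show "integrable M (\<lambda>\<omega>. Cl * (f (Z \<omega>))\<^sup>2)"
      using integrable_weighted[of "\<lambda>_. 1", OF _ f f] by (simp add: power2_eq_square)
    have "AE \<omega> in M. \<phi> (Z \<omega>) = cond_exp M Z (\<lambda>\<omega>. third_envelope (T \<omega>)) \<omega>"
      using phi(1) by (simp add: cond_exp_version_def third_envelope_def T_def)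
    then show "AE \<omega> in M. ?b (Z \<omega>) * cond_exp M Z (\<lambda>\<omega>. third_envelope (T \<omega>)) \<omega> \<le> Cl * (f (Z \<omega>))\<^sup>2"
      using AE_space
    proof eventually_elim
      case (elim \<omega>)
      have "\<phi> (Z \<omega>) \<le> Cl" using T_range[OF elim(2)] by (intro cSUP_upper phi(2)) simp
      then have "(f (Z \<omega>))\<^sup>2 * \<phi> (Z \<omega>) \<le> (f (Z \<omega>))\<^sup>2 * Cl" by (rule mult_left_mono) simp
      then show ?case unfolding bZ[OF elim(2)] elim(1)[symmetric] by (simp add: power2_eq_square mult_ac)
    qed
  qed
  finally show ?thesis by simp
qed

lemma Cl_nonneg: "Cl \<ge> 0"
proof -
  have "AE \<omega> in M. 0 \<le> third_envelope (T \<omega>)" using bdd3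
    by eventually_elim (simp add: third_envelope_def T_def sup_nonneg)
  then have "0 \<le> expectation (\<lambda>\<omega>. third_envelope (T \<omega>))" by (rule integral_nonneg_AE)
  also have "\<dots> = expectation (\<lambda>\<omega>. cond_exp M Z (\<lambda>\<omega>. third_envelope (T \<omega>)) \<omega>)"
    using expectation_cond_exp(2)[OF Z_meas _ measurable_compose[OF T_measurable third_measurable], of "\<lambda>_. 1"]
      third_integrable by simp
  also have "\<dots> \<le> expectation (\<lambda>\<omega>. Cl)"
  proof (rule integral_mono_AE)
    show "integrable M (\<lambda>\<omega>. cond_exp M Z (\<lambda>\<omega>. third_envelope (T \<omega>)) \<omega>)"
      using expectation_cond_exp(1)[OF Z_meas _ measurable_compose[OF T_measurable third_measurable], of "\<lambda>_. 1"]
        third_integrable by simp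
    have "AE \<omega> in M. \<phi> (Z \<omega>) = cond_exp M Z (\<lambda>\<omega>. third_envelope (T \<omega>)) \<omega>"
      using phi(1) by (simp add: cond_exp_version_def third_envelope_def T_def)
    then show "AE \<omega> in M. cond_exp M Z (\<lambda>\<omega>. third_envelope (T \<omega>)) \<omega> \<le> Cl"
      using AE_space
    proof eventually_elim
      case (elim \<omega>)
      have "\<phi> (Z \<omega>) \<le> Cl" using T_range[OF elim(2)] by (intro cSUP_upper phi(2)) simp
      then show ?case using elim(1) by simp
    qed
  qed simp
  also have "\<dots> = Cl" by (simp add: prob_space)
  finally show ?thesis .
qed

text \<open>\<open>(P_n - P)[G f k]\<close>, a bilinear form in \<open>f\<close> and \<open>k\<close>.\<close>

definition empirical_form :: "(real \<times> real \<Rightarrow> real) \<Rightarrow> nat \<Rightarrow> 'w \<Rightarrow> (real \<Rightarrow> real) \<Rightarrow> (real \<Rightarrow> real) \<Rightarrow> real" where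
  "empirical_form G n \<omega> f k = (1 / real n) * (\<Sum>i=1..n. G (Ts i \<omega>) * f (Zs i \<omega>) * k (Zs i \<omega>))
     - expectation (\<lambda>\<omega>. G (T \<omega>) * f (Z \<omega>) * k (Z \<omega>))"

text \<open>Each entry of the matrix of the form in the basis is a centred average of independent copies, and its
summands have second moment at most \<open>E(G^2) B^4\<close> because the basis is uniformly bounded.\<close>

lemma empirical_form_tail:
  assumes G: "G \<in> borel_measurable sample_space" and G2: "integrable M (\<lambda>\<omega>. (G (T \<omega>))\<^sup>2)"
    and n: "n \<ge> 1" and w: "\<And>\<nu>. w \<nu> \<ge> 0" "\<And>N. (\<Sum>\<nu><N. w \<nu>) \<le> W" and t: "t > 0"
  shows "\<exists>A\<in>events. prob A \<le> expectation (\<lambda>\<omega>. (G (T \<omega>))\<^sup>2) * B ^ 4 / real n * W\<^sup>2 / t \<and>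
    (\<forall>\<omega>\<in>space M - A. \<forall>N. (\<Sum>\<mu><N. \<Sum>\<nu><N. w \<mu> * w \<nu> * (empirical_form G n \<omega> (h_fun \<mu>) (h_fun \<nu>))\<^sup>2) \<le> t)"
proof -
  let ?c = "expectation (\<lambda>\<omega>. (G (T \<omega>))\<^sup>2) * B ^ 4"
  have c0: "?c \<ge> 0" using B_nonneg by (intro mult_nonneg_nonneg Bochner_Integration.integral_nonneg) auto
  have moments: "integrable M (\<lambda>\<omega>. (empirical_form G n \<omega> (h_fun \<mu>) (h_fun \<nu>))\<^sup>2) \<and>
      expectation (\<lambda>\<omega>. (empirical_form G n \<omega> (h_fun \<mu>) (h_fun \<nu>))\<^sup>2) \<le> ?c / real n" for \<mu> \<nu>
  proof -
    define q where "q = (\<lambda>p. G p * h_fun \<mu> (snd p) * h_fun \<nu> (snd p))"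
    have q: "q \<in> borel_measurable sample_space"
      unfolding q_def using G snd_measurable_sample[OF h_fun_mem] by measurable
    have q2: "(\<lambda>p. (q p)\<^sup>2) \<in> borel_measurable sample_space" using q by measurable
    have le: "(q (T \<omega>))\<^sup>2 \<le> B ^ 4 * (G (T \<omega>))\<^sup>2" if "\<omega> \<in> space M" for \<omega>
    proof -
      have "\<bar>q (T \<omega>)\<bar> \<le> \<bar>G (T \<omega>)\<bar> * B * B"
        unfolding q_def abs_mult using T_range[OF that] B_nonneg
        by (intro mult_mono h_fun_le) (auto simp: T_def)
      then have "\<bar>q (T \<omega>)\<bar>\<^sup>2 \<le> (\<bar>G (T \<omega>)\<bar> * B * B)\<^sup>2" by (intro power_mono) auto
      then show ?thesis by (simp add: power_mult_distrib power2_eq_square power4_eq_xxxx mult_ac)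
    qed
    have qint: "integrable M (\<lambda>\<omega>. (q (T \<omega>))\<^sup>2)"
    proof (rule Bochner_Integration.integrable_bound)
      show "integrable M (\<lambda>\<omega>. B ^ 4 * (G (T \<omega>))\<^sup>2)" using G2 by simp
      show "(\<lambda>\<omega>. (q (T \<omega>))\<^sup>2) \<in> borel_measurable M" by (rule measurable_compose[OF T_measurable q2])
      show "AE \<omega> in M. norm ((q (T \<omega>))\<^sup>2) \<le> norm (B ^ 4 * (G (T \<omega>))\<^sup>2)"
        by (rule AE_I2) (use le B_nonneg in auto)
    qed
    have qexp: "expectation (\<lambda>\<omega>. (q (T \<omega>))\<^sup>2) \<le> ?c"
      using integral_mono[OF qint _ le] G2 by (simp add: mult.commute)
    have ind: "indep_vars (\<lambda>_. borel) (\<lambda>i \<omega>. q (Ts i \<omega>)) {1..}"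
      by (rule indep_vars_compose2[OF Ts_indep]) (rule q)
    have eq: "empirical_form G n \<omega> (h_fun \<mu>) (h_fun \<nu>) = (1 / real n) * (\<Sum>i=1..n. q (Ts i \<omega>)) - expectation (\<lambda>\<omega>. q (T \<omega>))" for \<omega>
      by (simp add: empirical_form_def q_def T_def Ts_def)
    have i: "\<And>i. i \<ge> 1 \<Longrightarrow> integrable M (\<lambda>\<omega>. (q (Ts i \<omega>))\<^sup>2)"
      "\<And>i. i \<ge> 1 \<Longrightarrow> expectation (\<lambda>\<omega>. q (Ts i \<omega>)) = expectation (\<lambda>\<omega>. q (T \<omega>))"
      "\<And>i. i \<ge> 1 \<Longrightarrow> expectation (\<lambda>\<omega>. (q (Ts i \<omega>))\<^sup>2) \<le> ?c"
      using transfer[OF q] transfer[OF q2] qint qexp by auto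
    show ?thesis unfolding eq using mean_square_deviation_indep[OF ind i n] by blast
  qed
  show ?thesis
    using weighted_square_sum_tail[of "\<lambda>\<mu> \<nu> \<omega>. empirical_form G n \<omega> (h_fun \<mu>) (h_fun \<nu>)" "?c / real n" w W t]
      moments c0 w t by simp
qed

text \<open>Boundedness of the third derivative is a measurable property of an observation, so it passes from
\<open>T\<close> to each of its copies.\<close>

lemma bdd3_sample: "AE \<omega> in M. \<forall>i\<ge>1. bdd_above ((\<lambda>a. \<bar>dl 3 l (Ys i \<omega>) a\<bar>) ` {lo<..<hi})"
proof -
  define P where "P = (\<lambda>p :: real \<times> real. bdd_above ((\<lambda>a. \<bar>dl 3 l (fst p) a\<bar>) ` {lo<..<hi}) :: bool)"
  have "{y \<in> \<Y>. bdd_above ((\<lambda>a. \<bar>dl 3 l y a\<bar>) ` {lo<..<hi})} \<in> sets (restrict_space borel \<Y>)"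
    by (rule sup_dl_measurable) simp
  from measurable_sets[OF fst_measurable_sample this]
  have P: "{p \<in> space sample_space. P p} \<in> sets sample_space"
    by (rule back_subst[of "\<lambda>A. A \<in> sets sample_space"]) (auto simp: P_def space_sample_space)
  have "AE \<omega> in M. P (T \<omega>)" using bdd3 by (simp add: P_def T_def)
  then have AE_T: "AE p in distr M sample_space T. P p"
    unfolding AE_distr_iff[OF T_measurable P] .
  have "AE \<omega> in M. P (Ts i \<omega>)" if "i \<ge> 1" for i
    using AE_T unfolding Ts_distr[OF that, symmetric] AE_distr_iff[OF Ts_measurable[OF that] P] .
  then have "AE \<omega> in M. \<forall>i. i \<ge> 1 \<longrightarrow> P (Ts i \<omega>)"
    unfolding AE_all_countable by auto
  then show ?thesis by (simp add: P_def Ts_def)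
qed

lemma function_form_pen:
  assumes "lam > 0"
  shows "function_form H (pip lam)"
proof
  show "H \<noteq> {}" using g0 by auto
  show "(\<lambda>z. f z + a * g z) \<in> H" if "f \<in> H" "g \<in> H" for f g a using H_lincomb that .
  show "pip lam (\<lambda>z. f z + a * g z) k = pip lam f k + a * pip lam g k"
    if "f \<in> H" "g \<in> H" "k \<in> H" for f g k a
    using V_lincomb[OF that] roughness_lincomb[of f m g k a] H_sobolev that m
    by (simp add: pen_inner_def algebra_simps)
  show "pip lam f g = pip lam g f" for f g
    unfolding pen_inner_def by (simp only: V_sym[of f] roughness_sym[of m f])
  show "0 \<le> pip lam f f" if "f \<in> H" for f
    using V_ge(2)[OF that] roughness_nonneg[of m f] assms by (simp add: pen_inner_def)
qed

lemma gamma_nonneg: "\<gamma> \<nu> \<ge> 0"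
  using roughness_nonneg[of m "h_fun \<nu>"] diag_J[of \<nu> \<nu>] by simp

lemma basis_form_pen:
  assumes lam: "lam > 0" and K: "reproducing_kernel H (pip lam) K"
    and expansion: "\<And>g. g \<in> H \<Longrightarrow>
      (\<lambda>N. pnorm lam
         (\<lambda>z. g z - (\<Sum>\<nu><N. V_form M Y Z l g0 g (h_fun \<nu>) * h_fun \<nu> z))) \<longlonglongrightarrow> 0"
  shows "basis_form H (pip lam) h_fun (\<lambda>\<nu>. 1 + lam * \<gamma> \<nu>) B
    (\<lambda>g \<nu>. V g (h_fun \<nu>)) K"
proof -
  interpret function_form H "pip lam" by (rule function_form_pen[OF lam])
  have nrm: "nrm f = pnorm lam f" for f by (simp add: nrm_def pen_norm_def)
  show ?thesis
  proof
    show "0 < 1 + lam * \<gamma> \<nu>" for \<nu> using gamma_nonneg[of \<nu>] lam by (simp add: add_pos_nonneg)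
    show "pip lam (h_fun \<mu>) (h_fun \<nu>) = (if \<mu> = \<nu> then 1 + lam * \<gamma> \<mu> else 0)" for \<mu> \<nu>
      by (simp add: pen_inner_def diag_V diag_J)
  qed (use h_fun_mem h_fun_le expansion K in \<open>auto simp: nrm reproducing_kernel_def\<close>)
qed

end

section \<open>First-order condition and error of the linear representation\<close>

context spline_model
begin

text \<open>Along the line \<open>gh + t k\<close> the penalized criterion is differentiable in \<open>t\<close> and maximal at \<open>t = 0\<close>.\<close>

lemma first_order_condition:
  assumes \<omega>: "\<omega> \<in> space M" and gh: "gh \<in> H" and k: "k \<in> H"
    and max: "\<And>f. f \<in> H \<Longrightarrow> pen_lik l m Ys Zs n lam \<omega> f \<le> pen_lik l m Ys Zs n lam \<omega> gh"
  shows "(1 / real n) * (\<Sum>i=1..n. dl 1 l (Ys i \<omega>) (gh (Zs i \<omega>)) * k (Zs i \<omega>)) = lam * roughness m gh k"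
proof -
  let ?J = "roughness m"
  have J: "?J (\<lambda>z. gh z + t * k z) (\<lambda>z. gh z + t * k z) = ?J gh gh + 2 * t * ?J gh k + t\<^sup>2 * ?J k k" for t
  proof -
    note S = H_sobolev[OF gh] H_sobolev[OF k] H_sobolev[OF H_lincomb[OF gh k]]
    have "?J (\<lambda>z. gh z + t * k z) (\<lambda>z. gh z + t * k z) = ?J gh (\<lambda>z. gh z + t * k z) + t * ?J k (\<lambda>z. gh z + t * k z)"
      by (intro roughness_lincomb S m)
    also have "?J gh (\<lambda>z. gh z + t * k z) = ?J gh gh + t * ?J k gh"
      by (subst roughness_sym) (intro roughness_lincomb S m)
    also have "?J k (\<lambda>z. gh z + t * k z) = ?J gh k + t * ?J k k"
      by (subst roughness_sym) (intro roughness_lincomb S m)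
    finally show ?thesis by (simp add: roughness_sym[of m k gh] power2_eq_square algebra_simps)
  qed
  define \<Phi> where "\<Phi> = (\<lambda>t. (1 / real n) * (\<Sum>i=1..n. l (Ys i \<omega>) (gh (Zs i \<omega>) + t * k (Zs i \<omega>)))
    - (lam / 2) * (?J gh gh + 2 * t * ?J gh k + t\<^sup>2 * ?J k k))"
  have \<Phi>: "\<Phi> t = pen_lik l m Ys Zs n lam \<omega> (\<lambda>z. gh z + t * k z)" for t
    by (simp add: \<Phi>_def pen_lik_def J)
  have le: "\<Phi> t \<le> \<Phi> 0" for t
    using max[OF H_lincomb[OF gh k, of t]] by (simp add: \<Phi>)
  have dl: "((\<lambda>t. l (Ys i \<omega>) (gh (Zs i \<omega>) + t * k (Zs i \<omega>))) has_field_derivative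
      dl 1 l (Ys i \<omega>) (gh (Zs i \<omega>)) * k (Zs i \<omega>)) (at 0)" if "i \<in> {1..n}" for i
  proof -
    have "Ys i \<omega> \<in> \<Y>" using Ti_range[of i \<omega>] \<omega> that by auto
    then have "(l (Ys i \<omega>) has_field_derivative dl 1 l (Ys i \<omega>) (gh (Zs i \<omega>) + 0 * k (Zs i \<omega>)))
        (at (gh (Zs i \<omega>) + 0 * k (Zs i \<omega>)))"
      using dl_derivative[of "Ys i \<omega>" 0] by (simp add: dl_def)
    then show ?thesis
      by (rule DERIV_chain2[where g = "\<lambda>t. gh (Zs i \<omega>) + t * k (Zs i \<omega>)", THEN DERIV_cong])
        (auto intro!: derivative_eq_intros)
  qed
  have "(\<Phi> has_field_derivative (1 / real n) * (\<Sum>i=1..n. dl 1 l (Ys i \<omega>) (gh (Zs i \<omega>)) * k (Zs i \<omega>))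
      - (lam / 2) * (2 * ?J gh k)) (at 0)"
    unfolding \<Phi>_def
  proof (intro DERIV_diff DERIV_cmult DERIV_sum dl)
    show "((\<lambda>t. ?J gh gh + 2 * t * ?J gh k + t\<^sup>2 * ?J k k) has_field_derivative 2 * ?J gh k) (at 0)"
      by (auto intro!: derivative_eq_intros)
  qed
  then have "(1 / real n) * (\<Sum>i=1..n. dl 1 l (Ys i \<omega>) (gh (Zs i \<omega>)) * k (Zs i \<omega>)) - (lam / 2) * (2 * ?J gh k) = 0"
    by (rule DERIV_local_max[of _ _ _ 1]) (use le in auto)
  then show ?thesis by simp
qed

lemma empirical_form_sym: "empirical_form G n \<omega> f k = empirical_form G n \<omega> k f"
  unfolding empirical_form_def by (simp add: mult_ac)

lemma empirical_form_lincomb: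
  assumes G: "integrable M (\<lambda>\<omega>. G (T \<omega>))" and f: "f \<in> H" "g \<in> H" "k \<in> H"
  shows "empirical_form G n \<omega> (\<lambda>z. f z + a * g z) k = empirical_form G n \<omega> f k + a * empirical_form G n \<omega> g k"
proof -
  have "expectation (\<lambda>\<omega>. G (T \<omega>) * (f (Z \<omega>) + a * g (Z \<omega>)) * k (Z \<omega>))
      = expectation (\<lambda>\<omega>. G (T \<omega>) * f (Z \<omega>) * k (Z \<omega>) + a * (G (T \<omega>) * g (Z \<omega>) * k (Z \<omega>)))"
    by (intro Bochner_Integration.integral_cong) (auto simp: algebra_simps)
  also have "\<dots> = expectation (\<lambda>\<omega>. G (T \<omega>) * f (Z \<omega>) * k (Z \<omega>)) + a * expectation (\<lambda>\<omega>. G (T \<omega>) * g (Z \<omega>) * k (Z \<omega>))"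
    using integrable_weighted[OF G] f by simp
  finally show ?thesis
    by (simp add: empirical_form_def algebra_simps sum.distrib sum_distrib_left add_divide_distrib sum_divide_distrib)
qed

text \<open>The constant \<open>b\<close> below depends on the sample and may be large: it only shows that the form is
continuous. The bound itself is that of the Hilbert--Schmidt norm.\<close>

lemma empirical_form_operator_bound:
  assumes lam: "lam > 0" and K: "reproducing_kernel H (pip lam) K"
    and conv: "\<And>g. g \<in> H \<Longrightarrow>
      (\<lambda>N. pnorm lam (\<lambda>z. g z - (\<Sum>\<nu><N. V g (h_fun \<nu>) * h_fun \<nu> z))) \<longlonglongrightarrow> 0"
    and G: "integrable M (\<lambda>\<omega>. G (T \<omega>))"
    and w: "\<And>N. (\<Sum>\<nu><N. 1 / (1 + lam * \<gamma> \<nu>)) \<le> W"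
    and tail: "\<And>N. (\<Sum>\<mu><N. \<Sum>\<nu><N. 1 / (1 + lam * \<gamma> \<mu>) * (1 / (1 + lam * \<gamma> \<nu>))
      * (empirical_form G n \<omega> (h_fun \<mu>) (h_fun \<nu>))\<^sup>2) \<le> t"
    and \<omega>: "\<omega> \<in> space M" and f: "f \<in> H" and k: "k \<in> H"
  shows "\<bar>empirical_form G n \<omega> f k\<bar> \<le> sqrt t * pnorm lam f * pnorm lam k"
proof -
  interpret basis_form H "pip lam" h_fun "\<lambda>\<nu>. 1 + lam * \<gamma> \<nu>" B "\<lambda>g \<nu>. V g (h_fun \<nu>)" K
    by (rule basis_form_pen[OF lam K conv])
  have nrm: "pnorm lam f = nrm f" for f by (simp add: nrm_def pen_norm_def)
  define a where "a = B * sqrt W"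
  have a: "a \<ge> 0" using B_nonneg w[of 0] by (simp add: a_def)
  have sup: "\<bar>f z\<bar> \<le> a * nrm f" if "f \<in> H" "z \<in> {0..1}" for f z
    unfolding a_def by (rule sup_bound[OF that w])
  have prod: "\<bar>c * f z * k z\<bar> \<le> \<bar>c\<bar> * (a * nrm f * (a * nrm k))" if "f \<in> H" "k \<in> H" "z \<in> {0..1}" for f k z c
    unfolding abs_mult mult.assoc[of "\<bar>c\<bar>"] using sup that a nrm_nonneg
    by (intro mult_left_mono mult_mono) auto
  \<comment> \<open>The size of the form when both arguments are bounded by 1.\<close>
  define b where "b = (1 / real n) * (\<Sum>i=1..n. \<bar>G (Ts i \<omega>)\<bar>) + expectation (\<lambda>\<omega>. \<bar>G (T \<omega>)\<bar>)"
  have bdd: "\<bar>empirical_form G n \<omega> f k\<bar> \<le> (b * (a * a)) * nrm f * nrm k" if fk: "f \<in> H" "k \<in> H" for f k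
  proof -
    let ?c = "a * nrm f * (a * nrm k)"
    have "\<bar>(1 / real n) * (\<Sum>i=1..n. G (Ts i \<omega>) * f (Zs i \<omega>) * k (Zs i \<omega>))\<bar>
        \<le> (1 / real n) * (\<Sum>i=1..n. \<bar>G (Ts i \<omega>)\<bar> * ?c)"
      unfolding abs_mult[of "1 / real n"] using Ti_range \<omega> fk
      by (intro mult_mono order_trans[OF sum_abs sum_mono[OF prod]]) auto
    moreover have "\<bar>expectation (\<lambda>\<omega>. G (T \<omega>) * f (Z \<omega>) * k (Z \<omega>))\<bar> \<le> expectation (\<lambda>\<omega>. \<bar>G (T \<omega>)\<bar> * ?c)"
    proof (rule order_trans[OF integral_abs_bound integral_mono])
      show "integrable M (\<lambda>\<omega>. \<bar>G (T \<omega>) * f (Z \<omega>) * k (Z \<omega>)\<bar>)"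
        by (intro integrable_abs integrable_weighted G fk)
      show "integrable M (\<lambda>\<omega>. \<bar>G (T \<omega>)\<bar> * ?c)" using G by simp
    qed (use prod fk T_range in auto)
    ultimately have "\<bar>empirical_form G n \<omega> f k\<bar> \<le> (1 / real n) * (\<Sum>i=1..n. \<bar>G (Ts i \<omega>)\<bar> * ?c) + expectation (\<lambda>\<omega>. \<bar>G (T \<omega>)\<bar> * ?c)"
      unfolding empirical_form_def by linarith
    also have "\<dots> = b * ?c" using G by (simp add: b_def sum_distrib_right[symmetric] distrib_right)
    finally show ?thesis by (simp add: mult_ac)
  qed
  have "\<bar>empirical_form G n \<omega> f k\<bar> \<le> sqrt t * nrm f * nrm k"
  proof (rule bilinear_bound[OF _ _ bdd _ f k])
    show "empirical_form G n \<omega> (\<lambda>z. f z + a * g z) k = empirical_form G n \<omega> f k + a * empirical_form G n \<omega> g k"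
      if "f \<in> H" "g \<in> H" "k \<in> H" for f g k a using empirical_form_lincomb[OF G that] .
    show "empirical_form G n \<omega> k (\<lambda>z. f z + a * g z) = empirical_form G n \<omega> k f + a * empirical_form G n \<omega> k g"
      if "f \<in> H" "g \<in> H" "k \<in> H" for f g k a
      using empirical_form_lincomb[OF G that] by (simp only: empirical_form_sym[of G n \<omega> k])
    show "(\<Sum>\<mu><N. \<Sum>\<nu><N. (empirical_form G n \<omega> (h_fun \<mu>) (h_fun \<nu>))\<^sup>2 / ((1 + lam * \<gamma> \<mu>) * (1 + lam * \<gamma> \<nu>))) \<le> t" for N
      using tail[of N] by simp
  qed
  then show ?thesis by (simp add: nrm)
qed

lemma pen_norm_nonneg: "lam > 0 \<Longrightarrow> f \<in> H \<Longrightarrow> pnorm lam f \<ge> 0"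
  using function_form.ip_nonneg[OF function_form_pen] by (simp add: pen_norm_def)

lemma sup_le_pen_norm:
  assumes lam: "lam > 0" and K: "reproducing_kernel H (pip lam) K"
    and conv: "\<And>g. g \<in> H \<Longrightarrow>
      (\<lambda>N. pnorm lam (\<lambda>z. g z - (\<Sum>\<nu><N. V g (h_fun \<nu>) * h_fun \<nu> z))) \<longlonglongrightarrow> 0"
    and w: "\<And>N. (\<Sum>\<nu><N. 1 / (1 + lam * \<gamma> \<nu>)) \<le> W"
    and f: "f \<in> H" and z: "z \<in> {0..1}"
  shows "\<bar>f z\<bar> \<le> B * sqrt W * pnorm lam f"
proof -
  interpret basis_form H "pip lam" h_fun "\<lambda>\<nu>. 1 + lam * \<gamma> \<nu>" B "\<lambda>g \<nu>. V g (h_fun \<nu>)" K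
    by (rule basis_form_pen[OF lam K conv])
  show ?thesis using sup_bound[OF f z w] by (simp add: nrm_def pen_norm_def)
qed

text \<open>The deterministic core. On the event where the two Hilbert--Schmidt norms are at most \<open>sqrt t2\<close> and
\<open>sqrt t3\<close> and the estimate stays in the interval, the identity for \<open>\<langle>f, f\<rangle>\<close> is bounded by a multiple of
\<open>\<parallel>f\<parallel>\<close>, which can be cancelled.\<close>

lemma representation_error_bound:
  fixes gh :: "real \<Rightarrow> real"
  assumes lam: "lam > 0" and K: "reproducing_kernel H (pip lam) K"
    and conv: "\<And>g. g \<in> H \<Longrightarrow>
      (\<lambda>N. pnorm lam (\<lambda>z. g z - (\<Sum>\<nu><N. V g (h_fun \<nu>) * h_fun \<nu> z))) \<longlonglongrightarrow> 0"
    and Wg0: "Wg0 \<in> H" "\<And>f. f \<in> H \<Longrightarrow> pip lam Wg0 f = lam * roughness m g0 f"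
    and \<omega>: "\<omega> \<in> space M" and gh: "gh \<in> H"
    and max: "\<And>f. f \<in> H \<Longrightarrow> pen_lik l m Ys Zs n lam \<omega> f \<le> pen_lik l m Ys Zs n lam \<omega> gh"
    and w: "\<And>N. (\<Sum>\<nu><N. 1 / (1 + lam * \<gamma> \<nu>)) \<le> W"
    and tail2: "\<And>N. (\<Sum>\<mu><N. \<Sum>\<nu><N. 1 / (1 + lam * \<gamma> \<mu>) * (1 / (1 + lam * \<gamma> \<nu>))
      * (empirical_form curvature n \<omega> (h_fun \<mu>) (h_fun \<nu>))\<^sup>2) \<le> t2"
    and tail3: "\<And>N. (\<Sum>\<mu><N. \<Sum>\<nu><N. 1 / (1 + lam * \<gamma> \<mu>) * (1 / (1 + lam * \<gamma> \<nu>))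
      * (empirical_form third_envelope n \<omega> (h_fun \<mu>) (h_fun \<nu>))\<^sup>2) \<le> t3"
    and bdd: "\<And>i. i \<ge> 1 \<Longrightarrow> bdd_above ((\<lambda>a. \<bar>dl 3 l (Ys i \<omega>) a\<bar>) ` {lo<..<hi})"
    and range: "\<And>z. z \<in> {0..1} \<Longrightarrow> gh z \<in> {lo<..<hi}"
  defines "g \<equiv> (\<lambda>z. gh z - g0 z)"
  shows "\<bar>pnorm lam (\<lambda>z. gh z - g0 z - score l g0 Ys Zs K Wg0 n \<omega> z)\<bar>
    \<le> sqrt t2 * pnorm lam g
      + B * sqrt W * (Cl * C\<^sub>2 + sqrt t3) * (pnorm lam g)\<^sup>2"
proof -
  interpret basis_form H "pip lam" h_fun "\<lambda>\<nu>. 1 + lam * \<gamma> \<nu>" B "\<lambda>g \<nu>. V g (h_fun \<nu>)" K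
    by (rule basis_form_pen[OF lam K conv])
  let ?ip = "pip lam" and ?J = "roughness m"
  have nrm: "pnorm lam f = nrm f" for f by (simp add: nrm_def pen_norm_def)
  define \<epsilon> where "\<epsilon> = (\<lambda>i. dl 1 l (Ys i \<omega>) (g0 (Zs i \<omega>)))"
  define Ks where "Ks = (\<lambda>z. \<Sum>i\<in>{1..n}. (\<epsilon> i / real n) * K (Zs i \<omega>) z)"
  define s where "s = (\<lambda>z. Ks z - Wg0 z)"
  have Zi: "Zs i \<omega> \<in> {0..1}" "Ys i \<omega> \<in> \<Y>" if "i \<in> {1..n}" for i
    using Ti_range[of i \<omega>] \<omega> that by auto
  have Ks: "Ks \<in> H" unfolding Ks_def using kernel(1) Zi by (intro sum_mem) auto
  have sH: "s \<in> H" unfolding s_def by (intro diff_mem Ks Wg0)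
  have gH: "g \<in> H" unfolding g_def by (intro diff_mem gh g0)
  have score: "score l g0 Ys Zs K Wg0 n \<omega> = s"
    by (auto simp: score_def s_def Ks_def \<epsilon>_def sum_distrib_left)
  define f where "f = (\<lambda>z. g z - s z)"
  have fH: "f \<in> H" unfolding f_def by (intro diff_mem gH sH)
  have ip_s: "?ip s f = (1 / real n) * (\<Sum>i=1..n. \<epsilon> i * f (Zs i \<omega>)) - lam * ?J g0 f"
  proof -
    have "?ip Ks f = (\<Sum>i\<in>{1..n}. (\<epsilon> i / real n) * ?ip (K (Zs i \<omega>)) f)"
      unfolding Ks_def
      by (rule linear_functional_sum[of "\<lambda>g. ?ip g f"]) (use ip_lincomb fH kernel(1) Zi in auto)
    also have "\<dots> = (\<Sum>i\<in>{1..n}. (\<epsilon> i / real n) * f (Zs i \<omega>))"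
      by (intro sum.cong refl) (simp add: kernel(2)[OF Zi(1) fH])
    finally have "?ip Ks f = (1 / real n) * (\<Sum>i=1..n. \<epsilon> i * f (Zs i \<omega>))"
      by (simp add: sum_distrib_left)
    then show ?thesis unfolding s_def using ip_diff[OF Ks Wg0(1) fH] Wg0(2)[OF fH] by simp
  qed
  have Jg: "?J g f = ?J gh f - ?J g0 f"
    using roughness_lincomb[OF H_sobolev[OF gh] H_sobolev[OF g0] H_sobolev[OF fH] m, of "-1"]
    by (simp add: g_def)
  note foc = first_order_condition[OF \<omega> gh fH max]
  have empc: "V g f = empirical_form curvature n \<omega> g f - (1 / real n) * (\<Sum>i=1..n. curvature (Ts i \<omega>) * g (Zs i \<omega>) * f (Zs i \<omega>))"
    using V_eq_curv[OF gH fH] by (simp add: empirical_form_def)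
  define \<rho> where "\<rho> = (\<lambda>i. dl 1 l (Ys i \<omega>) (gh (Zs i \<omega>)) - \<epsilon> i - curvature (Ts i \<omega>) * g (Zs i \<omega>))"
  have \<rho>: "\<bar>\<rho> i\<bar> \<le> third_envelope (Ts i \<omega>) * g (Zs i \<omega>) * g (Zs i \<omega>)" if i: "i \<in> {1..n}" for i
  proof -
    have i1: "i \<ge> 1" using i by simp
    have g0r: "g0 (Zs i \<omega>) \<in> {lo<..<hi}" using g0_range Zi(1)[OF i] by (simp only: image_subset_iff)
    have ghr: "gh (Zs i \<omega>) \<in> {lo<..<hi}" using range Zi(1)[OF i] .
    have "\<bar>dl 1 l (Ys i \<omega>) (gh (Zs i \<omega>)) - dl 1 l (Ys i \<omega>) (g0 (Zs i \<omega>))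
        - dl 2 l (Ys i \<omega>) (g0 (Zs i \<omega>)) * (gh (Zs i \<omega>) - g0 (Zs i \<omega>))\<bar>
        \<le> third_envelope (Ts i \<omega>) * (gh (Zs i \<omega>) - g0 (Zs i \<omega>))\<^sup>2"
    proof (rule second_order_remainder[where f'' = "dl 3 l (Ys i \<omega>)"])
      show "(dl 1 l (Ys i \<omega>) has_field_derivative dl 2 l (Ys i \<omega>) x) (at x)" for x
        using dl_derivative[OF Zi(2)[OF i], of 1] by (simp add: numeral_2_eq_2)
      show "(dl 2 l (Ys i \<omega>) has_field_derivative dl 3 l (Ys i \<omega>) x) (at x)" for x
        using dl_derivative[OF Zi(2)[OF i], of 2] by (simp add: eval_nat_numeral)
      fix x assume "x \<in> closed_segment (g0 (Zs i \<omega>)) (gh (Zs i \<omega>))"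
      then have "x \<in> {lo<..<hi}"
        using g0r ghr by (auto simp: closed_segment_eq_real_ivl split: if_splits)
      then show "\<bar>dl 3 l (Ys i \<omega>) x\<bar> \<le> third_envelope (Ts i \<omega>)"
        unfolding third_envelope_def Ts_def fst_conv by (rule cSUP_upper[OF _ bdd[OF i1]])
    qed
    then show ?thesis
      by (simp add: \<rho>_def \<epsilon>_def curvature_def Ts_def g_def power2_eq_square mult.assoc)
  qed
  \<comment> \<open>The penalty terms cancel by the first-order condition, and \<open>V g f\<close> is the expectation that centres the form.\<close>
  have main: "?ip f f = empirical_form curvature n \<omega> g f + (1 / real n) * (\<Sum>i=1..n. \<rho> i * f (Zs i \<omega>))"
  proof -
    have "?ip f f = ?ip g f - ?ip s f" unfolding f_def[symmetric]
      using ip_diff[OF gH sH fH] by (simp add: f_def)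
    also have "?ip g f = V g f + lam * (?J gh f - ?J g0 f)"
      by (simp only: pen_inner_def Jg)
    also have "V g f + lam * (?J gh f - ?J g0 f) - ?ip s f
        = V g f + lam * ?J gh f - (1 / real n) * (\<Sum>i=1..n. \<epsilon> i * f (Zs i \<omega>))"
      unfolding ip_s by (simp add: algebra_simps)
    also have "\<dots> = empirical_form curvature n \<omega> g f + (1 / real n) * ((\<Sum>i=1..n. dl 1 l (Ys i \<omega>) (gh (Zs i \<omega>)) * f (Zs i \<omega>))
        - (\<Sum>i=1..n. \<epsilon> i * f (Zs i \<omega>)) - (\<Sum>i=1..n. curvature (Ts i \<omega>) * g (Zs i \<omega>) * f (Zs i \<omega>)))"
      using foc unfolding empc by (simp add: right_diff_distrib)
    also have "(\<Sum>i=1..n. dl 1 l (Ys i \<omega>) (gh (Zs i \<omega>)) * f (Zs i \<omega>))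
        - (\<Sum>i=1..n. \<epsilon> i * f (Zs i \<omega>)) - (\<Sum>i=1..n. curvature (Ts i \<omega>) * g (Zs i \<omega>) * f (Zs i \<omega>))
        = (\<Sum>i=1..n. \<rho> i * f (Zs i \<omega>))"
      by (simp add: \<rho>_def sum_subtractf left_diff_distrib)
    finally show ?thesis .
  qed
  define a where "a = B * sqrt W"
  have a0: "a \<ge> 0" using B_nonneg w[of 0] by (simp add: a_def)
  have sup: "\<bar>f z\<bar> \<le> a * nrm f" if "z \<in> {0..1}" for z
    unfolding a_def by (rule sup_bound[OF fH that w])
  have E2: "\<bar>empirical_form curvature n \<omega> g f\<bar> \<le> sqrt t2 * nrm g * nrm f"
    using empirical_form_operator_bound[OF lam K conv curv_integrable w tail2 \<omega> gH fH] by (simp add: nrm)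
  have E3: "(1 / real n) * (\<Sum>i=1..n. third_envelope (Ts i \<omega>) * g (Zs i \<omega>) * g (Zs i \<omega>)) \<le> (Cl * C\<^sub>2 + sqrt t3) * (nrm g)\<^sup>2"
  proof -
    have "(1 / real n) * (\<Sum>i=1..n. third_envelope (Ts i \<omega>) * g (Zs i \<omega>) * g (Zs i \<omega>))
        = empirical_form third_envelope n \<omega> g g + expectation (\<lambda>\<omega>. third_envelope (T \<omega>) * g (Z \<omega>) * g (Z \<omega>))"
      by (simp add: empirical_form_def)
    also have "\<dots> \<le> sqrt t3 * nrm g * nrm g + Cl * (C\<^sub>2 * (nrm g)\<^sup>2)"
    proof (rule add_mono)
      show "empirical_form third_envelope n \<omega> g g \<le> sqrt t3 * nrm g * nrm g"
        using empirical_form_operator_bound[OF lam K conv third_integrable w tail3 \<omega> gH gH] by (simp add: nrm)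
      have "V g g \<le> (nrm g)\<^sup>2"
        using nrm_sq[OF gH] roughness_nonneg[of m g] lam by (simp add: pen_inner_def)
      then have "expectation (\<lambda>\<omega>. (g (Z \<omega>))\<^sup>2) \<le> C\<^sub>2 * (nrm g)\<^sup>2"
        using V_ge(1)[OF gH] C_pos(3) by (meson mult_left_mono order_trans less_imp_le)
      then show "expectation (\<lambda>\<omega>. third_envelope (T \<omega>) * g (Z \<omega>) * g (Z \<omega>)) \<le> Cl * (C\<^sub>2 * (nrm g)\<^sup>2)"
        using third_le[OF gH] Cl_nonneg by (meson mult_left_mono order_trans)
    qed
    also have "\<dots> = (Cl * C\<^sub>2 + sqrt t3) * (nrm g)\<^sup>2" by (simp add: power2_eq_square algebra_simps)
    finally show ?thesis .
  qed
  have "(nrm f)\<^sup>2 \<le> (sqrt t2 * nrm g + a * ((Cl * C\<^sub>2 + sqrt t3) * (nrm g)\<^sup>2)) * nrm f"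
  proof -
    have "(1 / real n) * (\<Sum>i=1..n. \<rho> i * f (Zs i \<omega>))
        \<le> (1 / real n) * (\<Sum>i=1..n. third_envelope (Ts i \<omega>) * g (Zs i \<omega>) * g (Zs i \<omega>) * (a * nrm f))"
    proof (intro mult_left_mono sum_mono)
      fix i assume i: "i \<in> {1..n}"
      have "\<rho> i * f (Zs i \<omega>) \<le> \<bar>\<rho> i\<bar> * \<bar>f (Zs i \<omega>)\<bar>" by (simp add: abs_mult[symmetric])
      also have "\<dots> \<le> third_envelope (Ts i \<omega>) * g (Zs i \<omega>) * g (Zs i \<omega>) * (a * nrm f)"
        using \<rho>[OF i] sup[OF Zi(1)[OF i]] by (intro mult_mono) auto
      finally show "\<rho> i * f (Zs i \<omega>) \<le> third_envelope (Ts i \<omega>) * g (Zs i \<omega>) * g (Zs i \<omega>) * (a * nrm f)" .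
    qed simp
    also have "\<dots> = ((1 / real n) * (\<Sum>i=1..n. third_envelope (Ts i \<omega>) * g (Zs i \<omega>) * g (Zs i \<omega>))) * (a * nrm f)"
      by (simp add: sum_distrib_right sum_divide_distrib)
    also have "\<dots> \<le> ((Cl * C\<^sub>2 + sqrt t3) * (nrm g)\<^sup>2) * (a * nrm f)"
      using E3 a0 nrm_nonneg[OF fH] by (intro mult_right_mono) auto
    finally show ?thesis using main nrm_sq[OF fH] E2 by (simp add: algebra_simps)
  qed
  then have "nrm f \<le> sqrt t2 * nrm g + a * ((Cl * C\<^sub>2 + sqrt t3) * (nrm g)\<^sup>2)"
  proof (cases "nrm f = 0")
    case True
    have "t2 \<ge> 0" "t3 \<ge> 0" using tail2[of 0] tail3[of 0] by auto
    then show ?thesis using True a0 Cl_nonneg C_pos(3) nrm_nonneg[OF gH] by simp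
  next
    case False
    then have "nrm f > 0" using nrm_nonneg[OF fH] by simp
    moreover assume "(nrm f)\<^sup>2 \<le> (sqrt t2 * nrm g + a * ((Cl * C\<^sub>2 + sqrt t3) * (nrm g)\<^sup>2)) * nrm f"
    ultimately show ?thesis by (simp add: power2_eq_square)
  qed
  then show ?thesis
    unfolding nrm score a_def using f_def g_def nrm_nonneg[OF fH] by (simp add: mult.assoc)
qed

end

section \<open>Spectral weights and rates\<close>

text \<open>A sum against an integral: each term with \<open>\<nu> \<ge> 1\<close> is at most the increment of \<open>arctan (h x) / h\<close>
over \<open>[\<nu> - 1, \<nu>]\<close>.\<close>

lemma sum_inverse_quadratic_le:
  assumes h: "h > 0"
  shows "(\<Sum>\<nu><N. 1 / (1 + (h * real \<nu>)\<^sup>2)) \<le> 1 + (pi / 2) / h"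
proof -
  have step: "1 / (1 + b\<^sup>2) * (b - a) \<le> arctan b - arctan a" if ab: "0 \<le> a" "a < b" for a b :: real
  proof -
    obtain z where z: "a < z" "z < b" "arctan b - arctan a = (b - a) * inverse (1 + z\<^sup>2)"
      using MVT2[OF ab(2), of arctan "\<lambda>x. inverse (1 + x\<^sup>2)"] DERIV_arctan by blast
    have "z\<^sup>2 \<le> b\<^sup>2" using z ab by (intro power_mono) auto
    then have "1 / (1 + b\<^sup>2) \<le> inverse (1 + z\<^sup>2)"
      by (simp add: inverse_eq_divide frac_le add_pos_nonneg)
    then have "(b - a) * (1 / (1 + b\<^sup>2)) \<le> (b - a) * inverse (1 + z\<^sup>2)"
      using ab by (intro mult_left_mono) auto
    then show ?thesis using z(3) by (metis mult.commute)
  qed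
  have "(\<Sum>\<nu><Suc N. 1 / (1 + (h * real \<nu>)\<^sup>2)) \<le> 1 + arctan (h * real N) / h" for N
  proof (induction N)
    case (Suc N)
    have "1 / (1 + (h * real (Suc N))\<^sup>2) * (h * real (Suc N) - h * real N)
        \<le> arctan (h * real (Suc N)) - arctan (h * real N)"
      using h by (intro step) auto
    then have "1 / (1 + (h * real (Suc N))\<^sup>2) \<le> (arctan (h * real (Suc N)) - arctan (h * real N)) / h"
      using h by (simp add: field_simps)
    then show ?case using Suc by (simp add: diff_divide_distrib)
  qed simp
  moreover have "arctan (h * real N) / h \<le> (pi / 2) / h" for N
    by (intro divide_right_mono less_imp_le[OF arctan_ubound]) (use h in simp)
  ultimately have "(\<Sum>\<nu><Suc N. 1 / (1 + (h * real \<nu>)\<^sup>2)) \<le> 1 + (pi / 2) / h" by (meson add_left_mono order_trans)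
  moreover have "(\<Sum>\<nu><N. 1 / (1 + (h * real \<nu>)\<^sup>2)) \<le> (\<Sum>\<nu><Suc N. 1 / (1 + (h * real \<nu>)\<^sup>2))"
    by (simp add: add_nonneg_nonneg)
  ultimately show ?thesis by linarith
qed

text \<open>The effective dimension is of order \<open>1 / h\<close>. As \<open>\<gamma> \<nu>\<close> grows like \<open>\<nu>^(2m)\<close> with \<open>m \<ge> 1\<close>, the weights are
bounded by a multiple of \<open>1 / (1 + (h \<nu>)^2)\<close>, where the finitely many indices before the growth sets in
are absorbed into the constant.\<close>

lemma spectral_weights_bound:
  assumes m: "m \<ge> 1" and gam: "asymp_order \<gamma> (\<lambda>\<nu>. real \<nu> ^ (2 * m))" and nonneg: "\<And>\<nu>. \<gamma> \<nu> \<ge> 0"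
  obtains \<kappa> where "\<kappa> > 0"
    "\<And>h N. 0 < h \<Longrightarrow> h \<le> 1 \<Longrightarrow> (\<Sum>\<nu><N. 1 / (1 + h ^ (2 * m) * \<gamma> \<nu>)) \<le> \<kappa> / h"
proof -
  obtain c where c: "c > 0" "(\<lambda>\<nu>. \<gamma> \<nu> / real \<nu> ^ (2 * m)) \<longlonglongrightarrow> c"
    using gam by (auto simp: asymp_order_def)
  then have "\<forall>\<^sub>F \<nu> in sequentially. c / 2 < \<gamma> \<nu> / real \<nu> ^ (2 * m)"
    by (intro order_tendstoD) auto
  then obtain N0 where N0: "\<And>\<nu>. \<nu> \<ge> N0 \<Longrightarrow> c / 2 < \<gamma> \<nu> / real \<nu> ^ (2 * m)"
    by (auto simp: eventually_sequentially)
  define c' where "c' = min (c / 2) 1"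
  have c': "c' > 0" "c' \<le> c / 2" "c' \<le> 1" using c(1) by (auto simp: c'_def)
  \<comment> \<open>The first entry serves the indices beyond \<open>N0\<close>, the second one the finitely many others.\<close>
  define k where "k = max (2 / c') (1 + (real (Suc N0))\<^sup>2)"
  have "0 < 1 + (real (Suc N0))\<^sup>2" by (rule add_pos_nonneg) auto
  also have "\<dots> \<le> k" by (simp add: k_def)
  finally have k: "k > 0" .
  have weight_le: "1 / (1 + h ^ (2 * m) * \<gamma> \<nu>) \<le> k * (1 / (1 + (h * real \<nu>)\<^sup>2))" if h: "0 < h" "h \<le> 1" for h \<nu>
  proof -
    have "1 + (h * real \<nu>)\<^sup>2 \<le> k * (1 + h ^ (2 * m) * \<gamma> \<nu>)"
    proof (cases "\<nu> \<ge> Suc N0")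
      case True
      then have "c / 2 < \<gamma> \<nu> / real \<nu> ^ (2 * m)" "real \<nu> ^ (2 * m) > 0" using N0[of \<nu>] by auto
      then have g: "c / 2 * real \<nu> ^ (2 * m) \<le> \<gamma> \<nu>" by (simp add: pos_less_divide_eq)
      define x where "x = h * real \<nu>"
      have x: "x \<ge> 0" using h by (simp add: x_def)
      have double: "1 + a \<le> 2 * (1 + b)" if "a \<le> 1 + b" "0 \<le> b" for a b :: real
        using that by argo
      have "x\<^sup>2 \<le> 1 + x ^ (2 * m)"
      proof (cases "x \<le> 1")
        case True
        then have "x\<^sup>2 \<le> 1" using x by (simp add: power_le_one)
        then show ?thesis using x by (simp add: add_increasing2)
      next
        case False
        then have "x ^ 2 \<le> x ^ (2 * m)" using m by (intro power_increasing) auto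
        then show ?thesis by simp
      qed
      then have "1 + x\<^sup>2 \<le> 2 * (1 + x ^ (2 * m))"
        by (rule double) (rule zero_le_power[OF x])
      also have "\<dots> = (2 / c') * (c' * 1 + c' * x ^ (2 * m))" using c' by (simp add: field_simps)
      also have "\<dots> \<le> (2 / c') * (1 + c / 2 * x ^ (2 * m))"
        using c' x by (intro mult_left_mono add_mono mult_right_mono) auto
      also have "c / 2 * x ^ (2 * m) = h ^ (2 * m) * (c / 2 * real \<nu> ^ (2 * m))"
        by (simp add: x_def power_mult_distrib)
      also have "(2 / c') * (1 + h ^ (2 * m) * (c / 2 * real \<nu> ^ (2 * m))) \<le> (2 / c') * (1 + h ^ (2 * m) * \<gamma> \<nu>)"
        using c' h g by (intro mult_left_mono add_left_mono) auto
      also have "\<dots> \<le> k * (1 + h ^ (2 * m) * \<gamma> \<nu>)"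
        using h nonneg[of \<nu>] by (intro mult_right_mono) (auto simp: k_def)
      finally show ?thesis by (simp add: x_def)
    next
      case False
      have "h * real \<nu> \<le> 1 * real (Suc N0)" using False h by (intro mult_mono) auto
      then have "1 + (h * real \<nu>)\<^sup>2 \<le> 1 + (real (Suc N0))\<^sup>2" using h by (intro add_left_mono power_mono) auto
      also have "\<dots> \<le> k" by (simp add: k_def)
      also have "k \<le> k * (1 + h ^ (2 * m) * \<gamma> \<nu>)" using k h nonneg[of \<nu>] by simp
      finally show ?thesis .
    qed
    moreover have "1 + h ^ (2 * m) * \<gamma> \<nu> > 0" "1 + (h * real \<nu>)\<^sup>2 > 0"
      using h nonneg[of \<nu>] by (auto intro!: add_pos_nonneg)
    ultimately show ?thesis by (simp add: field_simps)
  qed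
  show ?thesis
  proof (rule that[of "k * 3"])
    show "(\<Sum>\<nu><N. 1 / (1 + h ^ (2 * m) * \<gamma> \<nu>)) \<le> k * 3 / h" if h: "0 < h" "h \<le> 1" for h N
    proof -
      have "(\<Sum>\<nu><N. 1 / (1 + h ^ (2 * m) * \<gamma> \<nu>)) \<le> k * (\<Sum>\<nu><N. 1 / (1 + (h * real \<nu>)\<^sup>2))"
        unfolding sum_distrib_left by (rule sum_mono) (rule weight_le[OF h])
      also have "\<dots> \<le> k * (1 + (pi / 2) / h)"
        using k h by (intro mult_left_mono sum_inverse_quadratic_le) auto
      also have "1 + (pi / 2) / h \<le> 1 / h + 2 / h"
        using h pi_less_4 by (intro add_mono divide_right_mono) auto
      then have "k * (1 + (pi / 2) / h) \<le> k * (3 / h)" using k by (intro mult_left_mono) (auto simp: field_simps)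
      finally show ?thesis by simp
    qed
  qed (use k in simp)
qed

text \<open>For \<open>h \<le> 1\<close> the exponent \<open>(6m - 1) / (4m) \<ge> 1\<close> makes the claimed power of \<open>h\<close> at least \<open>h^(-1)\<close>, and
the logarithms are at least 1 for large \<open>n\<close>.\<close>

lemma rate_dominates:
  fixes h C :: real and n m :: nat
  assumes m: "m \<ge> 1" and h: "0 < h" "h \<le> 1" and C: "C \<ge> 0" and n: "ln (ln (real n)) \<ge> 1" "ln (real n) \<ge> 1"
  defines "r \<equiv> (real n * h) powr (-1/2) + h ^ m"
  shows "real n powr (-1/2) * inverse h * r + C * h powr (-1/2) * (inverse (real n * h) + h ^ (2 * m))
    \<le> bahadur_rate m C h n * ln (real n)"
proof -
  have r: "r \<ge> 0" using h by (simp add: r_def)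
  have "real n powr (-1/2) * inverse h * r
      \<le> real n powr (-1/2) * r * h powr (- (6 * real m - 1) / (4 * real m)) * (sqrt (ln (ln (real n))) * ln (real n))"
  proof -
    have "h powr (-1) \<le> h powr (- (6 * real m - 1) / (4 * real m))"
      using h m by (intro powr_mono') (auto simp: field_simps)
    then have 1: "inverse h \<le> h powr (- (6 * real m - 1) / (4 * real m))" using h by (simp add: powr_minus)
    have 2: "1 \<le> sqrt (ln (ln (real n))) * ln (real n)"
      using n mult_mono[of 1 "sqrt (ln (ln (real n)))" 1 "ln (real n)"] by simp
    have "inverse h * 1 \<le> h powr (- (6 * real m - 1) / (4 * real m)) * (sqrt (ln (ln (real n))) * ln (real n))"
      using 1 2 h by (intro mult_mono) auto
    then have "(real n powr (-1/2) * r) * (inverse h * 1)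
        \<le> (real n powr (-1/2) * r) * (h powr (- (6 * real m - 1) / (4 * real m)) * (sqrt (ln (ln (real n))) * ln (real n)))"
      using r by (intro mult_left_mono) auto
    then show ?thesis by (simp add: mult_ac)
  qed
  moreover have "bahadur_rate m C h n * ln (real n)
      = real n powr (-1/2) * r * h powr (- (6 * real m - 1) / (4 * real m)) * (sqrt (ln (ln (real n))) * ln (real n))
        + C * h powr (-1/2) * (inverse (real n * h) + h ^ (2 * m))"
    using n(2) by (simp add: bahadur_rate_def r_def distrib_right)
  ultimately show ?thesis by simp
qed

text \<open>Insert \<open>h = q n^(-s)\<close> with \<open>s = 1 / (2m + 1)\<close> and \<open>q\<close> convergent. After division by \<open>n^(-m s)\<close> the
first term is \<open>n^(s (6m - 1) / (4m) - 1/2)\<close> up to logarithms, and its exponent is negative because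
\<open>(2m - 1)^2 > 0\<close>; the second term is \<open>n^(-(m - 1/2) s)\<close>.\<close>

lemma bahadur_rate_optimal_bandwidth:
  assumes m: "m \<ge> 1" and h: "\<And>n. h n > 0"
    and opt: "asymp_order h (\<lambda>n. real n powr (-1 / (2 * real m + 1)))"
  shows "(\<lambda>n. bahadur_rate m C (h n) n * ln (real n) / real n powr (- real m / (2 * real m + 1))) \<longlonglongrightarrow> 0"
proof -
  define s where "s = 1 / (2 * real m + 1)"
  define q where "q = (\<lambda>n. h n / real n powr (- s))"
  define e where "e = (6 * real m - 1) / (4 * real m)"
  have s: "s > 0" "1 - s = 2 * (real m * s)" by (auto simp: s_def field_simps)
  obtain c where c: "c > 0" "q \<longlonglongrightarrow> c"
    using opt by (auto simp: asymp_order_def q_def s_def)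
  define \<eta> where "\<eta> = 1/2 - s * e"
  have \<eta>: "\<eta> > 0"
  proof -
    have "s * e < 1/2"
    proof -
      have "0 < (2 * real m - 1)\<^sup>2" using m by (simp add: zero_less_power2)
      then show ?thesis using m by (simp add: s_def e_def power2_eq_square field_simps)
    qed
    then show ?thesis by (simp add: \<eta>_def)
  qed
  define \<eta>' where "\<eta>' = (real m - 1/2) * s"
  have \<eta>': "\<eta>' > 0" using s m by (simp add: \<eta>'_def)
  have eq: "bahadur_rate m C (h n) n * ln (real n) / real n powr (- real m / (2 * real m + 1))
      = (q n powr (-1/2) + q n ^ m) * q n powr (- e) * (real n powr (- \<eta>) * sqrt (ln (ln (real n))) * ln (real n))
        + C * q n powr (-1/2) * (inverse (q n) + q n ^ (2 * m)) * real n powr (- \<eta>')"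
    if n: "n \<ge> 3" for n
  proof -
    define x where "x = real n"
    define Q where "Q = q n"
    have x: "x > 1" using n by (simp add: x_def)
    have Q: "Q > 0" using h[of n] x by (simp add: Q_def q_def x_def)
    have hn: "h n = Q * x powr (- s)" using x by (simp add: Q_def q_def x_def)
    have nh: "x * h n = Q * x powr (1 - s)"
      using x by (simp add: hn powr_diff powr_minus field_simps)
    have ms: "- real m / (2 * real m + 1) = - (real m * s)" by (simp add: s_def)
    have p1: "(x * h n) powr (-1/2) = Q powr (-1/2) * x powr (- (real m * s))"
      unfolding nh using Q x s(2) by (simp add: powr_mult powr_powr)
    have p2: "h n ^ k = Q ^ k * x powr (- (real k * s))" for k
      unfolding hn using x by (simp add: power_mult_distrib powr_power mult_ac)
    have p3: "h n powr a = Q powr a * x powr (- s * a)" for a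
      unfolding hn using Q x by (simp add: powr_mult powr_powr)
    have p4: "inverse (x * h n) = inverse Q * x powr (- (2 * real m * s))"
      unfolding nh using s(2) by (simp add: powr_minus mult_ac)
    have lnx: "ln x \<noteq> 0" using x by simp
    have alg: "(a + b / L) * L / D = a * L / D + b / D" if "L \<noteq> 0" for a b L D :: real
      using that by (simp add: add_divide_distrib distrib_right)
    have p2m: "h n ^ (2 * m) = Q ^ (2 * m) * x powr (- (2 * real m * s))"
      using p2[of "2 * m"] by simp
    have p3e: "h n powr (- (6 * real m - 1) / (4 * real m)) = Q powr (- e) * x powr (s * e)"
    proof -
      have "- (6 * real m - 1) / (4 * real m) = - e" unfolding e_def by (rule minus_divide_left[symmetric])
      then show ?thesis using p3[of "- e"] by simp
    qed
    have p3h: "h n powr (-1/2) = Q powr (-1/2) * x powr (s / 2)"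
      using p3[of "-1/2"] by simp
    have "bahadur_rate m C (h n) n * ln x / x powr (- (real m * s))
        = x powr (-1/2) * (Q powr (-1/2) * x powr (- (real m * s)) + Q ^ m * x powr (- (real m * s)))
          * (Q powr (- e) * x powr (s * e)) * sqrt (ln (ln x)) * ln x / x powr (- (real m * s))
        + C * (Q powr (-1/2) * x powr (s / 2)) * (inverse Q * x powr (- (2 * real m * s)) + Q ^ (2 * m) * x powr (- (2 * real m * s)))
          / x powr (- (real m * s))"
      unfolding bahadur_rate_def x_def[symmetric] p1 p2[of m] p2m p3e p3h p4
      by (rule alg[OF lnx])
    also have "\<dots> = (Q powr (-1/2) + Q ^ m) * Q powr (- e)
          * ((x powr (-1/2) * x powr (s * e)) * sqrt (ln (ln x)) * ln x)
        + C * Q powr (-1/2) * (inverse Q + Q ^ (2 * m))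
          * (x powr (s / 2) * x powr (- (2 * real m * s)) / x powr (- (real m * s)))"
      using x by (simp add: field_simps)
    also have "x powr (-1/2) * x powr (s * e) = x powr (- \<eta>)"
      unfolding \<eta>_def by (simp add: powr_add[symmetric])
    also have "x powr (s / 2) * x powr (- (2 * real m * s)) / x powr (- (real m * s)) = x powr (- \<eta>')"
      unfolding \<eta>'_def by (simp add: powr_add[symmetric] powr_diff[symmetric] algebra_simps)
    finally show ?thesis unfolding ms x_def Q_def .
  qed
  have l1: "(\<lambda>n. real n powr (- \<eta>) * sqrt (ln (ln (real n))) * ln (real n)) \<longlonglongrightarrow> 0"
    using \<eta> by real_asymp
  have l2: "(\<lambda>n. real n powr (- \<eta>')) \<longlonglongrightarrow> 0"
    using \<eta>' by real_asymp
  have "(\<lambda>n. (q n powr (-1/2) + q n ^ m) * q n powr (- e) * (real n powr (- \<eta>) * sqrt (ln (ln (real n))) * ln (real n))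
        + C * q n powr (-1/2) * (inverse (q n) + q n ^ (2 * m)) * real n powr (- \<eta>'))
      \<longlonglongrightarrow> (c powr (-1/2) + c ^ m) * c powr (- e) * 0 + C * c powr (-1/2) * (inverse c + c ^ (2 * m)) * 0"
    using c by (intro tendsto_intros l1 l2) auto
  then have lim0: "(\<lambda>n. (q n powr (-1/2) + q n ^ m) * q n powr (- e) * (real n powr (- \<eta>) * sqrt (ln (ln (real n))) * ln (real n))
        + C * q n powr (-1/2) * (inverse (q n) + q n ^ (2 * m)) * real n powr (- \<eta>')) \<longlonglongrightarrow> 0" by simp
  show ?thesis
    by (rule Lim_transform_eventually[OF lim0])
      (use eq in \<open>auto simp: eventually_sequentially intro!: exI[of _ 3]\<close>)
qed

lemma smallOP_of_bigOP:
  assumes X: "bigOP M X r" and lim: "(\<lambda>n. r n / s n) \<longlonglongrightarrow> 0" and s: "\<And>n. n \<ge> 1 \<Longrightarrow> s n > 0"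
  shows "smallOP M X s"
  unfolding smallOP_def
proof (intro allI impI)
  fix \<epsilon> \<delta> :: real assume e: "\<epsilon> > 0" and d: "\<delta> > 0"
  obtain C where C: "\<forall>\<^sub>F n in sequentially. \<exists>A\<in>sets M.
     {\<omega> \<in> space M. \<bar>X n \<omega>\<bar> > C * r n} \<subseteq> A \<and> measure M A < \<epsilon>"
    using X e unfolding bigOP_def by blast
  have "(\<lambda>n. C * (r n / s n)) \<longlonglongrightarrow> C * 0" by (intro tendsto_intros lim)
  then have "\<forall>\<^sub>F n in sequentially. C * (r n / s n) < \<delta>" using d by (intro order_tendstoD) auto
  then show "\<forall>\<^sub>F n in sequentially. \<exists>A\<in>sets M. {\<omega> \<in> space M. \<bar>X n \<omega>\<bar> > \<delta> * s n} \<subseteq> A \<and> measure M A < \<epsilon>"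
    using C eventually_ge_at_top[of 1]
  proof eventually_elim
    case (elim n)
    have "C * r n < \<delta> * s n" using elim(1) s[OF elim(3)] by (simp add: field_simps)
    then have "{\<omega> \<in> space M. \<bar>X n \<omega>\<bar> > \<delta> * s n} \<subseteq> {\<omega> \<in> space M. \<bar>X n \<omega>\<bar> > C * r n}" by auto
    then show ?case using elim(2) by (meson order_trans)
  qed
qed

section \<open>The functional Bahadur representation\<close>

lemma powr_minus_half:
  assumes "x \<ge> 0"
  shows "x powr (-1/2) = inverse (sqrt x)"
proof -
  have "x powr (-1/2) = x powr (- (1/2))" by simp
  also have "\<dots> = inverse (x powr (1/2))" by (rule powr_minus)
  finally show ?thesis using assms by (simp only: powr_half_sqrt)
qed

text \<open>Here \<open>p\<close> is the norm of the estimation error, \<open>r\<close> its rate, \<open>u = h^(-1/2)\<close>, \<open>x = n^(-1/2) h^(-1)\<close> and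
\<open>D = (n h)^(-1) + h^(2m)\<close>. The mixed term \<open>u x r^2\<close> is absorbed into \<open>x r\<close> since \<open>u r \<le> 1\<close>.\<close>

lemma combine_error_terms:
  fixes p r u x D Cl b c\<^sub>2 s2 s3 C :: real
  assumes p: "0 \<le> p" "p \<le> C * r" and nn: "0 \<le> r" "0 \<le> u" "0 \<le> x" "0 \<le> D" "0 \<le> Cl" "0 \<le> b" "0 \<le> c\<^sub>2" "0 \<le> s2" "0 \<le> s3" "0 \<le> C"
    and ur: "u * r \<le> 1" and rD: "r\<^sup>2 \<le> 2 * D"
    and a: "s2 * C + b * s3 * C\<^sup>2 \<le> a" "2 * b * c\<^sub>2 * C\<^sup>2 \<le> a"
  shows "s2 * x * p + b * u * (Cl * c\<^sub>2 + s3 * x) * p\<^sup>2 \<le> a * (x * r + Cl * u * D)"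
proof -
  have p2: "p\<^sup>2 \<le> C\<^sup>2 * r\<^sup>2" using power_mono[OF p(2,1), of 2] by (simp add: power_mult_distrib)
  have "s2 * x * p \<le> s2 * x * (C * r)" using p nn by (intro mult_left_mono) auto
  moreover have "b * u * (Cl * c\<^sub>2 + s3 * x) * p\<^sup>2 \<le> b * u * (Cl * c\<^sub>2 + s3 * x) * (C\<^sup>2 * r\<^sup>2)"
    using p2 nn by (intro mult_left_mono) auto
  moreover have "b * u * (Cl * c\<^sub>2 + s3 * x) * (C\<^sup>2 * r\<^sup>2)
      = (b * s3 * C\<^sup>2 * x * r) * (u * r) + b * u * (Cl * c\<^sub>2) * (C\<^sup>2 * r\<^sup>2)"
    by (simp add: power2_eq_square algebra_simps)
  moreover have "(b * s3 * C\<^sup>2 * x * r) * (u * r) \<le> (b * s3 * C\<^sup>2 * x * r) * 1"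
    using ur nn by (intro mult_left_mono) auto
  moreover have "b * u * (Cl * c\<^sub>2) * (C\<^sup>2 * r\<^sup>2) \<le> b * u * (Cl * c\<^sub>2) * (C\<^sup>2 * (2 * D))"
    using rD nn by (intro mult_left_mono) auto
  moreover have "s2 * x * (C * r) + ((b * s3 * C\<^sup>2 * x * r) * 1 + b * u * (Cl * c\<^sub>2) * (C\<^sup>2 * (2 * D)))
      = (s2 * C + b * s3 * C\<^sup>2) * (x * r) + (2 * b * c\<^sub>2 * C\<^sup>2) * (Cl * u * D)"
    by (simp add: algebra_simps)
  ultimately have "s2 * x * p + b * u * (Cl * c\<^sub>2 + s3 * x) * p\<^sup>2
      \<le> (s2 * C + b * s3 * C\<^sup>2) * (x * r) + (2 * b * c\<^sub>2 * C\<^sup>2) * (Cl * u * D)"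
    by linarith
  also have "\<dots> \<le> a * (x * r) + a * (Cl * u * D)"
    using a nn by (intro add_mono mult_right_mono) auto
  finally show ?thesis by (simp add: algebra_simps)
qed

context spline_model
begin

text \<open>The image of the compact unit interval under \<open>g0\<close> keeps a positive distance from the ends of the
open interval.\<close>

lemma g0_margin:
  obtains \<delta> where "\<delta> > 0" "\<And>z a. z \<in> {0..1} \<Longrightarrow> \<bar>a - g0 z\<bar> < \<delta> \<Longrightarrow> a \<in> {lo<..<hi}"
proof -
  have ne: "compact {0..1::real}" "{0..1::real} \<noteq> {}" by auto
  obtain x where x: "x \<in> {0..1}" "\<And>z. z \<in> {0..1} \<Longrightarrow> g0 x \<le> g0 z"
    using continuous_attains_inf[OF ne H_continuous[OF g0]] by blast
  obtain y where y: "y \<in> {0..1}" "\<And>z. z \<in> {0..1} \<Longrightarrow> g0 z \<le> g0 y"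
    using continuous_attains_sup[OF ne H_continuous[OF g0]] by blast
  have xy: "lo < g0 x" "g0 y < hi" using g0_range x(1) y(1) by (auto simp only: image_subset_iff greaterThanLessThan_iff)
  show ?thesis
  proof (rule that[of "min (g0 x - lo) (hi - g0 y)"])
    show "a \<in> {lo<..<hi}" if "z \<in> {0..1}" "\<bar>a - g0 z\<bar> < min (g0 x - lo) (hi - g0 y)" for z a
      using x(2)[OF that(1)] y(2)[OF that(1)] that(2) by (auto simp: abs_if split: if_splits)
  qed (use xy in auto)
qed

text \<open>For large \<open>n\<close> the exceptional event is the union of five: the estimation error exceeds its rate, the
estimate is no maximizer, one of the two Hilbert--Schmidt norms is large, or a third derivative is
unbounded. Off this event the estimate lies in the interval, because its uniform distance from \<open>g0\<close> is
\<open>O(h^(-1/2) ((n h)^(-1/2) + h^m))\<close>, which tends to 0 by \<open>n h^2 \<rightarrow> \<infinity>\<close> and \<open>m \<ge> 1\<close>.\<close>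

lemma bahadur_bigOP:
  fixes lam h :: "nat \<Rightarrow> real" and ghat :: "nat \<Rightarrow> 'w \<Rightarrow> real \<Rightarrow> real"
    and K :: "nat \<Rightarrow> real \<Rightarrow> real \<Rightarrow> real" and W :: "nat \<Rightarrow> (real \<Rightarrow> real) \<Rightarrow> (real \<Rightarrow> real)"
  assumes gamma: "asymp_order \<gamma> (\<lambda>\<nu>. real \<nu> ^ (2 * m))"
    and lam: "\<And>n. lam n > 0" and h: "\<And>n. h n = lam n powr (1 / (2 * real m))"
    and K: "\<And>n. reproducing_kernel H (pip (lam n)) (K n)"
    and W: "\<And>n g. g \<in> H \<Longrightarrow> W n g \<in> H \<and>
      (\<forall>f\<in>H. pip (lam n) (W n g) f = lam n * roughness m g f)"
    and ghat: "prob_tending_to_one M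
      (\<lambda>n \<omega>. unique_maximizer H (pen_lik l m Ys Zs n (lam n) \<omega>) (ghat n \<omega>))"
    and conv: "\<And>n g. g \<in> H \<Longrightarrow>
      (\<lambda>N. pnorm (lam n) (\<lambda>z. g z - (\<Sum>\<nu><N. V g (h_fun \<nu>) * h_fun \<nu> z))) \<longlonglongrightarrow> 0"
    and rate: "bigOP M (\<lambda>n \<omega>. pnorm (lam n) (\<lambda>z. ghat n \<omega> z - g0 z))
      (\<lambda>n. (real n * h n) powr (-1/2) + h n ^ m)"
    and h_lim: "h \<longlonglongrightarrow> 0" and nh2: "filterlim (\<lambda>n. real n * (h n)\<^sup>2) at_top sequentially"
  shows "bigOP M
      (\<lambda>n \<omega>. pnorm (lam n)
         (\<lambda>z. ghat n \<omega> z - g0 z - score l g0 Ys Zs (K n) (W n g0) n \<omega> z))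
      (\<lambda>n. bahadur_rate m Cl (h n) n * ln (real n))"
  unfolding bigOP_def
proof (intro allI impI)
  fix e :: real assume e: "e > 0"
  have h_pos: "h n > 0" for n using lam[of n] by (simp add: h)
  have lam_h: "lam n = h n ^ (2 * m)" for n
    using lam[of n] m by (simp add: h powr_power)
  obtain \<kappa> where \<kappa>: "\<kappa> > 0"
    "\<And>h N. 0 < h \<Longrightarrow> h \<le> 1 \<Longrightarrow> (\<Sum>\<nu><N. 1 / (1 + h ^ (2 * m) * \<gamma> \<nu>)) \<le> \<kappa> / h"
    using spectral_weights_bound[OF m gamma gamma_nonneg] by blast
  define r where "r = (\<lambda>n. (real n * h n) powr (-1/2) + h n ^ m)"
  have r0: "r n \<ge> 0" for n using h_pos[of n] by (simp add: r_def)
  define v2 where "v2 = expectation (\<lambda>\<omega>. (curvature (T \<omega>))\<^sup>2) * B ^ 4 * \<kappa>\<^sup>2"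
  define v3 where "v3 = expectation (\<lambda>\<omega>. (third_envelope (T \<omega>))\<^sup>2) * B ^ 4 * \<kappa>\<^sup>2"
  have v: "v2 \<ge> 0" "v3 \<ge> 0" using B_nonneg by (auto simp: v2_def v3_def intro!: mult_nonneg_nonneg)
  \<comment> \<open>Thresholds at which Markov's inequality gives probability at most \<open>e / 8\<close>; the summand 1 keeps them positive if the second moment vanishes.\<close>
  define q2 where "q2 = 8 * v2 / e + 1"
  define q3 where "q3 = 8 * v3 / e + 1"
  have q: "q2 > 0" "q3 > 0" "v2 / q2 \<le> e / 8" "v3 / q3 \<le> e / 8"
    using v e by (auto simp: q2_def q3_def field_simps intro!: add_nonneg_pos)
  obtain C' where C': "\<forall>\<^sub>F n in sequentially. \<exists>A\<in>events.
     {\<omega> \<in> space M. \<bar>pnorm (lam n) (\<lambda>z. ghat n \<omega> z - g0 z)\<bar> > C' * r n} \<subseteq> A \<and> prob A < e / 4"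
    using rate e unfolding bigOP_def r_def by (meson divide_pos_pos zero_less_numeral)
  \<comment> \<open>The constant in a stochastic order bound may be negative.\<close>
  define C where "C = max C' 0"
  have C: "C \<ge> 0" "C' \<le> C" by (auto simp: C_def)
  obtain Ag where Ag: "\<And>n. Ag n \<in> events" "(\<lambda>n. prob (Ag n)) \<longlonglongrightarrow> 1"
    "\<And>n \<omega>. \<omega> \<in> Ag n \<Longrightarrow> unique_maximizer H (pen_lik l m Ys Zs n (lam n) \<omega>) (ghat n \<omega>)"
    using ghat unfolding prob_tending_to_one_def by blast
  have ev_g: "\<forall>\<^sub>F n in sequentially. 1 - e / 4 < prob (Ag n)"
    using Ag(2) e by (intro order_tendstoD) auto
  obtain \<delta> where \<delta>: "\<delta> > 0" "\<And>z a. z \<in> {0..1} \<Longrightarrow> \<bar>a - g0 z\<bar> < \<delta> \<Longrightarrow> a \<in> {lo<..<hi}"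
    using g0_margin by blast
  obtain N where N: "{\<omega> \<in> space M. \<not> (\<forall>i\<ge>1. bdd_above ((\<lambda>a. \<bar>dl 3 l (Ys i \<omega>) a\<bar>) ` {lo<..<hi}))} \<subseteq> N"
    "emeasure M N = 0" "N \<in> events"
    using bdd3_sample by (rule AE_E)
  have N0: "prob N = 0" using N(2) by (simp add: measure_def)
  have ev_h: "\<forall>\<^sub>F n in sequentially. h n \<le> 1"
    using order_tendstoD(2)[OF h_lim, of 1] by (auto elim: eventually_mono)
  have ev_ln: "\<forall>\<^sub>F n in sequentially. ln (ln (real n)) \<ge> 1" "\<forall>\<^sub>F n in sequentially. ln (real n) \<ge> 1"
    by real_asymp+
  have ur_lim: "(\<lambda>n. h n powr (-1/2) * r n) \<longlonglongrightarrow> 0"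
  proof -
    have l1: "(\<lambda>n. (real n * (h n)\<^sup>2) powr (-1/2)) \<longlonglongrightarrow> 0"
      by (rule tendsto_neg_powr[OF _ nh2]) simp
    have l2: "(\<lambda>n. h n powr (1/2)) \<longlonglongrightarrow> 0"
      using tendsto_powr'[OF h_lim tendsto_const[of "1/2"]] h_pos by (simp add: less_imp_le)
    have "\<forall>\<^sub>F n in sequentially. norm (h n powr (-1/2) * r n) \<le> (real n * (h n)\<^sup>2) powr (-1/2) + h n powr (1/2)"
      using ev_h
    proof eventually_elim
      case (elim n)
      have "h n powr (-1/2) * (real n * h n) powr (-1/2) = (real n * (h n)\<^sup>2) powr (-1/2)"
        using h_pos[of n] by (simp add: powr_mult[symmetric] power2_eq_square mult_ac)
      moreover have "h n powr (-1/2) * h n ^ m \<le> h n powr (1/2)"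
      proof -
        have "h n ^ m \<le> h n ^ 1" using elim h_pos[of n] m by (intro power_decreasing) auto
        then have "h n powr (-1/2) * h n ^ m \<le> h n powr (-1/2) * h n powr 1"
          using h_pos[of n] by (intro mult_left_mono) auto
        also have "\<dots> = h n powr (1/2)" by (simp only: powr_add[symmetric]) simp
        finally show ?thesis .
      qed
      ultimately have "h n powr (-1/2) * r n \<le> (real n * (h n)\<^sup>2) powr (-1/2) + h n powr (1/2)"
        by (simp add: r_def distrib_left)
      moreover have "h n powr (-1/2) * r n \<ge> 0" using r0[of n] by simp
      ultimately show ?case by simp
    qed
    then show ?thesis
      using tendsto_add[OF l1 l2] by (intro Lim_null_comparison[of "\<lambda>n. h n powr (-1/2) * r n"]) auto
  qed
  have ev_1: "\<forall>\<^sub>F n in sequentially. h n powr (-1/2) * r n < 1"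
    using ur_lim by (intro order_tendstoD) auto
  have ev_\<delta>: "\<forall>\<^sub>F n in sequentially. B * sqrt \<kappa> * C * (h n powr (-1/2) * r n) < \<delta>"
    using tendsto_mult[OF tendsto_const[of "B * sqrt \<kappa> * C"] ur_lim] \<delta>(1) by (intro order_tendstoD) auto
  define a where "a = max (sqrt q2 * C + B * sqrt \<kappa> * sqrt q3 * C\<^sup>2) (2 * (B * sqrt \<kappa>) * C\<^sub>2 * C\<^sup>2)"
  show "\<exists>C. \<forall>\<^sub>F n in sequentially. \<exists>A\<in>events.
      {\<omega> \<in> space M. C * (bahadur_rate m Cl (h n) n * ln (real n)) <
        \<bar>pnorm (lam n) (\<lambda>z. ghat n \<omega> z - g0 z - score l g0 Ys Zs (K n) (W n g0) n \<omega> z)\<bar>} \<subseteq> A \<and>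
      prob A < e"
  proof (rule exI[of _ a])
    show "\<forall>\<^sub>F n in sequentially. \<exists>A\<in>events.
      {\<omega> \<in> space M. a * (bahadur_rate m Cl (h n) n * ln (real n)) <
        \<bar>pnorm (lam n) (\<lambda>z. ghat n \<omega> z - g0 z - score l g0 Ys Zs (K n) (W n g0) n \<omega> z)\<bar>} \<subseteq> A \<and>
      prob A < e"
      using C' ev_g ev_h ev_ln ev_1 ev_\<delta> eventually_ge_at_top[of 1]
    proof eventually_elim
      case (elim n)
      have n: "n \<ge> 1" "real n > 0" using elim(8) by auto
      have hn: "h n > 0" "h n \<le> 1" using h_pos elim(3) by auto
      obtain A0 where A0: "A0 \<in> events" "prob A0 < e / 4"
        "{\<omega> \<in> space M. \<bar>pnorm (lam n) (\<lambda>z. ghat n \<omega> z - g0 z)\<bar> > C' * r n} \<subseteq> A0"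
        using elim(1) by blast
      define w where "w = \<kappa> / h n"
      have w: "(\<Sum>\<nu><N. 1 / (1 + lam n * \<gamma> \<nu>)) \<le> w" for N
        unfolding lam_h w_def by (rule \<kappa>(2)[OF hn])
      have wnn: "1 / (1 + lam n * \<gamma> \<nu>) \<ge> 0" for \<nu>
        using lam[of n] gamma_nonneg[of \<nu>] by simp
      define t2 where "t2 = q2 / (real n * (h n)\<^sup>2)"
      define t3 where "t3 = q3 / (real n * (h n)\<^sup>2)"
      have t: "t2 > 0" "t3 > 0" using q n hn by (auto simp: t2_def t3_def)
      obtain A2 where A2: "A2 \<in> events"
        "prob A2 \<le> expectation (\<lambda>\<omega>. (curvature (T \<omega>))\<^sup>2) * B ^ 4 / real n * w\<^sup>2 / t2"
        "\<And>\<omega> N. \<omega> \<in> space M - A2 \<Longrightarrow> (\<Sum>\<mu><N. \<Sum>\<nu><N. 1 / (1 + lam n * \<gamma> \<mu>) * (1 / (1 + lam n * \<gamma> \<nu>))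
          * (empirical_form curvature n \<omega> (h_fun \<mu>) (h_fun \<nu>))\<^sup>2) \<le> t2"
        using empirical_form_tail[OF curv_measurable curv_square_integrable n(1) wnn w t(1)] by blast
      obtain A3 where A3: "A3 \<in> events"
        "prob A3 \<le> expectation (\<lambda>\<omega>. (third_envelope (T \<omega>))\<^sup>2) * B ^ 4 / real n * w\<^sup>2 / t3"
        "\<And>\<omega> N. \<omega> \<in> space M - A3 \<Longrightarrow> (\<Sum>\<mu><N. \<Sum>\<nu><N. 1 / (1 + lam n * \<gamma> \<mu>) * (1 / (1 + lam n * \<gamma> \<nu>))
          * (empirical_form third_envelope n \<omega> (h_fun \<mu>) (h_fun \<nu>))\<^sup>2) \<le> t3"
        using empirical_form_tail[OF third_measurable third_square_integrable n(1) wnn w t(2)] by blast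
      have p2: "prob A2 \<le> e / 8"
      proof -
        have eq: "expectation (\<lambda>\<omega>. (curvature (T \<omega>))\<^sup>2) * B ^ 4 / real n * w\<^sup>2 / t2 = v2 / q2"
          using n hn q(1) by (simp add: v2_def w_def t2_def power_divide field_simps)
        show ?thesis using A2(2) q(3) unfolding eq by (rule order_trans)
      qed
      have p3: "prob A3 \<le> e / 8"
      proof -
        have eq: "expectation (\<lambda>\<omega>. (third_envelope (T \<omega>))\<^sup>2) * B ^ 4 / real n * w\<^sup>2 / t3 = v3 / q3"
          using n hn q(2) by (simp add: v3_def w_def t3_def power_divide field_simps)
        show ?thesis using A3(2) q(4) unfolding eq by (rule order_trans)
      qed
      have pg: "prob (space M - Ag n) < e / 4" using elim(2) prob_compl[OF Ag(1)] by simp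
      let ?A = "A0 \<union> (space M - Ag n) \<union> A2 \<union> A3 \<union> N"
      have ev: "?A \<in> events" using A0 A2 A3 N Ag by auto
      have "prob ?A \<le> prob A0 + prob (space M - Ag n) + prob A2 + prob A3 + prob N"
      proof -
        have c: "space M - Ag n \<in> events" using Ag(1) by auto
        have u1: "A0 \<union> (space M - Ag n) \<in> events" using A0(1) c by (rule sets.Un)
        have u2: "A0 \<union> (space M - Ag n) \<union> A2 \<in> events" using u1 A2(1) by (rule sets.Un)
        have u3: "A0 \<union> (space M - Ag n) \<union> A2 \<union> A3 \<in> events" using u2 A3(1) by (rule sets.Un)
        show ?thesis
          using measure_Un_le[OF A0(1) c] measure_Un_le[OF u1 A2(1)] measure_Un_le[OF u2 A3(1)]
            measure_Un_le[OF u3 N(3)] by linarith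
      qed
      also have "\<dots> < e" using A0(2) pg p2 p3 N0 e by simp
      finally have pA: "prob ?A < e" .
      have "\<bar>pnorm (lam n) (\<lambda>z. ghat n \<omega> z - g0 z - score l g0 Ys Zs (K n) (W n g0) n \<omega> z)\<bar>
          \<le> a * (bahadur_rate m Cl (h n) n * ln (real n))" if \<omega>: "\<omega> \<in> space M" "\<omega> \<notin> ?A" for \<omega>
      proof -
        have um: "unique_maximizer H (pen_lik l m Ys Zs n (lam n) \<omega>) (ghat n \<omega>)"
          using Ag(3) \<omega> by auto
        then have gh: "ghat n \<omega> \<in> H"
          "\<And>f. f \<in> H \<Longrightarrow> pen_lik l m Ys Zs n (lam n) \<omega> f \<le> pen_lik l m Ys Zs n (lam n) \<omega> (ghat n \<omega>)"
          by (auto simp: unique_maximizer_def)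
        define g where "g = (\<lambda>z. ghat n \<omega> z - g0 z)"
        have gH: "g \<in> H" using H_lincomb[OF gh(1) g0, of "-1"] by (simp add: g_def)
        define p where "p = pnorm (lam n) g"
        have p0: "p \<ge> 0" unfolding p_def by (rule pen_norm_nonneg[OF lam gH])
        have "p \<le> C' * r n" using A0(3) \<omega> by (auto simp: p_def g_def not_less)
        also have "\<dots> \<le> C * r n" using C r0 by (intro mult_right_mono) auto
        finally have pC: "p \<le> C * r n" .
        have sw: "sqrt w = sqrt \<kappa> * h n powr (-1/2)"
          unfolding w_def powr_minus_half[OF less_imp_le[OF hn(1)]] real_sqrt_divide by (rule divide_inverse)
        have range: "ghat n \<omega> z \<in> {lo<..<hi}" if z: "z \<in> {0..1}" for z
        proof (rule \<delta>(2)[OF z])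
          have "\<bar>g z\<bar> \<le> B * sqrt w * p"
            unfolding p_def by (rule sup_le_pen_norm[OF lam K conv w gH z])
          also have "\<dots> \<le> B * sqrt w * (C * r n)"
            using pC B_nonneg \<kappa>(1) hn by (intro mult_left_mono) (auto simp: w_def)
          also have "\<dots> = B * sqrt \<kappa> * C * (h n powr (-1/2) * r n)" by (simp add: sw)
          also have "\<dots> < \<delta>" by (rule elim(7))
          finally show "\<bar>ghat n \<omega> z - g0 z\<bar> < \<delta>" by (simp add: g_def)
        qed
        have bdd: "bdd_above ((\<lambda>a. \<bar>dl 3 l (Ys i \<omega>) a\<bar>) ` {lo<..<hi})" if "i \<ge> 1" for i
        proof (rule ccontr)
          assume "\<not> ?thesis"
          then have "\<not> (\<forall>i\<ge>1. bdd_above ((\<lambda>a. \<bar>dl 3 l (Ys i \<omega>) a\<bar>) ` {lo<..<hi}))"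
            using that by metis
          then have "\<omega> \<in> N" using subsetD[OF N(1), OF CollectI, OF conjI, OF \<omega>(1)] by metis
          then show False using \<omega>(2) by blast
        qed
        have \<omega>2: "\<omega> \<in> space M - A2" "\<omega> \<in> space M - A3" using \<omega> by auto
        have Wg0: "W n g0 \<in> H" "\<And>f. f \<in> H \<Longrightarrow> pip (lam n) (W n g0) f = lam n * roughness m g0 f"
          using W[OF g0] by auto
        let ?x = "real n powr (-1/2) * inverse (h n)" and ?D = "inverse (real n * h n) + h n ^ (2 * m)"
        have st: "sqrt t2 = sqrt q2 * ?x" "sqrt t3 = sqrt q3 * ?x"
          unfolding t2_def t3_def powr_minus_half[OF of_nat_0_le_iff] real_sqrt_divide real_sqrt_mult
          using hn by (simp_all add: divide_inverse)
        have "\<bar>pnorm (lam n) (\<lambda>z. ghat n \<omega> z - g0 z - score l g0 Ys Zs (K n) (W n g0) n \<omega> z)\<bar>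
            \<le> sqrt t2 * p + B * sqrt w * (Cl * C\<^sub>2 + sqrt t3) * p\<^sup>2"
          unfolding p_def g_def
          by (rule representation_error_bound[OF lam K conv Wg0 \<omega>(1) gh w A2(3)[OF \<omega>2(1)] A3(3)[OF \<omega>2(2)] bdd range])
        also have "\<dots> = sqrt q2 * ?x * p + (B * sqrt \<kappa>) * h n powr (-1/2) * (Cl * C\<^sub>2 + sqrt q3 * ?x) * p\<^sup>2"
          unfolding st sw by (simp add: mult.assoc)
        also have "\<dots> \<le> a * (?x * r n + Cl * h n powr (-1/2) * ?D)"
        proof (rule combine_error_terms[OF p0 pC])
          have "(r n)\<^sup>2 \<le> 2 * ((real n * h n) powr (-1/2))\<^sup>2 + 2 * (h n ^ m)\<^sup>2"
            unfolding r_def power2_sum using sum_squares_bound[of "(real n * h n) powr (-1/2)" "h n ^ m"] by linarith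
          also have "((real n * h n) powr (-1/2))\<^sup>2 = inverse (real n * h n)"
          proof -
            have "real n * h n \<ge> 0" using n hn by simp
            then show ?thesis by (simp only: powr_minus_half power_inverse real_sqrt_pow2)
          qed
          also have "(h n ^ m)\<^sup>2 = h n ^ (2 * m)" by (simp add: power_mult[symmetric] mult.commute)
          finally show "(r n)\<^sup>2 \<le> 2 * ?D" by simp
          show "h n powr (-1/2) * r n \<le> 1" using elim(6) by simp
        qed (use r0 n hn Cl_nonneg B_nonneg \<kappa>(1) C_pos q C in \<open>auto simp: a_def\<close>)
        also have "\<dots> \<le> a * (bahadur_rate m Cl (h n) n * ln (real n))"
        proof (rule mult_left_mono)
          show "?x * r n + Cl * h n powr (-1/2) * ?D \<le> bahadur_rate m Cl (h n) n * ln (real n)"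
            unfolding r_def by (rule rate_dominates[OF m hn Cl_nonneg elim(4,5)])
          have "0 \<le> 2 * (B * sqrt \<kappa>) * C\<^sub>2 * C\<^sup>2" using B_nonneg \<kappa>(1) C_pos by simp
          then show "a \<ge> 0" unfolding a_def by (rule max.coboundedI2)
        qed
        finally show ?thesis .
      qed
      then show ?case using ev pA by (intro bexI[of _ ?A]) (auto simp: not_le[symmetric])
    qed
  qed
qed

end

theorem theorem3p4:
  fixes M :: "'w measure"
    and Y Z :: "'w \<Rightarrow> real" and Ys Zs :: "nat \<Rightarrow> 'w \<Rightarrow> real"
    and \<Y> \<I> :: "real set"
    and F g0 \<phi> :: "real \<Rightarrow> real"
    and l :: "real \<Rightarrow> real \<Rightarrow> real"
    and m :: nat
    and H :: "(real \<Rightarrow> real) set"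
    and lam h \<gamma> :: "nat \<Rightarrow> real"
    and ghat :: "nat \<Rightarrow> 'w \<Rightarrow> real \<Rightarrow> real"
    and K :: "nat \<Rightarrow> real \<Rightarrow> real \<Rightarrow> real"
    and W :: "nat \<Rightarrow> (real \<Rightarrow> real) \<Rightarrow> (real \<Rightarrow> real)"
    and h_fun :: "nat \<Rightarrow> real \<Rightarrow> real"
    and C\<^sub>0 C\<^sub>1 C\<^sub>2 lo hi :: real
  \<comment> \<open>data\<close>
  assumes M: "prob_space M"
    and Y_meas: "Y \<in> borel_measurable M" and Z_meas: "Z \<in> borel_measurable M"
    and T_range: "\<And>\<omega>. \<omega> \<in> space M \<Longrightarrow> Y \<omega> \<in> \<Y> \<and> Z \<omega> \<in> {0..1}"
    and Ti_range: "\<And>i \<omega>. i \<ge> 1 \<Longrightarrow> \<omega> \<in> space M \<Longrightarrow> Ys i \<omega> \<in> \<Y> \<and> Zs i \<omega> \<in> {0..1}"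
    and indep: "prob_space.indep_vars M (\<lambda>_. borel) (\<lambda>i \<omega>. (Ys i \<omega>, Zs i \<omega>)) {1..}"
    and ident: "\<And>i. i \<ge> 1 \<Longrightarrow>
      distr M borel (\<lambda>\<omega>. (Ys i \<omega>, Zs i \<omega>)) = distr M borel (\<lambda>\<omega>. (Y \<omega>, Z \<omega>))"
    and Y_int: "integrable M Y"
    and cond_mean: "AE \<omega> in M. cond_exp M Z Y \<omega> = F (g0 (Z \<omega>))"
  \<comment> \<open>function space, true function, criterion function\<close>
    and m: "real m > 1/2"
    and H: "H = sobolev m \<or> H = sobolev_periodic m"
    and g0: "g0 \<in> H"
    and l_meas: "\<And>a. (\<lambda>y. l y a) \<in> borel_measurable (restrict_space borel \<Y>)"
    and criterion: "log_lik_criterion M Y Z \<Y> F g0 l \<or> quasi_lik_criterion M Y Z \<Y> F g0 l"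
  \<comment> \<open>smoothing parameter, kernel, penalty operator, estimate\<close>
    and lambda_pos: "\<And>n. lam n > 0"
    and lambda_lim: "lam \<longlonglongrightarrow> 0"
    and h: "\<And>n. h n = lam n powr (1 / (2 * real m))"
    and K: "\<And>n. reproducing_kernel H (pen_inner M Y Z l g0 m (lam n)) (K n)"
    and W: "\<And>n g. g \<in> H \<Longrightarrow> W n g \<in> H \<and>
      (\<forall>f\<in>H. pen_inner M Y Z l g0 m (lam n) (W n g) f = lam n * roughness m g f)"
    and ghat: "prob_tending_to_one M
      (\<lambda>n \<omega>. unique_maximizer H (pen_lik l m Ys Zs n (lam n) \<omega>) (ghat n \<omega>))"
  \<comment> \<open>condition (1)\<close>
    and smooth: "\<And>y k. y \<in> \<Y> \<Longrightarrow> k < 3 \<Longrightarrow> dl k l y differentiable_on UNIV"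
    and smooth3: "\<And>y. y \<in> \<Y> \<Longrightarrow> continuous_on UNIV (dl 3 l y)"
    and concave: "\<And>y. y \<in> \<Y> \<Longrightarrow> concave_on UNIV (l y)"
    and I_int: "\<I> = {lo<..<hi}" "g0 ` {0..1} \<subseteq> \<I>"
    and C_pos: "C\<^sub>0 > 0" "C\<^sub>1 > 0" "C\<^sub>2 > 0"
    and bdd2: "AE \<omega> in M. bdd_above ((\<lambda>a. \<bar>dl 2 l (Y \<omega>) a\<bar>) ` \<I>)"
    and exp2: "AE \<omega> in M. nonneg_cond_exp M Z
      (\<lambda>\<omega>. exp ((SUP a\<in>\<I>. \<bar>dl 2 l (Y \<omega>) a\<bar>) / C\<^sub>0)) \<omega> \<le> ennreal C\<^sub>0"
    and bdd3: "AE \<omega> in M. bdd_above ((\<lambda>a. \<bar>dl 3 l (Y \<omega>) a\<bar>) ` \<I>)"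
    and exp3: "AE \<omega> in M. nonneg_cond_exp M Z
      (\<lambda>\<omega>. exp ((SUP a\<in>\<I>. \<bar>dl 3 l (Y \<omega>) a\<bar>) / C\<^sub>0)) \<omega> \<le> ennreal C\<^sub>1"
    and info_bounds: "AE \<omega> in M. inverse C\<^sub>2 \<le> info M Y Z l g0 \<omega> \<and> info M Y Z l g0 \<omega> \<le> C\<^sub>2"
    and eps_mean: "AE \<omega> in M. cond_exp M Z (\<lambda>\<omega>. dl 1 l (Y \<omega>) (g0 (Z \<omega>))) \<omega> = 0"
    and eps_var: "AE \<omega> in M. cond_exp M Z (\<lambda>\<omega>. (dl 1 l (Y \<omega>) (g0 (Z \<omega>)))\<^sup>2) \<omega>
      = info M Y Z l g0 \<omega>"
  \<comment> \<open>condition (2)\<close>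
    and h_fun_mem: "\<And>\<nu>. h_fun \<nu> \<in> H"
    and h_fun_bdd: "bdd_above (range (\<lambda>\<nu>. sup_norm (h_fun \<nu>)))"
    and gamma: "mono \<gamma>" "asymp_order \<gamma> (\<lambda>\<nu>. real \<nu> ^ (2 * m))"
    and diag_V: "\<And>\<mu> \<nu>. V_form M Y Z l g0 (h_fun \<mu>) (h_fun \<nu>) = (if \<mu> = \<nu> then 1 else 0)"
    and diag_J: "\<And>\<mu> \<nu>. roughness m (h_fun \<mu>) (h_fun \<nu>) = (if \<mu> = \<nu> then \<gamma> \<mu> else 0)"
    and expansion: "\<And>n g. g \<in> H \<Longrightarrow>
      (\<lambda>N. pen_norm M Y Z l g0 m (lam n)
         (\<lambda>z. g z - (\<Sum>\<nu><N. V_form M Y Z l g0 g (h_fun \<nu>) * h_fun \<nu> z))) \<longlonglongrightarrow> 0"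
  \<comment> \<open>condition (3)\<close>
    and rate: "bigOP M (\<lambda>n \<omega>. pen_norm M Y Z l g0 m (lam n) (\<lambda>z. ghat n \<omega> z - g0 z))
      (\<lambda>n. (real n * h n) powr (-1/2) + h n ^ m)"
  \<comment> \<open>condition (4)\<close>
    and h_lim: "h \<longlonglongrightarrow> 0"
    and nh2: "filterlim (\<lambda>n. real n * (h n)\<^sup>2) at_top sequentially"
  \<comment> \<open>\<open>\<phi> z\<close> is the conditional expectation given \<open>Z = z\<close> whose supremum is the constant \<open>C\<^sub>l\<close>\<close>
    and phi: "cond_exp_version M Z (\<lambda>\<omega>. SUP a\<in>\<I>. \<bar>dl 3 l (Y \<omega>) a\<bar>) \<phi>"
      "bdd_above (\<phi> ` {0..1})"
  shows "bigOP M
      (\<lambda>n \<omega>. pen_norm M Y Z l g0 m (lam n)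
         (\<lambda>z. ghat n \<omega> z - g0 z - score l g0 Ys Zs (K n) (W n g0) n \<omega> z))
      (\<lambda>n. bahadur_rate m (SUP z\<in>{0..1}. \<phi> z) (h n) n * ln (real n))
    \<and> (asymp_order h (\<lambda>n. real n powr (-1 / (2 * real m + 1))) \<longrightarrow>
        (\<forall>X. bigOP M X (\<lambda>n. bahadur_rate m (SUP z\<in>{0..1}. \<phi> z) (h n) n * ln (real n)) \<longrightarrow>
             smallOP M X (\<lambda>n. real n powr (- real m / (2 * real m + 1)))))"
proof -
  have m1: "m \<ge> 1" using m by (cases m) auto
  interpret prob_space M by (rule M)
  interpret spline_model M Y Z Ys Zs \<Y> g0 \<phi> l m H h_fun \<gamma> C\<^sub>0 C\<^sub>1 C\<^sub>2 lo hi
    by unfold_locales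
      (use assms m1 in \<open>simp_all only: I_int(1)\<close>)
  have h_pos: "h n > 0" for n using lambda_pos[of n] by (simp add: h)
  have 1: "bigOP M
      (\<lambda>n \<omega>. pen_norm M Y Z l g0 m (lam n)
         (\<lambda>z. ghat n \<omega> z - g0 z - score l g0 Ys Zs (K n) (W n g0) n \<omega> z))
      (\<lambda>n. bahadur_rate m (SUP z\<in>{0..1}. \<phi> z) (h n) n * ln (real n))"
    by (rule bahadur_bigOP[OF gamma(2) lambda_pos h K W ghat expansion rate h_lim nh2])
  have 2: "smallOP M X (\<lambda>n. real n powr (- real m / (2 * real m + 1)))"
    if "asymp_order h (\<lambda>n. real n powr (-1 / (2 * real m + 1)))"
      "bigOP M X (\<lambda>n. bahadur_rate m (SUP z\<in>{0..1}. \<phi> z) (h n) n * ln (real n))" for X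
    by (rule smallOP_of_bigOP[OF that(2) bahadur_rate_optimal_bandwidth[OF m1 h_pos that(1)]]) simp
  show ?thesis using 1 2 by blast
qed

end
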